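(* Let $\mathbf{E}\to M$ be a complex Sasakian vector bundle over a $7$-dimensional Sasakian manifold $(M^7,\eta,\xi,g,\Phi)$, and let $\mathcal{A}(\mathbf{E})$ be the space of connections on $\mathbf{E}$. If a connection $A\in\mathcal{A}(\mathbf{E})$ is a selfdual contact instanton, i.e. $F_A=\ast(\eta\wedge d\eta\wedge F_A)$, then $A$ is a transverse Hermitian Yang–Mills (HYM) connection, i.e. $\hat F_A:=(F_A,\omega)=0$ and $F_A^{0,2}=0$, where $\omega=d\eta$. Conversely, if moreover $\mathbf{E}$ underlies a holomorphic Sasakian bundle $\mathcal{E}=(\mathbf{E},\bar\partial)$ and $A\in\mathcal{A}(\mathcal{E})$ is an integrable HYM connection, then $A$ is a selfdual contact instanton.
   Context: Sasakian manifold: $(M^{7},\eta,\xi,g,\Phi)$ where $\eta$ is a contact form with Reeb field $\xi$ ($\eta(\xi)=1$, $i_\xi d\eta=0$), $g$ a Riemannian metric, $\Phi\in\mathrm{End}(TM)$, with $g(\xi,\xi)=1$, $\Phi^2=-I+\eta\otimes\xi$, $g(\Phi X,\Phi Y)=g(X,Y)-\eta(X)\eta(Y)$, $\nabla^g_X\xi=-\Phi X$, $(\nabla^g_X\Phi)Y=g(X,Y)\xi-\eta(Y)X$, for $\nabla^g$ the Levi-Civita connection (equivalently the metric cone is Kähler). Put $H=\ker\eta$, $N_\xi=\mathbb{R}\xi$, $J=\Phi|_H$, $\omega=d\eta$, $\sigma=\eta\wedge d\eta$; $\ast$ is the Hodge star. Normalisation and orientation: $\omega$ is regarded as the transverse Kähler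 form, and at each point there is a positively oriented orthonormal coframe $(e^1,\dots,e^6,e^7=\eta)$ with $\omega=e^{14}+e^{25}+e^{36}$ and $e^j+\mathbf{i}e^{j+3}$ ($j=1,2,3$) of type $(1,0)$ (the transverse part of $g$ being scaled by a constant accordingly). With this convention $\ast(\sigma\wedge\cdot)$ acts on horizontal $2$-forms with eigenvalues $1,-1,-2$. Types: $H\otimes\mathbb{C}=H^{1,0}\oplus H^{0,1}$ is the splitting into $\pm\mathbf{i}$-eigenspaces of $J$; it gives the types $(p,q)$ of horizontal complex forms (those with $i_\xi\alpha=0$). $F_A$ is the curvature of $A$, $(F_A,\omega)$ is the pointwise inner product (an endomorphism-valued function), and $F_A^{0,2}$ is the $(0,2)$-component of $F_A$. Bundles: put $\tilde H^{0,1}=H^{0,1}\oplus (N_\xi\otimes\mathbb{C})$, an integrable distribution. For an integrable subbundle $S\subset TM\otimes\mathbb{C}$, a partial connection on a complex vector bundle $E$ along $S$ is an operator $D:\Gamma(E)\to\Gamma(S^*\otimes E)$ with $D(fs)=fDs+(df)|_S\otimes s$; it is flat if its curvature in $\Gamma(\Lambda^2S^*\otimes\mathrm{End}E)$ vanishes. A complex Sasakian vector bundle is a pair $\mathbf{E}=(E,D_0)$ with $E\to M$ a complex vector bundle and $D_0$ a partial connection along $N_\xi$. A holomorphic Sasakian bundle is $\mathcal{E}=(\mathbf{E},\bar\partial)$ with $\bar\partial$ a flat partial connection on $E$ along $\tilde H^{0,1}$ restricting to $D_0$ along $N_\xi$. A connection $A$ is integrable on $\mathcal{E}$ if $d_A|_{\tilde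 H^{0,1}}=\bar\partial$; $\mathcal{A}(\mathcal{E})$ denotes the set of integrable connections.
   Formalization: In the converse, A is also assumed unitary for some Hermitian metric on E; without this it fails (on S^7, A = d + z1 dz2 − z2 dz1). The coframe e^j + i e^{j+3} may be of type (1,0) or (0,1), since the stated identities force (0,1) under the usual sign of dη. *)

theory Defs
  imports "HOL-Analysis.Analysis" "HOL-Combinatorics.Permutations"
begin

section \<open>Smooth manifolds\<close>

primrec Ck_on :: "nat \<Rightarrow> 'a::euclidean_space set \<Rightarrow> ('a \<Rightarrow> 'b::real_normed_vector) \<Rightarrow> bool" where
  "Ck_on 0 S f \<longleftrightarrow> continuous_on S f"
| "Ck_on (Suc k) S f \<longleftrightarrow> (\<forall>x\<in>S. f differentiable (at x)) \<and>
     (\<forall>b\<in>Basis. Ck_on k S (\<lambda>x. frechet_derivative f (at x) b))"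

text \<open>Used for open \<open>S\<close> only.\<close>

definition smooth_on :: "'a::euclidean_space set \<Rightarrow> ('a \<Rightarrow> 'b::real_normed_vector) \<Rightarrow> bool" where
  "smooth_on S f \<longleftrightarrow> (\<forall>k. Ck_on k S f)"

text \<open>
  The underlying space of a manifold is a type \<open>'m\<close>, Hausdorff and second countable. The smooth
  structure is a family \<open>K\<close> that selects a chart \<open>K p\<close> around each point \<open>p\<close>; the selected charts
  form the atlas (every smooth structure is generated by such a subatlas). The tangent space
  \<open>T\<^sub>pM\<close> is \<open>real^'n\<close>, identified by the differential of the chart \<open>K p\<close> selected at \<open>p\<close>, and its
  complexification is \<open>complex^'n\<close>.
\<close>

type_synonym ('m, 'n) atlas = "'m \<Rightarrow> 'm set \<times> ('m \<Rightarrow> real^'n)"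

definition chart_dom :: "('m, 'n::finite) atlas \<Rightarrow> 'm \<Rightarrow> 'm set" where
  "chart_dom K p = fst (K p)"

definition coord :: "('m, 'n::finite) atlas \<Rightarrow> 'm \<Rightarrow> 'm \<Rightarrow> real^'n" where
  "coord K p = snd (K p)"

definition coord_inv :: "('m, 'n::finite) atlas \<Rightarrow> 'm \<Rightarrow> real^'n \<Rightarrow> 'm" where
  "coord_inv K p = inv_into (chart_dom K p) (coord K p)"

definition smooth_manifold ::
    "('m::{t2_space,second_countable_topology}, 'n::finite) atlas \<Rightarrow> bool" where
  "smooth_manifold K \<longleftrightarrow>
     (\<forall>p. p \<in> chart_dom K p \<and> open (chart_dom K p) \<and> open (coord K p ` chart_dom K p) \<and>
        homeomorphism (chart_dom K p) (coord K p ` chart_dom K p) (coord K p) (coord_inv K p)) \<and>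
     (\<forall>p q. smooth_on (coord K p ` (chart_dom K p \<inter> chart_dom K q)) (coord K q \<circ> coord_inv K p))"

definition smooth_fun_on ::
    "('m, 'n::finite) atlas \<Rightarrow> 'm set \<Rightarrow> ('m \<Rightarrow> 'b::real_normed_vector) \<Rightarrow> bool" where
  "smooth_fun_on K W f \<longleftrightarrow> (\<forall>q. smooth_on (coord K q ` (chart_dom K q \<inter> W)) (f \<circ> coord_inv K q))"

abbreviation smooth_fun :: "('m, 'n::finite) atlas \<Rightarrow> ('m \<Rightarrow> 'b::real_normed_vector) \<Rightarrow> bool" where
  "smooth_fun K f \<equiv> smooth_fun_on K UNIV f"

text \<open>
  \<open>dtrans K a b q\<close> turns the components at \<open>q\<close> of a tangent vector in the chart \<open>K a\<close> into its
  components in the chart \<open>K b\<close>. So \<open>dtrans K q b q u\<close> are the \<open>K b\<close>-components of \<open>u \<in> T\<^sub>qM\<close>, and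
  \<open>\<lambda>q. dtrans K a q q w\<close> is the vector field on \<open>chart_dom K a\<close> with constant \<open>K a\<close>-components \<open>w\<close>.
\<close>

definition dtrans ::
    "('m, 'n::finite) atlas \<Rightarrow> 'm \<Rightarrow> 'm \<Rightarrow> 'm \<Rightarrow> real^'n \<Rightarrow> real^'n" where
  "dtrans K a b q = frechet_derivative (coord K b \<circ> coord_inv K a) (at (coord K a q))"

text \<open>\<open>dfun K f p u\<close> is \<open>df\<^sub>p(u)\<close> for \<open>u \<in> T\<^sub>pM\<close>.\<close>

definition dfun ::
    "('m, 'n::finite) atlas \<Rightarrow> ('m \<Rightarrow> 'b::real_normed_vector) \<Rightarrow> 'm \<Rightarrow> real^'n \<Rightarrow> 'b" where
  "dfun K f p = frechet_derivative (f \<circ> coord_inv K p) (at (coord K p p))"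

definition smooth_vf :: "('m, 'n::finite) atlas \<Rightarrow> ('m \<Rightarrow> real^'n) \<Rightarrow> bool" where
  "smooth_vf K X \<longleftrightarrow> (\<forall>a. smooth_fun_on K (chart_dom K a) (\<lambda>q. dtrans K q a q (X q)))"

definition lie_bracket ::
    "('m, 'n::finite) atlas \<Rightarrow> ('m \<Rightarrow> real^'n) \<Rightarrow> ('m \<Rightarrow> real^'n) \<Rightarrow> 'm \<Rightarrow> real^'n" where
  "lie_bracket K X Y p =
     dfun K (\<lambda>q. dtrans K q p q (Y q)) p (X p) - dfun K (\<lambda>q. dtrans K q p q (X q)) p (Y p)"

text \<open>
  Exterior derivative of a 1-form: \<open>d\<eta>(X,Y) = X\<eta>(Y) - Y\<eta>(X) - \<eta>([X,Y])\<close>, evaluated on the commuting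
  fields with constant components in the chart \<open>K p\<close>.
\<close>

definition ext_d1 ::
    "('m, 'n::finite) atlas \<Rightarrow> ('m \<Rightarrow> real^'n \<Rightarrow> real) \<Rightarrow> 'm \<Rightarrow> real^'n \<Rightarrow> real^'n \<Rightarrow> real" where
  "ext_d1 K \<eta> p u v =
     dfun K (\<lambda>q. \<eta> q (dtrans K p q q v)) p u - dfun K (\<lambda>q. \<eta> q (dtrans K p q q u)) p v"

definition smooth_1form :: "('m, 'n::finite) atlas \<Rightarrow> ('m \<Rightarrow> real^'n \<Rightarrow> real) \<Rightarrow> bool" where
  "smooth_1form K \<eta> \<longleftrightarrow> (\<forall>p. linear (\<eta> p)) \<and>
     (\<forall>X. smooth_vf K X \<longrightarrow> smooth_fun K (\<lambda>p. \<eta> p (X p)))"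

definition riemannian_metric ::
    "('m, 'n::finite) atlas \<Rightarrow> ('m \<Rightarrow> real^'n \<Rightarrow> real^'n \<Rightarrow> real) \<Rightarrow> bool" where
  "riemannian_metric K g \<longleftrightarrow>
     (\<forall>p. bilinear (g p) \<and> (\<forall>u v. g p u v = g p v u) \<and> (\<forall>u. u \<noteq> 0 \<longrightarrow> g p u u > 0)) \<and>
     (\<forall>X Y. smooth_vf K X \<longrightarrow> smooth_vf K Y \<longrightarrow> smooth_fun K (\<lambda>p. g p (X p) (Y p)))"

definition smooth_endo :: "('m, 'n::finite) atlas \<Rightarrow> ('m \<Rightarrow> real^'n \<Rightarrow> real^'n) \<Rightarrow> bool" where
  "smooth_endo K \<Phi> \<longleftrightarrow> (\<forall>p. linear (\<Phi> p)) \<and>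
     (\<forall>X. smooth_vf K X \<longrightarrow> smooth_vf K (\<lambda>p. \<Phi> p (X p)))"

text \<open>\<open>nab Y p u\<close> stands for \<open>(\<nabla>\<^sub>uY)(p)\<close>, \<open>u \<in> T\<^sub>pM\<close>.\<close>

definition levi_civita ::
    "('m, 'n::finite) atlas \<Rightarrow> ('m \<Rightarrow> real^'n \<Rightarrow> real^'n \<Rightarrow> real) \<Rightarrow>
     (('m \<Rightarrow> real^'n) \<Rightarrow> 'm \<Rightarrow> real^'n \<Rightarrow> real^'n) \<Rightarrow> bool" where
  "levi_civita K g nab \<longleftrightarrow>
     (\<forall>X Y. smooth_vf K X \<longrightarrow> smooth_vf K Y \<longrightarrow> smooth_vf K (\<lambda>p. nab Y p (X p))) \<and>
     (\<forall>Y p. smooth_vf K Y \<longrightarrow> linear (nab Y p)) \<and>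
     (\<forall>Y Z p u. smooth_vf K Y \<longrightarrow> smooth_vf K Z \<longrightarrow>
        nab (\<lambda>q. Y q + Z q) p u = nab Y p u + nab Z p u) \<and>
     (\<forall>f Y p u. smooth_fun K f \<longrightarrow> smooth_vf K Y \<longrightarrow>
        nab (\<lambda>q. f q *\<^sub>R Y q) p u = f p *\<^sub>R nab Y p u + dfun K f p u *\<^sub>R Y p) \<and>
     (\<forall>X Y p. smooth_vf K X \<longrightarrow> smooth_vf K Y \<longrightarrow>
        nab Y p (X p) - nab X p (Y p) = lie_bracket K X Y p) \<and>
     (\<forall>Y Z p u. smooth_vf K Y \<longrightarrow> smooth_vf K Z \<longrightarrow>
        dfun K (\<lambda>q. g q (Y q) (Z q)) p u = g p (nab Y p u) (Z p) + g p (Y p) (nab Z p u))"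

section \<open>Exterior algebra of a vector space of type \<open>real^'n\<close>\<close>

text \<open>
  A \<open>k\<close>-form is a function of a sequence of vectors that only depends on the entries
  \<open>v 1, \<dots>, v k\<close>. Frames are likewise indexed by \<open>{1..n}\<close>.
\<close>

definition alt_form :: "nat \<Rightarrow> ((nat \<Rightarrow> real^'n::finite) \<Rightarrow> 'w::real_vector) \<Rightarrow> bool" where
  "alt_form k \<alpha> \<longleftrightarrow>
     (\<forall>v w. (\<forall>i\<in>{1..k}. v i = w i) \<longrightarrow> \<alpha> v = \<alpha> w) \<and>
     (\<forall>v. \<forall>i\<in>{1..k}. linear (\<lambda>x. \<alpha> (v(i := x)))) \<and>
     (\<forall>v. \<forall>i\<in>{1..k}. \<forall>j\<in>{1..k}. i \<noteq> j \<and> v i = v j \<longrightarrow> \<alpha> v = 0)"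

definition form1 :: "(real^'n::finite \<Rightarrow> 'w) \<Rightarrow> (nat \<Rightarrow> real^'n) \<Rightarrow> 'w" where
  "form1 \<alpha> = (\<lambda>v. \<alpha> (v 1))"

definition form2 :: "(real^'n::finite \<Rightarrow> real^'n \<Rightarrow> 'w) \<Rightarrow> (nat \<Rightarrow> real^'n) \<Rightarrow> 'w" where
  "form2 \<beta> = (\<lambda>v. \<beta> (v 1) (v 2))"

text \<open>\<open>wedge k l \<alpha> \<beta>\<close> is \<open>\<alpha> \<and> \<beta>\<close> for a \<open>k\<close>-form \<open>\<alpha>\<close> and a vector-valued \<open>l\<close>-form \<open>\<beta>\<close>,
  normalised so that \<open>(\<alpha> \<and> \<beta>)(u,v) = \<alpha>(u)\<beta>(v) - \<alpha>(v)\<beta>(u)\<close> for 1-forms.\<close>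

definition wedge ::
    "nat \<Rightarrow> nat \<Rightarrow> ((nat \<Rightarrow> real^'n::finite) \<Rightarrow> real) \<Rightarrow> ((nat \<Rightarrow> real^'n) \<Rightarrow> 'w::real_vector) \<Rightarrow>
     (nat \<Rightarrow> real^'n) \<Rightarrow> 'w" where
  "wedge k l \<alpha> \<beta> v = (1 / (fact k * fact l)) *\<^sub>R
     (\<Sum>\<pi> | \<pi> permutes {1..k+l}.
        (of_int (sign \<pi>) * \<alpha> (\<lambda>i. v (\<pi> i))) *\<^sub>R \<beta> (\<lambda>i. v (\<pi> (k + i))))"

definition pos_onb ::
    "(real^'n::finite \<Rightarrow> real^'n \<Rightarrow> real) \<Rightarrow> ((nat \<Rightarrow> real^'n) \<Rightarrow> real) \<Rightarrow> (nat \<Rightarrow> real^'n) \<Rightarrow> bool" where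
  "pos_onb G \<mu> e \<longleftrightarrow>
     (\<forall>i\<in>{1..CARD('n)}. \<forall>j\<in>{1..CARD('n)}. G (e i) (e j) = (if i = j then 1 else 0)) \<and> \<mu> e > 0"

text \<open>
  Hodge star for the inner product \<open>G\<close> and the orientation in which a basis \<open>e\<close> is positive iff
  \<open>\<mu> e > 0\<close>. For a positive orthonormal basis with dual coframe \<open>e\<^sup>1, \<dots>, e\<^sup>n\<close>,
  \<open>*\<beta> = 1/(k!(n-k)!) \<Sum>\<^sub>\<pi> sign \<pi> \<beta>(e\<^bsub>\<pi>1\<^esub>,\<dots>,e\<^bsub>\<pi>k\<^esub>) e\<^bsup>\<pi>(k+1)\<^esup> \<and> \<dots> \<and> e\<^bsup>\<pi>n\<^esup>\<close>; writing out the wedge product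
  as an alternating sum cancels the factor \<open>1/(n-k)!\<close>. The value does not depend on the basis.
\<close>

definition hodge ::
    "(real^'n::finite \<Rightarrow> real^'n \<Rightarrow> real) \<Rightarrow> ((nat \<Rightarrow> real^'n) \<Rightarrow> real) \<Rightarrow> nat \<Rightarrow>
     ((nat \<Rightarrow> real^'n) \<Rightarrow> 'w::real_vector) \<Rightarrow> (nat \<Rightarrow> real^'n) \<Rightarrow> 'w" where
  "hodge G \<mu> k \<beta> v =
     (let e = (SOME e. pos_onb G \<mu> e) in
      (1 / fact k) *\<^sub>R
      (\<Sum>\<pi> | \<pi> permutes {1..CARD('n)}.
         (of_int (sign \<pi>) * (\<Prod>j\<in>{1..CARD('n) - k}. G (e (\<pi> (k + j))) (v j))) *\<^sub>R
         \<beta> (\<lambda>i. e (\<pi> i))))"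

text \<open>The inner product on 2-forms for which \<open>e\<^sup>i \<and> e\<^sup>j\<close>, \<open>i < j\<close>, are orthonormal; the first argument
  may be vector-valued.\<close>

definition inner_2form ::
    "(real^'n::finite \<Rightarrow> real^'n \<Rightarrow> real) \<Rightarrow> (real^'n \<Rightarrow> real^'n \<Rightarrow> 'w::real_vector) \<Rightarrow>
     (real^'n \<Rightarrow> real^'n \<Rightarrow> real) \<Rightarrow> 'w" where
  "inner_2form G \<beta> \<alpha> =
     (let e = (SOME e. pos_onb G (\<lambda>_. 1) e) in
      \<Sum>j\<in>{1..CARD('n)}. \<Sum>i\<in>{1..<j}. \<alpha> (e i) (e j) *\<^sub>R \<beta> (e i) (e j))"

text \<open>A nowhere vanishing top form represents an orientation.\<close>

definition orientation_form ::
    "('m, 'n::finite) atlas \<Rightarrow> ('m \<Rightarrow> (nat \<Rightarrow> real^'n) \<Rightarrow> real) \<Rightarrow> bool" where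
  "orientation_form K \<mu> \<longleftrightarrow>
     (\<forall>p. alt_form CARD('n) (\<mu> p) \<and> (\<exists>v. \<mu> p v \<noteq> 0)) \<and>
     (\<forall>X. (\<forall>i. smooth_vf K (X i)) \<longrightarrow> smooth_fun K (\<lambda>p. \<mu> p (\<lambda>i. X i p)))"

section \<open>Complexification\<close>

definition cvec :: "real^'n::finite \<Rightarrow> complex^'n" where
  "cvec u = (\<chi> i. of_real (u $ i))"

definition re_vec :: "complex^'n::finite \<Rightarrow> real^'n" where
  "re_vec v = (\<chi> i. Re (v $ i))"

definition im_vec :: "complex^'n::finite \<Rightarrow> real^'n" where
  "im_vec v = (\<chi> i. Im (v $ i))"

definition cext_fun :: "(real^'n::finite \<Rightarrow> complex) \<Rightarrow> complex^'n \<Rightarrow> complex" where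
  "cext_fun \<alpha> v = \<alpha> (re_vec v) + \<i> * \<alpha> (im_vec v)"

definition cext_endo :: "(real^'n::finite \<Rightarrow> real^'n) \<Rightarrow> complex^'n \<Rightarrow> complex^'n" where
  "cext_endo \<Phi> v = cvec (\<Phi> (re_vec v)) + \<i> *s cvec (\<Phi> (im_vec v))"

definition cext_2form ::
    "(real^'n::finite \<Rightarrow> real^'n \<Rightarrow> complex^'r^'r) \<Rightarrow> complex^'n \<Rightarrow> complex^'n \<Rightarrow> complex^'r^'r" where
  "cext_2form F u v = (\<chi> a b.
     F (re_vec u) (re_vec v) $ a $ b - F (im_vec u) (im_vec v) $ a $ b
     + \<i> * (F (re_vec u) (im_vec v) $ a $ b + F (im_vec u) (re_vec v) $ a $ b))"

definition smooth_cvf :: "('m, 'n::finite) atlas \<Rightarrow> ('m \<Rightarrow> complex^'n) \<Rightarrow> bool" where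
  "smooth_cvf K X \<longleftrightarrow> smooth_vf K (\<lambda>p. re_vec (X p)) \<and> smooth_vf K (\<lambda>p. im_vec (X p))"

definition lie_bracket_c ::
    "('m, 'n::finite) atlas \<Rightarrow> ('m \<Rightarrow> complex^'n) \<Rightarrow> ('m \<Rightarrow> complex^'n) \<Rightarrow> 'm \<Rightarrow> complex^'n" where
  "lie_bracket_c K X Y p =
     (let Xr = (\<lambda>q. re_vec (X q)); Xi = (\<lambda>q. im_vec (X q));
          Yr = (\<lambda>q. re_vec (Y q)); Yi = (\<lambda>q. im_vec (Y q))
      in cvec (lie_bracket K Xr Yr p - lie_bracket K Xi Yi p)
         + \<i> *s cvec (lie_bracket K Xr Yi p + lie_bracket K Xi Yr p))"

section \<open>Complex vector bundles, partial connections, curvature\<close>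

text \<open>
  A complex vector bundle of rank \<open>CARD('r)\<close>: the fibre \<open>E\<^sub>p\<close> over every point is the vector space
  \<open>complex^'r\<close>, without any relation between different fibres other than the one given by the local
  trivialisations. The family \<open>T\<close> selects around each point \<open>q\<close> an open set \<open>fst (T q)\<close> and a
  trivialisation over it, \<open>snd (T q) p\<close> being the matrix of the isomorphism from \<open>E\<^sub>p\<close> to \<open>complex^'r\<close>.
\<close>

type_synonym ('m, 'r) bundle_atlas = "'m \<Rightarrow> 'm set \<times> ('m \<Rightarrow> complex^'r^'r)"

definition vector_bundle ::
    "('m::{t2_space,second_countable_topology}, 'n::finite) atlas \<Rightarrow> ('m, 'r::finite) bundle_atlas \<Rightarrow> bool"
  where
  "vector_bundle K T \<longleftrightarrow>
     (\<forall>q. q \<in> fst (T q) \<and> open (fst (T q)) \<and> (\<forall>p\<in>fst (T q). invertible (snd (T q) p))) \<and>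
     (\<forall>q q'. smooth_fun_on K (fst (T q) \<inter> fst (T q'))
        (\<lambda>p. snd (T q') p ** matrix_inv (snd (T q) p)))"

definition smooth_section ::
    "('m, 'n::finite) atlas \<Rightarrow> ('m, 'r::finite) bundle_atlas \<Rightarrow> ('m \<Rightarrow> complex^'r) \<Rightarrow> bool" where
  "smooth_section K T s \<longleftrightarrow> (\<forall>q. smooth_fun_on K (fst (T q)) (\<lambda>p. snd (T q) p *v s p))"

text \<open>
  \<open>D s p v\<close> stands for \<open>(D\<^sub>v s)(p)\<close>; it is only meaningful for \<open>v\<close> in \<open>S p\<close>, the fibre at \<open>p\<close> of a
  subbundle \<open>S\<close> of the complexified tangent bundle.
\<close>

type_synonym ('m, 'n, 'r) operator =
  "('m \<Rightarrow> complex^'r) \<Rightarrow> 'm \<Rightarrow> complex^'n \<Rightarrow> complex^'r"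

definition partial_connection ::
    "('m, 'n::finite) atlas \<Rightarrow> ('m, 'r::finite) bundle_atlas \<Rightarrow> ('m \<Rightarrow> (complex^'n) set) \<Rightarrow>
     ('m, 'n, 'r) operator \<Rightarrow> bool" where
  "partial_connection K T S D \<longleftrightarrow>
     (\<forall>s X. smooth_section K T s \<longrightarrow> smooth_cvf K X \<longrightarrow> (\<forall>p. X p \<in> S p) \<longrightarrow>
        smooth_section K T (\<lambda>p. D s p (X p))) \<and>
     (\<forall>s p. smooth_section K T s \<longrightarrow>
        (\<forall>u\<in>S p. \<forall>v\<in>S p. D s p (u + v) = D s p u + D s p v) \<and>
        (\<forall>a. \<forall>v\<in>S p. D s p (a *s v) = a *s D s p v)) \<and>
     (\<forall>s t p. smooth_section K T s \<longrightarrow> smooth_section K T t \<longrightarrow>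
        (\<forall>v\<in>S p. D (\<lambda>q. s q + t q) p v = D s p v + D t p v)) \<and>
     (\<forall>f s p. smooth_fun K f \<longrightarrow> smooth_section K T s \<longrightarrow>
        (\<forall>v\<in>S p. D (\<lambda>q. f q *s s q) p v = f p *s D s p v + cext_fun (dfun K f p) v *s s p))"

definition flat_along ::
    "('m, 'n::finite) atlas \<Rightarrow> ('m, 'r::finite) bundle_atlas \<Rightarrow> ('m \<Rightarrow> (complex^'n) set) \<Rightarrow>
     ('m, 'n, 'r) operator \<Rightarrow> bool" where
  "flat_along K T S D \<longleftrightarrow>
     (\<forall>X Y s. smooth_cvf K X \<longrightarrow> smooth_cvf K Y \<longrightarrow> (\<forall>p. X p \<in> S p \<and> Y p \<in> S p) \<longrightarrow>
        smooth_section K T s \<longrightarrow>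
        (\<forall>p. D (\<lambda>q. D s q (Y q)) p (X p) - D (\<lambda>q. D s q (X q)) p (Y p)
              - D s p (lie_bracket_c K X Y p) = 0))"

text \<open>
  A connection \<open>d\<^sub>A : \<Gamma>(E) \<rightarrow> \<Gamma>(T\<^sup>*M \<otimes> E)\<close>; as \<open>E\<close> is complex, the values are extended complex
  linearly to the complexified tangent bundle.
\<close>

definition connection ::
    "('m, 'n::finite) atlas \<Rightarrow> ('m, 'r::finite) bundle_atlas \<Rightarrow> ('m, 'n, 'r) operator \<Rightarrow> bool" where
  "connection K T A \<longleftrightarrow> partial_connection K T (\<lambda>_. UNIV) A"

text \<open>\<open>F\<close> is the curvature of \<open>A\<close>, as a 2-form with values in \<open>End E\<close>.\<close>

definition is_curvature ::
    "('m, 'n::finite) atlas \<Rightarrow> ('m, 'r::finite) bundle_atlas \<Rightarrow> ('m, 'n, 'r) operator \<Rightarrow>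
     ('m \<Rightarrow> real^'n \<Rightarrow> real^'n \<Rightarrow> complex^'r^'r) \<Rightarrow> bool" where
  "is_curvature K T A F \<longleftrightarrow>
     (\<forall>p. alt_form 2 (form2 (F p))) \<and>
     (\<forall>X Y s p. smooth_vf K X \<longrightarrow> smooth_vf K Y \<longrightarrow> smooth_section K T s \<longrightarrow>
        F p (X p) (Y p) *v s p =
          A (\<lambda>q. A s q (cvec (Y q))) p (cvec (X p)) - A (\<lambda>q. A s q (cvec (X q))) p (cvec (Y p))
          - A s p (cvec (lie_bracket K X Y p)))"

definition hermitian_metric ::
    "('m, 'n::finite) atlas \<Rightarrow> ('m, 'r::finite) bundle_atlas \<Rightarrow>
     ('m \<Rightarrow> complex^'r \<Rightarrow> complex^'r \<Rightarrow> complex) \<Rightarrow> bool" where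
  "hermitian_metric K T h \<longleftrightarrow>
     (\<forall>p x y z a. h p (x + y) z = h p x z + h p y z \<and> h p (a *s x) z = a * h p x z \<and>
        h p y x = cnj (h p x y) \<and> (x \<noteq> 0 \<longrightarrow> Re (h p x x) > 0)) \<and>
     (\<forall>s t. smooth_section K T s \<longrightarrow> smooth_section K T t \<longrightarrow> smooth_fun K (\<lambda>p. h p (s p) (t p)))"

definition unitary_connection ::
    "('m, 'n::finite) atlas \<Rightarrow> ('m, 'r::finite) bundle_atlas \<Rightarrow>
     ('m \<Rightarrow> complex^'r \<Rightarrow> complex^'r \<Rightarrow> complex) \<Rightarrow> ('m, 'n, 'r) operator \<Rightarrow> bool" where
  "unitary_connection K T h A \<longleftrightarrow>
     (\<forall>s t p u. smooth_section K T s \<longrightarrow> smooth_section K T t \<longrightarrow>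
        dfun K (\<lambda>q. h q (s q) (t q)) p u = h p (A s p (cvec u)) (t p) + h p (s p) (A t p (cvec u)))"

section \<open>Sasakian 7-manifolds\<close>

definition contact_form :: "('m, 7) atlas \<Rightarrow> ('m \<Rightarrow> real^7 \<Rightarrow> real) \<Rightarrow> bool" where
  "contact_form K \<eta> \<longleftrightarrow> smooth_1form K \<eta> \<and>
     (\<forall>p. let \<omega> = form2 (ext_d1 K \<eta> p)
          in \<exists>v. wedge 1 6 (form1 (\<eta> p)) (wedge 2 4 \<omega> (wedge 2 2 \<omega> \<omega>)) v \<noteq> 0)"

definition sasakian ::
    "('m::{t2_space,second_countable_topology}, 7) atlas \<Rightarrow> ('m \<Rightarrow> real^7 \<Rightarrow> real) \<Rightarrow> ('m \<Rightarrow> real^7) \<Rightarrow>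
     ('m \<Rightarrow> real^7 \<Rightarrow> real^7 \<Rightarrow> real) \<Rightarrow> ('m \<Rightarrow> real^7 \<Rightarrow> real^7) \<Rightarrow> bool" where
  "sasakian K \<eta> \<xi> g \<Phi> \<longleftrightarrow>
     smooth_manifold K \<and> contact_form K \<eta> \<and> smooth_vf K \<xi> \<and> riemannian_metric K g \<and> smooth_endo K \<Phi> \<and>
     (\<forall>p. \<eta> p (\<xi> p) = 1 \<and> (\<forall>u. ext_d1 K \<eta> p (\<xi> p) u = 0)) \<and>
     (\<forall>p. g p (\<xi> p) (\<xi> p) = 1) \<and>
     (\<forall>p u. \<Phi> p (\<Phi> p u) = - u + \<eta> p u *\<^sub>R \<xi> p) \<and>
     (\<forall>p u v. g p (\<Phi> p u) (\<Phi> p v) = g p u v - \<eta> p u * \<eta> p v) \<and>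
     (\<exists>nab. levi_civita K g nab \<and>
        (\<forall>p u. nab \<xi> p u = - \<Phi> p u) \<and>
        (\<forall>Y p u. smooth_vf K Y \<longrightarrow>
           nab (\<lambda>q. \<Phi> q (Y q)) p u - \<Phi> p (nab Y p u) = g p u (Y p) *\<^sub>R \<xi> p - \<eta> p (Y p) *\<^sub>R u))"

definition H10 :: "('m \<Rightarrow> real^7 \<Rightarrow> real) \<Rightarrow> ('m \<Rightarrow> real^7 \<Rightarrow> real^7) \<Rightarrow> 'm \<Rightarrow> (complex^7) set" where
  "H10 \<eta> \<Phi> p = {v. cext_fun (\<lambda>u. of_real (\<eta> p u)) v = 0 \<and> cext_endo (\<Phi> p) v = \<i> *s v}"

definition H01 :: "('m \<Rightarrow> real^7 \<Rightarrow> real) \<Rightarrow> ('m \<Rightarrow> real^7 \<Rightarrow> real^7) \<Rightarrow> 'm \<Rightarrow> (complex^7) set" where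
  "H01 \<eta> \<Phi> p = {v. cext_fun (\<lambda>u. of_real (\<eta> p u)) v = 0 \<and> cext_endo (\<Phi> p) v = (- \<i>) *s v}"

definition N_xi :: "('m \<Rightarrow> real^7) \<Rightarrow> 'm \<Rightarrow> (complex^7) set" where
  "N_xi \<xi> p = range (\<lambda>a. a *s cvec (\<xi> p))"

definition H01_tilde ::
    "('m \<Rightarrow> real^7 \<Rightarrow> real) \<Rightarrow> ('m \<Rightarrow> real^7) \<Rightarrow> ('m \<Rightarrow> real^7 \<Rightarrow> real^7) \<Rightarrow> 'm \<Rightarrow> (complex^7) set" where
  "H01_tilde \<eta> \<xi> \<Phi> p = {u + v | u v. u \<in> H01 \<eta> \<Phi> p \<and> v \<in> N_xi \<xi> p}"

definition type_10 ::
    "('m \<Rightarrow> real^7 \<Rightarrow> real) \<Rightarrow> ('m \<Rightarrow> real^7) \<Rightarrow> ('m \<Rightarrow> real^7 \<Rightarrow> real^7) \<Rightarrow> 'm \<Rightarrow>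
     (real^7 \<Rightarrow> complex) \<Rightarrow> bool" where
  "type_10 \<eta> \<xi> \<Phi> p \<alpha> \<longleftrightarrow> \<alpha> (\<xi> p) = 0 \<and> (\<forall>v\<in>H01 \<eta> \<Phi> p. cext_fun \<alpha> v = 0)"

definition type_01 ::
    "('m \<Rightarrow> real^7 \<Rightarrow> real) \<Rightarrow> ('m \<Rightarrow> real^7) \<Rightarrow> ('m \<Rightarrow> real^7 \<Rightarrow> real^7) \<Rightarrow> 'm \<Rightarrow>
     (real^7 \<Rightarrow> complex) \<Rightarrow> bool" where
  "type_01 \<eta> \<xi> \<Phi> p \<alpha> \<longleftrightarrow> \<alpha> (\<xi> p) = 0 \<and> (\<forall>v\<in>H10 \<eta> \<Phi> p. cext_fun \<alpha> v = 0)"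

text \<open>The metric \<open>g\<close> with its transverse part rescaled by \<open>c\<close>, i.e. \<open>c g\<^sub>H + \<eta> \<otimes> \<eta>\<close>.\<close>

definition scaled_metric ::
    "('m \<Rightarrow> real^7 \<Rightarrow> real) \<Rightarrow> ('m \<Rightarrow> real^7 \<Rightarrow> real^7 \<Rightarrow> real) \<Rightarrow> real \<Rightarrow>
     'm \<Rightarrow> real^7 \<Rightarrow> real^7 \<Rightarrow> real" where
  "scaled_metric \<eta> g c p u v = c * (g p u v - \<eta> p u * \<eta> p v) + \<eta> p u * \<eta> p v"

text \<open>
  The normalisation at every point: there is a positively oriented orthonormal coframe
  \<open>e\<^sup>1, \<dots>, e\<^sup>6, e\<^sup>7 = \<eta>\<close> of the rescaled metric with \<open>d\<eta> = e\<^sup>1\<^sup>4 + e\<^sup>2\<^sup>5 + e\<^sup>3\<^sup>6\<close> and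
  \<open>e\<^sup>j + \<i> e\<^bsup>j+3\<^esup>\<close> (\<open>j = 1,2,3\<close>) of type \<open>(1,0)\<close> or, for all \<open>j\<close>, of type \<open>(0,1)\<close>. Which of the two
  cases occurs is a matter of sign conventions. With the present ones, \<open>\<nabla>\<^sub>X\<xi> = -\<Phi>X\<close> gives
  \<open>d\<eta>(X,Y) = 2g(X,\<Phi>Y)\<close>, which forces type \<open>(0,1)\<close> and \<open>c = 2\<close>; with the opposite sign of \<open>d\<eta>\<close> or \<open>\<Phi>\<close>
  it is \<open>(1,0)\<close>.
\<close>

definition normalised ::
    "('m, 7) atlas \<Rightarrow> ('m \<Rightarrow> real^7 \<Rightarrow> real) \<Rightarrow> ('m \<Rightarrow> real^7) \<Rightarrow>
     ('m \<Rightarrow> real^7 \<Rightarrow> real^7 \<Rightarrow> real) \<Rightarrow> ('m \<Rightarrow> real^7 \<Rightarrow> real^7) \<Rightarrow> real \<Rightarrow>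
     ('m \<Rightarrow> (nat \<Rightarrow> real^7) \<Rightarrow> real) \<Rightarrow> bool" where
  "normalised K \<eta> \<xi> g \<Phi> c \<mu> \<longleftrightarrow> c > 0 \<and> orientation_form K \<mu> \<and>
     (\<forall>p. \<exists>e. pos_onb (scaled_metric \<eta> g c p) (\<mu> p) e \<and>
        (let \<theta> = (\<lambda>j. scaled_metric \<eta> g c p (e j)) in
         \<theta> 7 = \<eta> p \<and>
         (\<forall>u v. ext_d1 K \<eta> p u v = (\<Sum>j\<in>{1,2,3}. \<theta> j u * \<theta> (j + 3) v - \<theta> j v * \<theta> (j + 3) u)) \<and>
         ((\<forall>j\<in>{1,2,3}. type_10 \<eta> \<xi> \<Phi> p (\<lambda>u. Complex (\<theta> j u) (\<theta> (j + 3) u))) \<or>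
          (\<forall>j\<in>{1,2,3}. type_01 \<eta> \<xi> \<Phi> p (\<lambda>u. Complex (\<theta> j u) (\<theta> (j + 3) u))))))"

section \<open>Sasakian bundles, contact instantons and the HYM condition\<close>

definition complex_sasakian_bundle ::
    "('m::{t2_space,second_countable_topology}, 7) atlas \<Rightarrow> ('m \<Rightarrow> real^7) \<Rightarrow>
     ('m, 'r::finite) bundle_atlas \<Rightarrow> ('m, 7, 'r) operator \<Rightarrow> bool" where
  "complex_sasakian_bundle K \<xi> T D0 \<longleftrightarrow>
     vector_bundle K T \<and> partial_connection K T (N_xi \<xi>) D0"

definition holomorphic_sasakian_bundle ::
    "('m::{t2_space,second_countable_topology}, 7) atlas \<Rightarrow> ('m \<Rightarrow> real^7 \<Rightarrow> real) \<Rightarrow> ('m \<Rightarrow> real^7) \<Rightarrow>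
     ('m \<Rightarrow> real^7 \<Rightarrow> real^7) \<Rightarrow> ('m, 'r::finite) bundle_atlas \<Rightarrow> ('m, 7, 'r) operator \<Rightarrow>
     ('m, 7, 'r) operator \<Rightarrow> bool" where
  "holomorphic_sasakian_bundle K \<eta> \<xi> \<Phi> T D0 dbar \<longleftrightarrow>
     complex_sasakian_bundle K \<xi> T D0 \<and>
     partial_connection K T (H01_tilde \<eta> \<xi> \<Phi>) dbar \<and> flat_along K T (H01_tilde \<eta> \<xi> \<Phi>) dbar \<and>
     (\<forall>s p. smooth_section K T s \<longrightarrow> (\<forall>v\<in>N_xi \<xi> p. dbar s p v = D0 s p v))"

definition integrable_connection ::
    "('m, 7) atlas \<Rightarrow> ('m \<Rightarrow> real^7 \<Rightarrow> real) \<Rightarrow> ('m \<Rightarrow> real^7) \<Rightarrow>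
     ('m \<Rightarrow> real^7 \<Rightarrow> real^7) \<Rightarrow> ('m, 'r::finite) bundle_atlas \<Rightarrow> ('m, 7, 'r) operator \<Rightarrow>
     ('m, 7, 'r) operator \<Rightarrow> bool" where
  "integrable_connection K \<eta> \<xi> \<Phi> T dbar A \<longleftrightarrow> connection K T A \<and>
     (\<forall>s p. smooth_section K T s \<longrightarrow> (\<forall>v\<in>H01_tilde \<eta> \<xi> \<Phi> p. A s p v = dbar s p v))"

text \<open>The last argument of the next three definitions is the curvature \<open>F\<^sub>A\<close>.\<close>

definition selfdual_contact_instanton ::
    "('m, 7) atlas \<Rightarrow> ('m \<Rightarrow> real^7 \<Rightarrow> real) \<Rightarrow> ('m \<Rightarrow> real^7 \<Rightarrow> real^7 \<Rightarrow> real) \<Rightarrow>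
     ('m \<Rightarrow> (nat \<Rightarrow> real^7) \<Rightarrow> real) \<Rightarrow> ('m \<Rightarrow> real^7 \<Rightarrow> real^7 \<Rightarrow> complex^'r^'r::finite) \<Rightarrow> bool" where
  "selfdual_contact_instanton K \<eta> G \<mu> F \<longleftrightarrow>
     (\<forall>p. form2 (F p) = hodge (G p) (\<mu> p) 5
        (wedge 3 2 (wedge 1 2 (form1 (\<eta> p)) (form2 (ext_d1 K \<eta> p))) (form2 (F p))))"

text \<open>The projection of the complexified tangent space onto \<open>H\<^sup>0\<^sup>,\<^sup>1\<close> along \<open>H\<^sup>1\<^sup>,\<^sup>0 \<oplus> N\<^sub>\<xi>\<close>,
  on real vectors, and the \<open>(0,2)\<close>-component obtained from it.\<close>

definition proj_01 ::
    "('m \<Rightarrow> real^7 \<Rightarrow> real) \<Rightarrow> ('m \<Rightarrow> real^7) \<Rightarrow> ('m \<Rightarrow> real^7 \<Rightarrow> real^7) \<Rightarrow> 'm \<Rightarrow> real^7 \<Rightarrow> complex^7" where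
  "proj_01 \<eta> \<xi> \<Phi> p u = (1 / 2) *s (cvec (u - \<eta> p u *\<^sub>R \<xi> p) + \<i> *s cvec (\<Phi> p u))"

definition component_02 ::
    "('m \<Rightarrow> real^7 \<Rightarrow> real) \<Rightarrow> ('m \<Rightarrow> real^7) \<Rightarrow> ('m \<Rightarrow> real^7 \<Rightarrow> real^7) \<Rightarrow>
     ('m \<Rightarrow> real^7 \<Rightarrow> real^7 \<Rightarrow> complex^'r^'r::finite) \<Rightarrow> 'm \<Rightarrow> real^7 \<Rightarrow> real^7 \<Rightarrow> complex^'r^'r" where
  "component_02 \<eta> \<xi> \<Phi> F p u v = cext_2form (F p) (proj_01 \<eta> \<xi> \<Phi> p u) (proj_01 \<eta> \<xi> \<Phi> p v)"

text \<open>
  The two curvature equations alone. That the connection is moreover unitary for some Hermitian metric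
  is kept separate (\<open>unitary_connection\<close>): without it they do not determine \<open>F\<^sup>2\<^sup>,\<^sup>0\<close> and \<open>i\<^sub>\<xi>F\<close>.
\<close>

definition transverse_HYM ::
    "('m, 7) atlas \<Rightarrow> ('m \<Rightarrow> real^7 \<Rightarrow> real) \<Rightarrow> ('m \<Rightarrow> real^7) \<Rightarrow> ('m \<Rightarrow> real^7 \<Rightarrow> real^7) \<Rightarrow>
     ('m \<Rightarrow> real^7 \<Rightarrow> real^7 \<Rightarrow> real) \<Rightarrow> ('m \<Rightarrow> real^7 \<Rightarrow> real^7 \<Rightarrow> complex^'r^'r::finite) \<Rightarrow> bool" where
  "transverse_HYM K \<eta> \<xi> \<Phi> G F \<longleftrightarrow>
     (\<forall>p. inner_2form (G p) (F p) (ext_d1 K \<eta> p) = 0) \<and>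
     (\<forall>p u v. component_02 \<eta> \<xi> \<Phi> F p u v = 0)"

end

theory Submission
  imports Defs
begin

text \<open>
  In an adapted frame, with \<open>J\<close> the complex structure for which \<open>e\<^sup>j + \<i> e\<^bsup>j+3\<^esup>\<close> has type \<open>(1,0)\<close>,
  \<open>*(\<eta> \<and> \<omega> \<and> F)(u, v) = F(Ju, Jv) - (F, \<omega>) \<omega>(u, v)\<close> for every 2-form \<open>F\<close>; as \<open>J = \<plusminus>\<Phi>\<close> and \<open>\<Phi>\<xi> = 0\<close>, the first
  term is \<open>F(\<Phi>u, \<Phi>v)\<close> and ignores \<open>\<xi>\<close>. If \<open>F\<close> is selfdual, the arguments \<open>e\<^sub>1, e\<^sub>4\<close> give \<open>(F, \<omega>) = 0\<close>, so \<open>F\<close> is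
  \<open>\<Phi>\<close>-invariant, i.e. horizontal of type \<open>(1,1)\<close>.

  Conversely, flatness of the partial connection gives \<open>F(\<xi>, \<cdot>) = 0\<close> on \<open>H\<^sup>0\<^sup>,\<^sup>1\<close>. Unitarity makes \<open>F\<close>
  skew-Hermitian on real vectors, so the complex equations \<open>F(\<xi>, \<cdot>) = 0\<close> and \<open>F\<^sup>0\<^sup>,\<^sup>2 = 0\<close> split into
  real ones, which say that \<open>F\<close> is \<open>\<Phi>\<close>-invariant.
\<close>

section \<open>Alternating sums and top-degree forms\<close>

text \<open>Two of the definitions, \<open>hodge\<close> and \<open>inner_2form\<close>, use an
  orthonormal basis picked by choice, so the formula cannot be read off an adapted frame directly.
  The star is moved to that frame because its whole sum over permutations is a top-degree form in
  the frame vectors and an oriented orthonormal change of frame has determinant 1; the inner product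
  is moved because it is a double trace. A second obstacle is that connections act on global
  sections and fields, while the curvature identities are pointwise: vectors and fibre elements are
  extended by means of bump functions. The analysis culminates in the symmetry of second
  derivatives, which gives [X, Y] f = X Y f - Y X f and hence the skew-Hermitian curvature. In the
  converse, the bracket with the Reeb field must preserve the distribution along which flatness is
  assumed; this is where the covariant derivatives of \<open>\<xi>\<close> and \<open>\<Phi>\<close>
  enter, through the vanishing of the Lie derivative of \<open>\<Phi>\<close> along
  \<open>\<xi>\<close>.\<close>

definition alt_sum ::
    "nat \<Rightarrow> ((nat \<Rightarrow> 'v) \<Rightarrow> 'w::real_vector) \<Rightarrow> (nat \<Rightarrow> 'v) \<Rightarrow> 'w" where
  "alt_sum n L v = (\<Sum>\<pi> | \<pi> permutes {1..n}. of_int (sign \<pi>) *\<^sub>R L (v \<circ> \<pi>))"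

lemma sign_square_real [simp]: "of_int (sign p) * of_int (sign p) = (1::real)"
  by (cases p rule: sign_cases) auto

lemma alt_sum_permute:
  assumes "\<rho> permutes {1..n}"
  shows "alt_sum n L (v \<circ> \<rho>) = of_int (sign \<rho>) *\<^sub>R alt_sum n L v"
proof -
  have "alt_sum n L v = (\<Sum>\<pi> | \<pi> permutes {1..n}. of_int (sign (\<rho> \<circ> \<pi>)) *\<^sub>R L (v \<circ> (\<rho> \<circ> \<pi>)))"
    unfolding alt_sum_def by (rule setum_permutations_compose_left[OF assms])
  also have "\<dots> = (\<Sum>\<pi> | \<pi> permutes {1..n}. of_int (sign \<rho>) *\<^sub>R of_int (sign \<pi>) *\<^sub>R L (v \<circ> \<rho> \<circ> \<pi>))"
    using assms
    by (intro sum.cong refl) (auto simp: sign_compose permutes_imp_permutation[of "{1..n}"] o_assoc)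
  also have "\<dots> = of_int (sign \<rho>) *\<^sub>R alt_sum n L (v \<circ> \<rho>)"
    unfolding alt_sum_def by (simp add: scaleR_sum_right)
  finally show ?thesis by simp
qed

text \<open>The permutation acts on the slots of \<open>L\<close>, not on the vectors as in
  \<open>alt_sum_permute\<close>, so the sum is reindexed by composition on the other side.\<close>

lemma alt_sum_precompose:
  assumes "\<rho> permutes {1..n}"
  shows "alt_sum n (\<lambda>x. L (x \<circ> \<rho>)) v = of_int (sign \<rho>) *\<^sub>R alt_sum n L v"
proof -
  have "alt_sum n L v = (\<Sum>\<pi> | \<pi> permutes {1..n}. of_int (sign (\<pi> \<circ> \<rho>)) *\<^sub>R L (v \<circ> (\<pi> \<circ> \<rho>)))"
    unfolding alt_sum_def by (rule sum_permutations_compose_right[OF assms])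
  also have "\<dots> = (\<Sum>\<pi> | \<pi> permutes {1..n}. of_int (sign \<rho>) *\<^sub>R of_int (sign \<pi>) *\<^sub>R L (v \<circ> \<pi> \<circ> \<rho>))"
    using assms
    by (intro sum.cong refl) (auto simp: sign_compose permutes_imp_permutation[of "{1..n}"] o_assoc mult.commute)
  also have "\<dots> = of_int (sign \<rho>) *\<^sub>R alt_sum n (\<lambda>x. L (x \<circ> \<rho>)) v"
    unfolding alt_sum_def by (simp add: scaleR_sum_right)
  finally show ?thesis by simp
qed

lemma alt_sum_scaleR: "alt_sum n (\<lambda>x. a *\<^sub>R L x) v = a *\<^sub>R alt_sum n L v"
  unfolding alt_sum_def scaleR_sum_right by (intro sum.cong refl) simp

text \<open>
  Inside an outer alternating sum the antisymmetrisations coming from wedge products are redundant; this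
  turns the nested sums in \<open>hodge_contact_wedge\<close> into a single one.
\<close>

lemma alt_sum_alt_sum:
  assumes "k \<le> n"
  shows "alt_sum n (alt_sum k L) v = fact k *\<^sub>R alt_sum n L v"
proof -
  have "alt_sum n (alt_sum k L) v =
      (\<Sum>\<rho> | \<rho> permutes {1..k}. of_int (sign \<rho>) *\<^sub>R alt_sum n (\<lambda>x. L (x \<circ> \<rho>)) v)"
    unfolding alt_sum_def scaleR_sum_right
    by (subst sum.swap) (simp add: mult.commute)
  also have "\<dots> = (\<Sum>\<rho> | \<rho> permutes {1..k}. alt_sum n L v)"
  proof (intro sum.cong refl, goal_cases)
    case (1 \<rho>)
    then have "\<rho> permutes {1..n}" using assms by (auto intro: permutes_subset)
    then show ?case by (simp add: alt_sum_precompose)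
  qed
  also have "\<dots> = fact k *\<^sub>R alt_sum n L v"
    using card_permutations[of "{1..k}" k] by (simp add: sum_constant_scaleR)
  finally show ?thesis .
qed

text \<open>A factor that reads only slots beyond \<open>k\<close> is constant along the inner
  permutations and can enter their sum. In this version the factor is real, in
  \<open>alt_sum_pull_right\<close> it is the vector.\<close>

lemma alt_sum_pull:
  assumes "\<And>\<rho>. \<rho> permutes {1..k} \<Longrightarrow> c (x \<circ> \<rho>) = c x"
  shows "c x *\<^sub>R alt_sum k L x = alt_sum k (\<lambda>y. c y *\<^sub>R L y) x"
  unfolding alt_sum_def scaleR_sum_right by (intro sum.cong refl) (simp add: assms mult.commute)

lemma alt_sum_pull_right:
  assumes "\<And>\<rho>. \<rho> permutes {1..k} \<Longrightarrow> B (x \<circ> \<rho>) = B x"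
  shows "alt_sum k L x *\<^sub>R B x = alt_sum k (\<lambda>y. L y *\<^sub>R B y) x"
  unfolding alt_sum_def scaleR_sum_left by (intro sum.cong refl) (simp add: assms)

lemma wedge_eq_alt_sum:
  "wedge k l \<alpha> \<beta> v = (1 / (fact k * fact l)) *\<^sub>R alt_sum (k + l) (\<lambda>x. \<alpha> x *\<^sub>R \<beta> (\<lambda>i. x (k + i))) v"
  unfolding wedge_def alt_sum_def by (simp add: comp_def)

lemma hodge_eq_alt_sum:
  fixes G :: "real^'n::finite \<Rightarrow> real^'n \<Rightarrow> real"
  shows "hodge G \<mu> k \<beta> v = (1 / fact k) *\<^sub>R
     alt_sum CARD('n) (\<lambda>x. (\<Prod>j\<in>{1..CARD('n) - k}. G (x (k + j)) (v j)) *\<^sub>R \<beta> x) (SOME e. pos_onb G \<mu> e)"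
  unfolding hodge_def alt_sum_def Let_def by (simp add: comp_def)

text \<open>The star contributes 1/5! and the two wedge products 1/(3! 2!) and 1/(1! 2!), together
  1/2880. Flattening the inner sums over permutations of \<open>{1..5}\<close> and
  \<open>{1..3}\<close> gives back 5! and 3!, which leaves 1/4.\<close>

lemma hodge_contact_wedge:
  fixes G :: "real^7 \<Rightarrow> real^7 \<Rightarrow> real" and F :: "real^7 \<Rightarrow> real^7 \<Rightarrow> 'w::real_vector"
  shows "hodge G \<mu> 5 (wedge 3 2 (wedge 1 2 (form1 \<eta>) (form2 \<omega>)) (form2 F)) v =
     (1 / 4) *\<^sub>R alt_sum 7 (\<lambda>x. (G (x 6) (v 1) * G (x 7) (v 2) * (\<eta> (x 1) * \<omega> (x 2) (x 3))) *\<^sub>R F (x 4) (x 5))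
       (SOME e. pos_onb G \<mu> e)"
proof -
  have fix3: "\<rho> 4 = 4 \<and> \<rho> 5 = 5 \<and> \<rho> 6 = 6 \<and> \<rho> 7 = 7" if "\<rho> permutes {1..3}" for \<rho> :: "nat \<Rightarrow> nat"
    using that by (simp add: permutes_def)
  have fix5: "\<rho> 6 = 6 \<and> \<rho> 7 = 7" if "\<rho> permutes {1..5}" for \<rho> :: "nat \<Rightarrow> nat"
    using that by (simp add: permutes_def)
  have w12: "wedge 1 2 (form1 \<eta>) (form2 \<omega>) x = (1/2) * alt_sum 3 (\<lambda>x. \<eta> (x 1) * \<omega> (x 2) (x 3)) x" for x
    unfolding wedge_eq_alt_sum form1_def form2_def by (simp add: eval_nat_numeral)
  have w32: "wedge 3 2 (wedge 1 2 (form1 \<eta>) (form2 \<omega>)) (form2 F) x =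
      (1/24) *\<^sub>R alt_sum 5 (alt_sum 3 (\<lambda>x. (\<eta> (x 1) * \<omega> (x 2) (x 3)) *\<^sub>R F (x 4) (x 5))) x" for x
  proof -
    have "wedge 3 2 (wedge 1 2 (form1 \<eta>) (form2 \<omega>)) (form2 F) x =
      (1/12) *\<^sub>R alt_sum 5 (\<lambda>x. (1/2) *\<^sub>R (alt_sum 3 (\<lambda>x. \<eta> (x 1) * \<omega> (x 2) (x 3)) x *\<^sub>R F (x 4) (x 5))) x"
      unfolding wedge_eq_alt_sum[of 3] w12 by (simp add: fact_numeral form2_def)
    also have "\<dots> = (1/24) *\<^sub>R alt_sum 5 (\<lambda>x. alt_sum 3 (\<lambda>x. \<eta> (x 1) * \<omega> (x 2) (x 3)) x *\<^sub>R F (x 4) (x 5)) x"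
      by (subst alt_sum_scaleR) simp
    also have "(\<lambda>x. alt_sum 3 (\<lambda>x. \<eta> (x 1) * \<omega> (x 2) (x 3)) x *\<^sub>R F (x 4) (x 5)) =
        alt_sum 3 (\<lambda>x. (\<eta> (x 1) * \<omega> (x 2) (x 3)) *\<^sub>R F (x 4) (x 5))"
      by (rule ext, rule alt_sum_pull_right[where B="\<lambda>x. F (x 4) (x 5)"]) (drule fix3, simp)
    finally show ?thesis .
  qed
  have "hodge G \<mu> 5 (wedge 3 2 (wedge 1 2 (form1 \<eta>) (form2 \<omega>)) (form2 F)) v = (1/120) *\<^sub>R
      alt_sum 7 (\<lambda>x. (1/24) *\<^sub>R ((G (x 6) (v 1) * G (x 7) (v 2)) *\<^sub>R
        alt_sum 5 (alt_sum 3 (\<lambda>x. (\<eta> (x 1) * \<omega> (x 2) (x 3)) *\<^sub>R F (x 4) (x 5))) x)) (SOME e. pos_onb G \<mu> e)"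
    unfolding hodge_eq_alt_sum w32 by (simp add: fact_numeral eval_nat_numeral mult.commute)
  also have "\<dots> = (1/2880) *\<^sub>R
      alt_sum 7 (alt_sum 5 (\<lambda>x. (G (x 6) (v 1) * G (x 7) (v 2)) *\<^sub>R
         alt_sum 3 (\<lambda>x. (\<eta> (x 1) * \<omega> (x 2) (x 3)) *\<^sub>R F (x 4) (x 5)) x)) (SOME e. pos_onb G \<mu> e)"
    by (subst alt_sum_scaleR, subst alt_sum_pull[where c="\<lambda>x. G (x 6) (v 1) * G (x 7) (v 2)"])
       (drule fix5, simp_all)
  also have "\<dots> = (1/24) *\<^sub>R
      alt_sum 7 (\<lambda>x. (G (x 6) (v 1) * G (x 7) (v 2)) *\<^sub>R
         alt_sum 3 (\<lambda>x. (\<eta> (x 1) * \<omega> (x 2) (x 3)) *\<^sub>R F (x 4) (x 5)) x) (SOME e. pos_onb G \<mu> e)"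
    by (subst alt_sum_alt_sum) (simp_all add: fact_numeral)
  also have "\<dots> = (1/24) *\<^sub>R
      alt_sum 7 (alt_sum 3 (\<lambda>x. (G (x 6) (v 1) * G (x 7) (v 2)) *\<^sub>R
         (\<eta> (x 1) * \<omega> (x 2) (x 3)) *\<^sub>R F (x 4) (x 5))) (SOME e. pos_onb G \<mu> e)"
    by (subst alt_sum_pull[where c="\<lambda>x. G (x 6) (v 1) * G (x 7) (v 2)"]) (drule fix3, simp_all)
  also have "\<dots> = (1/4) *\<^sub>R
      alt_sum 7 (\<lambda>x. (G (x 6) (v 1) * G (x 7) (v 2)) *\<^sub>R
         (\<eta> (x 1) * \<omega> (x 2) (x 3)) *\<^sub>R F (x 4) (x 5)) (SOME e. pos_onb G \<mu> e)"
    by (subst alt_sum_alt_sum) (simp_all add: fact_numeral)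
  finally show ?thesis by (simp add: mult.assoc)
qed

section \<open>Alternating forms of top degree and change of basis\<close>

lemma alt_form_alt_sum:
  fixes L :: "(nat \<Rightarrow> real^'n::finite) \<Rightarrow> 'w::real_vector"
  assumes loc: "\<And>v w. (\<And>i. i \<in> {1..n} \<Longrightarrow> v i = w i) \<Longrightarrow> L v = L w"
    and lin: "\<And>v i. i \<in> {1..n} \<Longrightarrow> linear (\<lambda>x. L (v(i := x)))"
  shows "alt_form n (alt_sum n L)"
  unfolding alt_form_def
proof (intro conjI allI ballI impI)
  fix v w :: "nat \<Rightarrow> real^'n" assume "\<forall>i\<in>{1..n}. v i = w i"
  then show "alt_sum n L v = alt_sum n L w"
    unfolding alt_sum_def
  proof (intro sum.cong refl arg_cong[where f="scaleR _"] loc, goal_cases)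
    case (1 \<pi> i)
    then show ?case using permutes_in_image[of \<pi> "{1..n}" i] by simp
  qed
next
  fix v :: "nat \<Rightarrow> real^'n" and i assume i: "i \<in> {1..n}"
  have "linear (\<lambda>x. of_int (sign \<pi>) *\<^sub>R L (v(i := x) \<circ> \<pi>))" if \<pi>: "\<pi> permutes {1..n}" for \<pi>
  proof -
    \<comment> \<open>Replacing the vector \<open>v i\<close> affects \<open>L\<close> only in the
      slot that \<open>\<pi>\<close> sends to \<open>i\<close>.\<close>
    have "v(i := x) \<circ> \<pi> = (v \<circ> \<pi>)(inv \<pi> i := x)" for x
      using \<pi> by (auto simp: fun_eq_iff permutes_inverses)
    moreover have "inv \<pi> i \<in> {1..n}"
      using i permutes_in_image[OF permutes_inv[OF \<pi>]] by blast
    ultimately show ?thesis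
      using linear_compose_scale_right[OF lin] by simp
  qed
  then show "linear (\<lambda>x. alt_sum n L (v(i := x)))"
    unfolding alt_sum_def by (intro linear_compose_sum) auto
next
  fix v :: "nat \<Rightarrow> real^'n" and i j assume ij: "i \<in> {1..n}" "j \<in> {1..n}" "i \<noteq> j \<and> v i = v j"
  then have "v \<circ> Transposition.transpose i j = v"
    by (auto simp: fun_eq_iff Transposition.transpose_def)
  \<comment> \<open>Exchanging two equal entries leaves \<open>v\<close> fixed but changes the sign
    of the sum.\<close>
  then have "alt_sum n L v = - alt_sum n L v"
    using alt_sum_permute[OF permutes_swap_id[OF ij(1,2)], of L v] ij by (simp add: sign_swap_id)
  then have "2 *\<^sub>R alt_sum n L v = 0"
    by (simp add: scaleR_2 eq_neg_iff_add_eq_0)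
  then show "alt_sum n L v = 0" by simp
qed

text \<open>Polarisation: expanding \<open>V (x + y) (x + y) = 0\<close> leaves
  \<open>V x y + V y x = 0\<close>.\<close>

lemma alt_form_swap:
  assumes "alt_form n \<alpha>" "i \<in> {1..n}" "j \<in> {1..n}" "i \<noteq> j"
  shows "\<alpha> (v \<circ> Transposition.transpose i j) = - \<alpha> v"
proof -
  define V where "V x y = \<alpha> (v(i := x, j := y))" for x y
  have lin1: "linear (\<lambda>x. V x y)" for y
  proof -
    have "linear (\<lambda>x. \<alpha> ((v(j := y))(i := x)))" using assms unfolding alt_form_def by blast
    then show ?thesis using assms(4) by (simp add: V_def fun_upd_twist)
  qed
  have lin2: "linear (V x)" for x
    using assms unfolding alt_form_def V_def by blast
  have zero: "V x x = 0" for x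
    using assms unfolding alt_form_def V_def by (metis fun_upd_same fun_upd_other)
  have "V x y + V y x = 0" for x y
    using zero[of "x + y"] unfolding linear_add[OF lin1] linear_add[OF lin2] by (simp add: zero add.commute)
  then have "V (v j) (v i) = - V (v i) (v j)"
    by (simp add: eq_neg_iff_add_eq_0)
  moreover have "V (v j) (v i) = \<alpha> (v \<circ> Transposition.transpose i j)"
    unfolding V_def using assms(4) by (auto simp: Transposition.transpose_def fun_eq_iff intro!: arg_cong[where f=\<alpha>])
  moreover have "V (v i) (v j) = \<alpha> v" unfolding V_def by simp
  ultimately show ?thesis by simp
qed

lemma alt_form_permute:
  assumes "alt_form n \<alpha>" "\<pi> permutes {1..n}"
  shows "\<alpha> (v \<circ> \<pi>) = of_int (sign \<pi>) *\<^sub>R \<alpha> v"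
proof -
  have "finite {1..n}" by simp
  from this assms(2) show ?thesis
  proof (induction arbitrary: v rule: permutes_rev_induct)
    case id
    then show ?case by simp
  next
    case (swap a b p)
    have A: "\<alpha> (v \<circ> (p \<circ> Transposition.transpose a b)) = - \<alpha> (v \<circ> p)"
      using alt_form_swap[OF assms(1) swap(1-3), of "v \<circ> p"] by (simp add: o_assoc)
    have B: "sign (p \<circ> Transposition.transpose a b) = - sign p"
      using swap by (simp add: sign_compose permutes_imp_permutation[OF _ swap(4)] sign_swap_id permutation_swap_id)
    show ?case unfolding A B swap.IH by simp
  qed
qed

text \<open>Induction on the set of expanded slots. A choice of indices on \<open>T\<close> is
  encoded as a total function that is the identity off \<open>T\<close>: each choice is then counted
  once, and for \<open>T = {1..n}\<close> the permutations are literally among the choices.\<close>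

lemma alt_form_multilinear_expand:
  assumes \<alpha>: "alt_form n \<alpha>" and T: "T \<subseteq> {1..n}" and S: "finite S"
  shows "\<alpha> (\<lambda>i. if i \<in> T then (\<Sum>j\<in>S. c i j *\<^sub>R e j) else w i) =
     (\<Sum>\<phi> | (\<forall>i\<in>T. \<phi> i \<in> S) \<and> (\<forall>i. i \<notin> T \<longrightarrow> \<phi> i = i).
        (\<Prod>i\<in>T. c i (\<phi> i)) *\<^sub>R \<alpha> (\<lambda>i. if i \<in> T then e (\<phi> i) else w i))"
proof -
  have "finite T" using T by (rule finite_subset) simp
  then show ?thesis using T
  proof (induction T arbitrary: w rule: finite_induct)
    case empty
    have "{\<phi>. \<forall>i. \<phi> i = i} = {\<lambda>i::nat. i}" by auto
    then show ?case by simp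
  next
    case (insert a T)
    let ?P = "\<lambda>T. {\<phi>. (\<forall>i\<in>T. \<phi> i \<in> S) \<and> (\<forall>i. i \<notin> T \<longrightarrow> \<phi> i = i)}"
    let ?u = "\<lambda>i. if i \<in> T then (\<Sum>j\<in>S. c i j *\<^sub>R e j) else w i"
    have lin: "linear (\<lambda>x. \<alpha> (?u(a := x)))"
      using \<alpha> insert.prems unfolding alt_form_def by blast
    have "\<alpha> (\<lambda>i. if i \<in> insert a T then (\<Sum>j\<in>S. c i j *\<^sub>R e j) else w i) =
        \<alpha> (?u(a := \<Sum>j\<in>S. c a j *\<^sub>R e j))"
      by (rule arg_cong[where f=\<alpha>]) auto
    also have "\<dots> = (\<Sum>j\<in>S. c a j *\<^sub>R \<alpha> (?u(a := e j)))"
      using linear_sum[OF lin, of "\<lambda>j. c a j *\<^sub>R e j" S] linear_scale[OF lin] by simp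
    also have "\<dots> = (\<Sum>j\<in>S. c a j *\<^sub>R (\<Sum>\<phi>\<in>?P T. (\<Prod>i\<in>T. c i (\<phi> i)) *\<^sub>R
        \<alpha> (\<lambda>i. if i \<in> T then e (\<phi> i) else (w(a := e j)) i)))"
    proof (intro sum.cong refl arg_cong[where f="scaleR _"], goal_cases)
      case (1 j)
      have "?u(a := e j) = (\<lambda>i. if i \<in> T then (\<Sum>j\<in>S. c i j *\<^sub>R e j) else (w(a := e j)) i)"
        using insert.hyps by auto
      then show ?case using insert by simp
    qed
    also have "\<dots> = (\<Sum>(j, \<phi>)\<in>S \<times> ?P T. (c a j * (\<Prod>i\<in>T. c i (\<phi> i))) *\<^sub>R
        \<alpha> (\<lambda>i. if i \<in> T then e (\<phi> i) else (w(a := e j)) i))"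
      using S by (simp add: scaleR_sum_right sum.cartesian_product)
    also have "\<dots> = (\<Sum>\<phi>\<in>?P (insert a T). (\<Prod>i\<in>insert a T. c i (\<phi> i)) *\<^sub>R
        \<alpha> (\<lambda>i. if i \<in> insert a T then e (\<phi> i) else w i))"
    \<comment> \<open>A choice on \<open>insert a T\<close> splits into its value at
      \<open>a\<close> and the same map reset to the identity at \<open>a\<close>.\<close>
    proof (rule sum.reindex_bij_witness[where i="\<lambda>\<phi>. (\<phi> a, \<phi>(a := a))" and j="\<lambda>(j, \<phi>). \<phi>(a := j)"], goal_cases)
      case (5 x)
      obtain j \<phi> where x: "x = (j, \<phi>)" by force
      show ?case unfolding x prod.case
      proof (intro arg_cong2[where f=scaleR])
      show "(\<Prod>i\<in>insert a T. c i ((\<phi>(a := j)) i)) = c a j * (\<Prod>i\<in>T. c i (\<phi> i))"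
        using insert.hyps by (auto intro!: prod.cong)
      show "\<alpha> (\<lambda>i. if i \<in> insert a T then e ((\<phi>(a := j)) i) else w i) =
          \<alpha> (\<lambda>i. if i \<in> T then e (\<phi> i) else (w(a := e j)) i)"
        using insert.hyps by (intro arg_cong[where f=\<alpha>]) auto
    qed
    qed (use insert.hyps in auto)
    finally show ?case .
  qed
qed

text \<open>The coefficient is the Leibniz formula for the determinant of \<open>c\<close>: an index
  map that is not a permutation repeats a vector, so its term vanishes.\<close>

lemma alt_form_expand:
  fixes c :: "nat \<Rightarrow> nat \<Rightarrow> real"
  assumes \<alpha>: "alt_form n \<alpha>" and f: "\<And>i. i \<in> {1..n} \<Longrightarrow> f i = (\<Sum>j\<in>{1..n}. c i j *\<^sub>R e j)"
  shows "\<alpha> f = (\<Sum>\<pi> | \<pi> permutes {1..n}. of_int (sign \<pi>) * (\<Prod>i\<in>{1..n}. c i (\<pi> i))) *\<^sub>R \<alpha> e"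
proof -
  let ?P = "{\<phi>. (\<forall>i\<in>{1..n}. \<phi> i \<in> {1..n}) \<and> (\<forall>i. i \<notin> {1..n} \<longrightarrow> \<phi> i = i)}"
  let ?t = "\<lambda>\<phi>. (\<Prod>i\<in>{1..n}. c i (\<phi> i)) *\<^sub>R \<alpha> (e \<circ> \<phi>)"
  have loc: "\<alpha> v = \<alpha> w" if "\<forall>i\<in>{1..n}. v i = w i" for v w
    using \<alpha> that unfolding alt_form_def by blast
  have "\<alpha> f = \<alpha> (\<lambda>i. if i \<in> {1..n} then (\<Sum>j\<in>{1..n}. c i j *\<^sub>R e j) else f i)"
    by (rule loc) (use f in auto)
  also have "\<dots> = (\<Sum>\<phi>\<in>?P. (\<Prod>i\<in>{1..n}. c i (\<phi> i)) *\<^sub>R \<alpha> (\<lambda>i. if i \<in> {1..n} then e (\<phi> i) else f i))"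
    by (rule alt_form_multilinear_expand[OF \<alpha>]) auto
  also have "\<dots> = sum ?t ?P"
    by (intro sum.cong refl arg_cong[where f="scaleR _"] loc) auto
  also have "\<dots> = sum ?t {\<pi>. \<pi> permutes {1..n}}"
  proof (rule sum.mono_neutral_right)
    show "finite ?P" by (rule finite_bounded_functions) auto
    show "{\<pi>. \<pi> permutes {1..n}} \<subseteq> ?P"
      using permutes_in_image permutes_not_in by fastforce
    show "\<forall>\<phi>\<in>?P - {\<pi>. \<pi> permutes {1..n}}. ?t \<phi> = 0"
    proof
      fix \<phi> assume \<phi>: "\<phi> \<in> ?P - {\<pi>. \<pi> permutes {1..n}}"
      have "\<not> inj_on \<phi> {1..n}"
      proof
        assume "inj_on \<phi> {1..n}"
        moreover have "\<phi> ` {1..n} \<subseteq> {1..n}" using \<phi> by auto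
        ultimately have "bij_betw \<phi> {1..n} {1..n}"
          by (simp add: bij_betw_def endo_inj_surj)
        then show False using \<phi> by (auto intro: bij_imp_permutes)
      qed
      then obtain i j where "i \<in> {1..n}" "j \<in> {1..n}" "i \<noteq> j" "\<phi> i = \<phi> j"
        by (auto simp: inj_on_def)
      then have "\<alpha> (e \<circ> \<phi>) = 0" using \<alpha> unfolding alt_form_def by (metis comp_apply)
      then show "?t \<phi> = 0" by simp
    qed
  qed
  also have "\<dots> = (\<Sum>\<pi> | \<pi> permutes {1..n}. (of_int (sign \<pi>) * (\<Prod>i\<in>{1..n}. c i (\<pi> i))) *\<^sub>R \<alpha> e)"
    by (intro sum.cong refl) (auto simp: alt_form_permute[OF \<alpha>] mult.commute)
  finally show ?thesis by (simp add: scaleR_sum_left)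
qed

section \<open>Orthonormal frames\<close>

locale inner_form =
  fixes G :: "real^'n::finite \<Rightarrow> real^'n \<Rightarrow> real"
  assumes bilin: "bilinear G" and sym: "G u v = G v u" and pos: "u \<noteq> 0 \<Longrightarrow> G u u > 0"
begin

lemma linear_right: "linear (G u)" and linear_left: "linear (\<lambda>u. G u v)"
  using bilin unfolding bilinear_def by auto

text \<open>Orthonormality makes the family injective and independent, so it is a basis by
  dimension; pairing with \<open>e j\<close> then reads off the coefficients.\<close>

lemma onb_expand:
  assumes e: "pos_onb G \<mu> e"
  shows "x = (\<Sum>j\<in>{1..CARD('n)}. G x (e j) *\<^sub>R e j)"
proof -
  let ?I = "{1..CARD('n)}"
  have ort: "G (e i) (e j) = (if i = j then 1 else 0)" if "i \<in> ?I" "j \<in> ?I" for i j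
    using e that unfolding pos_onb_def by blast
  have coeff: "G (\<Sum>i\<in>?I. c i *\<^sub>R e i) (e j) = c j" if "j \<in> ?I" for c j
  proof -
    have "G (\<Sum>i\<in>?I. c i *\<^sub>R e i) (e j) = (\<Sum>i\<in>?I. c i * G (e i) (e j))"
      by (simp add: linear_sum[OF linear_left] linear_scale[OF linear_left])
    also have "\<dots> = (\<Sum>i\<in>?I. if i = j then c j else 0)"
      by (intro sum.cong refl) (use that ort in auto)
    finally show ?thesis using that by simp
  qed
  have inj: "inj_on e ?I"
  proof (rule inj_onI)
    fix i j assume "i \<in> ?I" "j \<in> ?I" "e i = e j"
    then show "i = j" using ort[of i j] ort[of i i] by (auto split: if_splits)
  qed
  have "independent (e ` ?I)"
  proof (rule independent_if_scalars_zero)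
    fix f x assume 0: "(\<Sum>x\<in>e ` ?I. f x *\<^sub>R x) = 0" and x: "x \<in> e ` ?I"
    then obtain j where j: "j \<in> ?I" "x = e j" by auto
    have "(\<Sum>i\<in>?I. f (e i) *\<^sub>R e i) = 0"
      using 0 by (subst (asm) sum.reindex[OF inj]) (simp add: comp_def)
    then show "f x = 0"
      using coeff[OF j(1), of "\<lambda>i. f (e i)"] j linear_0[OF linear_left] by simp
  qed simp
  moreover have "card (e ` ?I) = CARD('n)"
    using card_image[OF inj] by simp
  ultimately have "UNIV \<subseteq> span (e ` ?I)"
    by (intro card_ge_dim_independent) auto
  then have "x \<in> span (e ` ?I)" by auto
  then obtain u where "x = (\<Sum>v\<in>e ` ?I. u v *\<^sub>R v)"
    by (auto simp: span_finite)
  then have x: "x = (\<Sum>i\<in>?I. u (e i) *\<^sub>R e i)"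
    by (subst (asm) sum.reindex[OF inj]) (simp add: comp_def)
  then have "u (e j) = G x (e j)" if "j \<in> ?I" for j
    using coeff[OF that, of "\<lambda>i. u (e i)", folded x] by simp
  then show ?thesis by (intro trans[OF x] sum.cong) auto
qed

text \<open>This is what makes the choice of frame in \<open>hodge\<close> harmless. The determinant
  \<open>D f e\<close> of the change of frame equals that of its transpose \<open>D e f\<close>;
  expanding \<open>\<mu>\<close> back and forth shows that their product is 1, and equal orientation
  makes the sign positive.\<close>

lemma alt_form_pos_onb:
  assumes e: "pos_onb G \<mu> e" and f: "pos_onb G \<mu> f" and \<mu>: "alt_form CARD('n) \<mu>"
    and \<alpha>: "alt_form CARD('n) \<alpha>"
  shows "\<alpha> f = \<alpha> e"
proof -
  let ?I = "{1..CARD('n)}"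
  define D where "D f e = (\<Sum>\<pi> | \<pi> permutes ?I. of_int (sign \<pi>) * (\<Prod>i\<in>?I. G (f i) (e (\<pi> i))))"
    for f e
  have expand: "\<beta> f = D f e *\<^sub>R \<beta> e" if "pos_onb G \<mu> e" "alt_form CARD('n) \<beta>"
    for f e and \<beta> :: "(nat \<Rightarrow> real^'n) \<Rightarrow> 'z::real_vector"
    unfolding D_def by (rule alt_form_expand[OF that(2)]) (rule onb_expand[OF that(1)])
  have "D f e = D e f"
  proof -
    \<comment> \<open>Summing over inverse permutations turns the determinant into that of the
      transposed matrix.\<close>
    have "D f e = (\<Sum>\<pi> | \<pi> permutes ?I. of_int (sign (inv \<pi>)) * (\<Prod>i\<in>?I. G (f i) (e (inv \<pi> i))))"
      unfolding D_def
      by (rule sum.reindex_bij_witness[where i=inv and j=inv]) (auto intro: permutes_inv simp: permutes_inv_inv)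
    also have "\<dots> = D e f"
      unfolding D_def
    proof (intro sum.cong refl, goal_cases)
      case (1 \<pi>)
      then have \<pi>: "\<pi> permutes ?I" by simp
      have "(\<Prod>i\<in>?I. G (f i) (e (inv \<pi> i))) = (\<Prod>i\<in>?I. G (f (\<pi> i)) (e (inv \<pi> (\<pi> i))))"
        by (rule prod.permute[OF \<pi>, unfolded comp_def])
      then show ?case
        using \<pi> by (simp add: sign_inverse permutes_imp_permutation[OF _ \<pi>] permutes_inverses sym)
    qed
    finally show ?thesis .
  qed
  moreover have "\<mu> e = D e f * (D f e * \<mu> e)"
    using expand[OF f \<mu>, of e] expand[OF e \<mu>, of f] by simp
  moreover have "\<mu> e > 0" "\<mu> f > 0" using e f unfolding pos_onb_def by auto
  ultimately have "D f e * D f e = 1" by simp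
  moreover have "D f e > 0"
    using expand[OF e \<mu>, of f] \<open>\<mu> e > 0\<close> \<open>\<mu> f > 0\<close> by (simp add: zero_less_mult_iff)
  ultimately have "D f e = 1"
    by (auto simp: square_eq_1_iff)
  then show ?thesis using expand[OF e \<alpha>, of f] by simp
qed

text \<open>The trace of a bilinear map with respect to \<open>G\<close>. One argument
  \<open>f i\<close> is expanded in \<open>e\<close>; after exchanging the sums the other argument
  recombines to \<open>e j\<close>.\<close>

lemma trace_onb:
  fixes b :: "real^'n \<Rightarrow> real^'n \<Rightarrow> 'w::real_vector"
  assumes e: "pos_onb G \<mu> e" and f: "pos_onb G \<nu> f" and b1: "\<And>v. linear (\<lambda>u. b u v)" and b2: "\<And>u. linear (b u)"
  shows "(\<Sum>i\<in>{1..CARD('n)}. b (f i) (f i)) = (\<Sum>i\<in>{1..CARD('n)}. b (e i) (e i))"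
proof -
  let ?I = "{1..CARD('n)}"
  have "(\<Sum>i\<in>?I. b (f i) (f i)) = (\<Sum>i\<in>?I. \<Sum>j\<in>?I. G (f i) (e j) *\<^sub>R b (e j) (f i))"
  proof (rule sum.cong[OF refl])
    fix i
    have "b (f i) (f i) = b (\<Sum>j\<in>?I. G (f i) (e j) *\<^sub>R e j) (f i)"
      using onb_expand[OF e, of "f i"] by simp
    then show "b (f i) (f i) = (\<Sum>j\<in>?I. G (f i) (e j) *\<^sub>R b (e j) (f i))"
      by (simp add: linear_sum[OF b1] linear_scale[OF b1])
  qed
  also have "\<dots> = (\<Sum>j\<in>?I. \<Sum>i\<in>?I. G (e j) (f i) *\<^sub>R b (e j) (f i))"
    by (subst sum.swap) (simp add: sym)
  also have "\<dots> = (\<Sum>j\<in>?I. b (e j) (e j))"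
  proof (rule sum.cong[OF refl])
    fix j
    have "b (e j) (e j) = b (e j) (\<Sum>i\<in>?I. G (e j) (f i) *\<^sub>R f i)"
      using onb_expand[OF f, of "e j"] by simp
    then show "(\<Sum>i\<in>?I. G (e j) (f i) *\<^sub>R b (e j) (f i)) = b (e j) (e j)"
      by (simp add: linear_sum[OF b2] linear_scale[OF b2])
  qed
  finally show ?thesis .
qed

end

section \<open>The operator \<open>*(\<eta> \<and> d\<eta> \<and> \<cdot>)\<close> in an adapted frame\<close>

text \<open>If a nonzero term forces \<open>\<pi>\<close> to agree with \<open>\<rho>\<close> off
  \<open>T\<close>, then \<open>\<pi>\<close> is \<open>\<rho>\<close> followed on the right by a
  permutation of \<open>T\<close>; this cuts a sum over 7! permutations down to 4!.\<close>

lemma alt_sum_restrict: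
  assumes \<rho>: "\<rho> permutes {1..n}" and T: "T \<subseteq> {1..n}"
    and L: "\<And>\<pi> i. \<pi> permutes {1..n} \<Longrightarrow> L (v \<circ> \<pi>) \<noteq> 0 \<Longrightarrow> i \<in> {1..n} - T \<Longrightarrow> \<pi> i = \<rho> i"
  shows "alt_sum n L v =
    of_int (sign \<rho>) *\<^sub>R (\<Sum>q | q permutes T. of_int (sign q) *\<^sub>R L (v \<circ> \<rho> \<circ> q))"
proof -
  have "alt_sum n L (v \<circ> \<rho>) = (\<Sum>q | q permutes T. of_int (sign q) *\<^sub>R L (v \<circ> \<rho> \<circ> q))"
    unfolding alt_sum_def
  proof (rule sum.mono_neutral_right)
    show "{q. q permutes T} \<subseteq> {q. q permutes {1..n}}"
      using T by (auto intro: permutes_subset)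
    show "\<forall>q\<in>{q. q permutes {1..n}} - {q. q permutes T}. of_int (sign q) *\<^sub>R L (v \<circ> \<rho> \<circ> q) = 0"
    proof
      fix q assume q: "q \<in> {q. q permutes {1..n}} - {q. q permutes T}"
      have "L (v \<circ> (\<rho> \<circ> q)) = 0"
      proof (rule ccontr)
        assume "L (v \<circ> (\<rho> \<circ> q)) \<noteq> 0"
        moreover have "\<rho> \<circ> q permutes {1..n}" using q \<rho> by (auto intro: permutes_compose)
        ultimately have "(\<rho> \<circ> q) i = \<rho> i" if "i \<in> {1..n} - T" for i
          using L that by blast
        then have "q i = i" if "i \<notin> T" for i
          using that q permutes_inj[OF \<rho>] permutes_not_in[of q "{1..n}" i]
          by (cases "i \<in> {1..n}") (auto dest: injD)
        then have "q permutes T" using q by (auto simp: permutes_def)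
        then show False using q by simp
      qed
      then show "of_int (sign q) *\<^sub>R L (v \<circ> \<rho> \<circ> q) = 0" by (simp add: o_assoc)
    qed
  qed (simp add: finite_permutations)
  then have "of_int (sign \<rho>) *\<^sub>R alt_sum n L v = (\<Sum>q | q permutes T. of_int (sign q) *\<^sub>R L (v \<circ> \<rho> \<circ> q))"
    by (simp add: alt_sum_permute[OF \<rho>])
  then have "of_int (sign \<rho>) *\<^sub>R of_int (sign \<rho>) *\<^sub>R alt_sum n L v =
      of_int (sign \<rho>) *\<^sub>R (\<Sum>q | q permutes T. of_int (sign q) *\<^sub>R L (v \<circ> \<rho> \<circ> q))"
    by simp
  then show ?thesis by simp
qed

text \<open>The six terms are the ways to split the four indices into two increasing pairs. Each
  collects 2! 2! = 4 permutations, which agree by skewness of \<open>B\<close> and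
  \<open>C\<close>.\<close>

lemma sum_permutations_2345:
  fixes B :: "nat \<Rightarrow> nat \<Rightarrow> real" and C :: "nat \<Rightarrow> nat \<Rightarrow> 'w::real_vector"
  assumes B: "\<And>i j. B i j = - B j i" and C: "\<And>i j. C i j = - C j i"
  shows "(\<Sum>q | q permutes {2,3,4,5::nat}. of_int (sign q) *\<^sub>R (B (q 2) (q 3) *\<^sub>R C (q 4) (q 5))) =
    4 *\<^sub>R (B 2 3 *\<^sub>R C 4 5 - B 2 4 *\<^sub>R C 3 5 + B 2 5 *\<^sub>R C 3 4
        + B 3 4 *\<^sub>R C 2 5 - B 3 5 *\<^sub>R C 2 4 + B 4 5 *\<^sub>R C 2 3)"
proof -
  have p: "permutation q" if "q permutes S" "finite S" for q and S :: "nat set"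
    using that by (rule permutes_imp_permutation[rotated])
  have 4: "(4 * r) *\<^sub>R x = r *\<^sub>R x + r *\<^sub>R x + r *\<^sub>R x + r *\<^sub>R x" for r and x :: 'w
    by (simp flip: scaleR_add_left)
  note B' = B[of 3 2] B[of 4 2] B[of 5 2] B[of 4 3] B[of 5 3] B[of 5 4]
  note C' = C[of 3 2] C[of 4 2] C[of 5 2] C[of 4 3] C[of 5 3] C[of 5 4]
  show ?thesis
    by (simp add: sum_over_permutations_insert permutes_sing sign_swap_id sign_compose permutation_swap_id
        permutation_compose B' C' Transposition.transpose_def) (simp add: 4 algebra_simps)
qed

text \<open>Passing from \<open>i < j\<close> to all pairs turns the inner product of 2-forms into a
  double trace, to which \<open>trace_onb\<close> applies.\<close>

lemma sum_symmetric_upper: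
  fixes b :: "nat \<Rightarrow> nat \<Rightarrow> 'w::real_vector"
  assumes "\<And>i j. b i j = b j i" "\<And>i. b i i = 0"
  shows "2 *\<^sub>R (\<Sum>j\<in>{1..n}. \<Sum>i\<in>{1..<j}. b i j) = (\<Sum>j\<in>{1..n}. \<Sum>i\<in>{1..n}. b i j)"
proof (induction n)
  case (Suc n)
  have "{1..<Suc n} = {1..n}" by auto
  moreover have "(\<Sum>j\<in>{1..n}. b (Suc n) j) = (\<Sum>i\<in>{1..n}. b i (Suc n))"
    by (intro sum.cong refl assms(1))
  ultimately show ?case
    using Suc assms(2) by (simp add: sum.distrib scaleR_add_right scaleR_2 algebra_simps)
qed simp

text \<open>The complex structure is an abstract \<open>J\<close> fixed by its action on the frame,
  so that the two cases of the normalisation, where it is \<open>\<Phi>\<close> or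
  \<open>- \<Phi>\<close>, are covered by one computation.\<close>

locale adapted_frame = inner_form G for G :: "real^7 \<Rightarrow> real^7 \<Rightarrow> real" +
  fixes \<mu> :: "(nat \<Rightarrow> real^7) \<Rightarrow> real" and e :: "nat \<Rightarrow> real^7"
    and \<eta> :: "real^7 \<Rightarrow> real" and \<omega> :: "real^7 \<Rightarrow> real^7 \<Rightarrow> real" and J :: "real^7 \<Rightarrow> real^7"
  assumes onb: "pos_onb G \<mu> e" and orientation: "alt_form 7 \<mu>"
    and \<eta>_frame: "\<eta> u = G (e 7) u"
    and \<omega>_frame: "\<omega> u v = (\<Sum>j\<in>{1,2,3}. G (e j) u * G (e (j + 3)) v - G (e j) v * G (e (j + 3)) u)"
    and J_frame: "linear J" "J (e 1) = e 4" "J (e 2) = e 5" "J (e 3) = e 6"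
      "J (e 4) = - e 1" "J (e 5) = - e 2" "J (e 6) = - e 3" "J (e 7) = 0"
begin

lemma G_frame: "i \<in> {1..7} \<Longrightarrow> j \<in> {1..7} \<Longrightarrow> G (e i) (e j) = (if i = j then 1 else 0)"
  using onb unfolding pos_onb_def by simp

lemmas G_add = linear_add[OF linear_left] linear_add[OF linear_right]
lemmas G_scale = linear_scale[OF linear_left] linear_scale[OF linear_right]

lemma \<omega>_add: "\<omega> (u + u') v = \<omega> u v + \<omega> u' v" "\<omega> u (v + v') = \<omega> u v + \<omega> u v'"
  and \<omega>_scale: "\<omega> (r *\<^sub>R u) v = r * \<omega> u v" "\<omega> u (r *\<^sub>R v) = r * \<omega> u v"
  and \<omega>_skew: "\<omega> u v = - \<omega> v u"
  unfolding \<omega>_frame by (simp_all add: G_add G_scale algebra_simps)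

lemma bilinear_frame_zero:
  fixes Q :: "real^7 \<Rightarrow> real^7 \<Rightarrow> 'w::real_vector"
  assumes "\<And>v. linear (\<lambda>u. Q u v)" "\<And>u. linear (Q u)"
    and "\<And>a b. a \<in> {1..7} \<Longrightarrow> b \<in> {1..7} \<Longrightarrow> Q (e a) (e b) = 0"
  shows "Q u v = 0"
proof -
  have "Q u v = Q (\<Sum>a\<in>{1..7}. G u (e a) *\<^sub>R e a) (\<Sum>b\<in>{1..7}. G v (e b) *\<^sub>R e b)"
    using onb_expand[OF onb, of u] onb_expand[OF onb, of v] by simp
  also have "\<dots> = 0"
    using assms(3)
    by (simp add: linear_sum[OF assms(1)] linear_scale[OF assms(1)] linear_sum[OF assms(2)]
        linear_scale[OF assms(2)] del: One_nat_def)
  finally show ?thesis .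
qed

context
  fixes F :: "real^7 \<Rightarrow> real^7 \<Rightarrow> 'w::real_vector"
  assumes alt: "alt_form 2 (form2 F)"
begin

lemma F_linear: "linear (\<lambda>u. F u v)" "linear (F u)"
proof -
  have "linear (\<lambda>x. form2 F (((\<lambda>i. if i = 1 then u else v))(i := x)))" if "i \<in> {1..2}" for i u
    using alt that unfolding alt_form_def by blast
  from this[of 1] this[of 2 u] show "linear (\<lambda>u. F u v)" "linear (F u)"
    by (simp_all add: form2_def)
qed

lemma F_self: "F u u = 0"
proof -
  have "\<forall>v. \<forall>i\<in>{1..2}. \<forall>j\<in>{1..2}. i \<noteq> j \<and> v i = v j \<longrightarrow> form2 F v = 0"
    using alt unfolding alt_form_def by blast
  from this[rule_format, of 1 2 "\<lambda>_. u"] show ?thesis by (simp add: form2_def)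
qed

lemmas F_add = linear_add[OF F_linear(1)] linear_add[OF F_linear(2)]
lemmas F_scale = linear_scale[OF F_linear(1)] linear_scale[OF F_linear(2)]

lemma F_skew: "F u v = - F v u"
proof -
  have "F u v + F v u = 0" using F_self[of "u + v"] unfolding F_add by (simp add: F_self add.commute)
  then show ?thesis by (simp add: eq_neg_iff_add_eq_0)
qed

text \<open>The integrand before antisymmetrisation over the frame: slots 1 to 5 belong to the form
  under the star, slots 6 and 7 are the directions that the star leaves over.\<close>

definition star_integrand :: "real^7 \<Rightarrow> real^7 \<Rightarrow> (nat \<Rightarrow> real^7) \<Rightarrow> 'w" where
  "star_integrand u v x = (G (x 6) u * G (x 7) v * (\<eta> (x 1) * \<omega> (x 2) (x 3))) *\<^sub>R F (x 4) (x 5)"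

text \<open>As a function of the frame the alternating sum is a top-degree form, so by
  \<open>alt_form_pos_onb\<close> the frame picked by choice may be replaced by
  \<open>e\<close>.\<close>

lemma hodge_frame:
  "hodge G \<mu> 5 (wedge 3 2 (wedge 1 2 (form1 \<eta>) (form2 \<omega>)) (form2 F)) v =
     (1 / 4) *\<^sub>R alt_sum 7 (star_integrand (v 1) (v 2)) e"
proof -
  have ex: "pos_onb G \<mu> (SOME e. pos_onb G \<mu> e)" by (rule someI[where P="pos_onb G \<mu>", OF onb])
  have "alt_form CARD(7) (alt_sum 7 (star_integrand u w))" for u w
    unfolding card_num1 card_bit0 card_bit1
  proof (simp, rule alt_form_alt_sum)
    fix x y :: "nat \<Rightarrow> real^7" assume "\<And>i. i \<in> {1..7} \<Longrightarrow> x i = y i"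
    then show "star_integrand u w x = star_integrand u w y" by (simp add: star_integrand_def)
  next
    fix x :: "nat \<Rightarrow> real^7" and i :: nat assume "i \<in> {1..7}"
    then have "i = 1 \<or> i = 2 \<or> i = 3 \<or> i = 4 \<or> i = 5 \<or> i = 6 \<or> i = 7" by auto
    moreover have "linear (\<lambda>z. (f z) *\<^sub>R W)" if "linear f" for f :: "real^7 \<Rightarrow> real" and W :: 'w
      using linear_compose[OF that, of "\<lambda>r. r *\<^sub>R W"] by (simp add: comp_def linear_iff scaleR_add_left)
    moreover have "linear (\<lambda>z. a * f z)" "linear (\<lambda>z. f z * a)" if "linear f" for f :: "real^7 \<Rightarrow> real" and a
      using that by (auto simp: linear_iff algebra_simps)
    moreover have "linear (\<omega> p)" "linear (\<lambda>z. \<omega> z p)" for p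
      by (auto simp: linear_iff \<omega>_add \<omega>_scale)
    ultimately show "linear (\<lambda>z. star_integrand u w (x(i := z)))"
      unfolding star_integrand_def \<eta>_frame
      by (elim disjE) (simp_all add: linear_left linear_right linear_compose_scale_right F_linear)
  qed
  with orientation show ?thesis
    unfolding hodge_contact_wedge star_integrand_def[symmetric]
    by (subst alt_form_pos_onb[OF onb ex]) simp_all
qed

text \<open>A nonzero term needs \<open>\<pi> 1 = 7\<close>, \<open>\<pi> 6 = a\<close> and
  \<open>\<pi> 7 = b\<close>, and injectivity rules this out when two of the three targets
  coincide.\<close>

lemma star_frame_degenerate:
  assumes "a = 7 \<or> b = 7 \<or> a = b" "a \<in> {1..7}" "b \<in> {1..7}"
  shows "alt_sum 7 (star_integrand (e a) (e b)) e = 0"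
  unfolding alt_sum_def
proof (rule sum.neutral, rule ballI)
  fix \<pi> :: "nat \<Rightarrow> nat" assume "\<pi> \<in> {\<pi>. \<pi> permutes {1..7}}"
  then have \<pi>: "\<pi> permutes {1..7}" by simp
  have in7: "\<pi> i \<in> {1..7}" if "i \<in> {1..7}" for i
    using permutes_in_image[OF \<pi>] that by blast
  have "\<pi> 6 \<noteq> \<pi> 7" "\<pi> 1 \<noteq> \<pi> 6" "\<pi> 1 \<noteq> \<pi> 7"
    using inj_eq[OF permutes_inj[OF \<pi>]] by simp_all
  moreover have "G (e 7) (e (\<pi> 1)) = (if 7 = \<pi> 1 then 1 else 0)"
    "G (e (\<pi> 6)) (e a) = (if \<pi> 6 = a then 1 else 0)" "G (e (\<pi> 7)) (e b) = (if \<pi> 7 = b then 1 else 0)"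
    using assms by (intro G_frame in7; simp)+
  ultimately have "star_integrand (e a) (e b) (e \<circ> \<pi>) = 0"
    using assms(1) unfolding star_integrand_def \<eta>_frame by (elim disjE) simp_all
  then show "of_int (sign \<pi>) *\<^sub>R star_integrand (e a) (e b) (e \<circ> \<pi>) = 0" by simp
qed

text \<open>The three forced values leave only permutations of the middle slots 2 to 5 free. The
  factor 4 from these cancels the 1/4 of \<open>hodge_contact_wedge\<close>.\<close>

lemma star_frame_permutation:
  assumes \<rho>: "\<rho> permutes {1..7}" "\<rho> 1 = 7" "\<rho> 6 = a" "\<rho> 7 = b"
  defines "E i \<equiv> e (\<rho> i)"
  shows "alt_sum 7 (star_integrand (e a) (e b)) e = (4 * of_int (sign \<rho>)) *\<^sub>R
    (\<omega> (E 2) (E 3) *\<^sub>R F (E 4) (E 5) - \<omega> (E 2) (E 4) *\<^sub>R F (E 3) (E 5) + \<omega> (E 2) (E 5) *\<^sub>R F (E 3) (E 4)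
     + \<omega> (E 3) (E 4) *\<^sub>R F (E 2) (E 5) - \<omega> (E 3) (E 5) *\<^sub>R F (E 2) (E 4) + \<omega> (E 4) (E 5) *\<^sub>R F (E 2) (E 3))"
proof -
  have in7: "\<pi> i \<in> {1..7}" if "\<pi> permutes {1..7}" "i \<in> {1..7}" for \<pi> and i :: nat
    using permutes_in_image[OF that(1)] that by blast
  have "alt_sum 7 (star_integrand (e a) (e b)) e = of_int (sign \<rho>) *\<^sub>R (\<Sum>q | q permutes {2,3,4,5}.
      of_int (sign q) *\<^sub>R star_integrand (e a) (e b) (e \<circ> \<rho> \<circ> q))"
  proof (rule alt_sum_restrict[OF \<rho>(1)])
    fix \<pi> and i :: nat
    assume \<pi>: "\<pi> permutes {1..7}" "star_integrand (e a) (e b) (e \<circ> \<pi>) \<noteq> 0" and i: "i \<in> {1..7} - {2,3,4,5}"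
    have "\<pi> 1 = 7" "\<pi> 6 = a" "\<pi> 7 = b"
      using \<pi>(2) G_frame[of 7 "\<pi> 1"] G_frame[of "\<pi> 6" a] G_frame[of "\<pi> 7" b]
        in7[OF \<pi>(1)] in7[OF \<rho>(1), of 6] in7[OF \<rho>(1), of 7] \<rho>
      unfolding star_integrand_def \<eta>_frame by (auto split: if_splits)
    moreover have "i = 1 \<or> i = 6 \<or> i = 7" using i by auto
    ultimately show "\<pi> i = \<rho> i" using \<rho> by auto
  qed auto
  also have "(\<Sum>q | q permutes {2,3,4,5}. of_int (sign q) *\<^sub>R star_integrand (e a) (e b) (e \<circ> \<rho> \<circ> q)) =
      (\<Sum>q | q permutes {2,3,4,5}. of_int (sign q) *\<^sub>R (\<omega> (E (q 2)) (E (q 3)) *\<^sub>R F (E (q 4)) (E (q 5))))"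
  proof (intro sum.cong refl arg_cong[where f="scaleR _"], goal_cases)
    case (1 q)
    then have "q 1 = 1" "q 6 = 6" "q 7 = 7" by (auto simp: permutes_def)
    then show ?case
      using G_frame in7[OF \<rho>(1), of 6] in7[OF \<rho>(1), of 7] \<rho>
      by (simp add: star_integrand_def \<eta>_frame E_def)
  qed
  also have "\<dots> = 4 *\<^sub>R
    (\<omega> (E 2) (E 3) *\<^sub>R F (E 4) (E 5) - \<omega> (E 2) (E 4) *\<^sub>R F (E 3) (E 5) + \<omega> (E 2) (E 5) *\<^sub>R F (E 3) (E 4)
     + \<omega> (E 3) (E 4) *\<^sub>R F (E 2) (E 5) - \<omega> (E 3) (E 5) *\<^sub>R F (E 2) (E 4) + \<omega> (E 4) (E 5) *\<^sub>R F (E 2) (E 3))"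
    by (rule sum_permutations_2345) (rule \<omega>_skew, rule F_skew)
  finally show ?thesis by (simp add: mult.commute)
qed

lemma star_frame_swap:
  "alt_sum 7 (star_integrand u v) x = - alt_sum 7 (star_integrand v u) x"
proof -
  have swap: "star_integrand v u = (\<lambda>x. star_integrand u v (x \<circ> Transposition.transpose 6 7))"
    by (auto simp: star_integrand_def Transposition.transpose_def mult.commute)
  have "alt_sum 7 (star_integrand v u) x =
      of_int (sign (Transposition.transpose 6 (7::nat))) *\<^sub>R alt_sum 7 (star_integrand u v) x"
    unfolding swap by (rule alt_sum_precompose) (simp add: permutes_swap_id)
  then show ?thesis by (simp add: sign_swap_id)
qed

definition contraction :: 'w where
  "contraction = F (e 1) (e 4) + F (e 2) (e 5) + F (e 3) (e 6)"

text \<open>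
  Each case uses the permutation that sends 1, 6, 7 to \<open>7, a, b\<close> and is increasing on the remaining indices;
  the transpositions are read off its cycles.
\<close>

lemma star_frame_less:
  assumes "a \<in> {1..6}" "b \<in> {1..6}" "a < b"
  shows "(1 / 4) *\<^sub>R alt_sum 7 (star_integrand (e a) (e b)) e =
    F (J (e a)) (J (e b)) - \<omega> (e a) (e b) *\<^sub>R contraction"
proof -
  let ?t = "Transposition.transpose :: nat \<Rightarrow> _"
  \<comment> \<open>\<open>J\<close> exchanges the indices 1, 2, 3 with 4, 5, 6 and so produces
    \<open>F\<close> on pairs in decreasing order. Fixed instances of \<open>F_skew\<close> put them
    in order; as a general rewrite rule it would not.\<close>
  note simps = permutes_compose permutes_swap_id sign_compose sign_swap_id permutation_compose permutation_swap_id
    Transposition.transpose_def \<omega>_frame G_frame J_frame contraction_def F_add F_scale F_self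
    linear_neg[OF F_linear(1)] linear_neg[OF F_linear(2)] algebra_simps
    F_skew[of "e 4" "e 1"] F_skew[of "e 4" "e 2"] F_skew[of "e 4" "e 3"]
    F_skew[of "e 5" "e 1"] F_skew[of "e 5" "e 2"] F_skew[of "e 5" "e 3"]
    F_skew[of "e 6" "e 1"] F_skew[of "e 6" "e 2"] F_skew[of "e 6" "e 3"]
  consider "a = 1" "b = 2" | "a = 1" "b = 3" | "a = 1" "b = 4" | "a = 1" "b = 5" | "a = 1" "b = 6"
    | "a = 2" "b = 3" | "a = 2" "b = 4" | "a = 2" "b = 5" | "a = 2" "b = 6" | "a = 3" "b = 4"
    | "a = 3" "b = 5" | "a = 3" "b = 6" | "a = 4" "b = 5" | "a = 4" "b = 6" | "a = 5" "b = 6"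
  proof -
    have "a \<in> {1,2,3,4,5,6}" "b \<in> {1,2,3,4,5,6}" using assms by auto
    then show ?thesis using that assms(3) by (elim insertE emptyE; simp)
  qed
  then show ?thesis
  proof cases
    case 1
    show ?thesis
      unfolding 1 by (subst star_frame_permutation[of "?t 1 7 \<circ> ?t 7 2 \<circ> ?t 2 3 \<circ> ?t 3 4 \<circ> ?t 4 5 \<circ> ?t 5 6"])
        (simp_all add: simps del: One_nat_def)
  next
    case 2
    show ?thesis
      unfolding 2 by (subst star_frame_permutation[of "?t 1 7 \<circ> ?t 7 3 \<circ> ?t 3 4 \<circ> ?t 4 5 \<circ> ?t 5 6"])
        (simp_all add: simps del: One_nat_def)
  next
    case 3
    show ?thesis
      unfolding 3 by (subst star_frame_permutation[of "?t 1 7 \<circ> ?t 7 4 \<circ> ?t 4 5 \<circ> ?t 5 6"])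
        (simp_all add: simps del: One_nat_def)
  next
    case 4
    show ?thesis
      unfolding 4 by (subst star_frame_permutation[of "?t 1 7 \<circ> ?t 7 5 \<circ> ?t 5 6"])
        (simp_all add: simps del: One_nat_def)
  next
    case 5
    show ?thesis
      unfolding 5 by (subst star_frame_permutation[of "?t 1 7 \<circ> ?t 7 6"])
        (simp_all add: simps del: One_nat_def)
  next
    case 6
    show ?thesis
      unfolding 6 by (subst star_frame_permutation[of "?t 1 7 \<circ> ?t 7 3 \<circ> ?t 3 4 \<circ> ?t 4 5 \<circ> ?t 5 6 \<circ> ?t 6 2"])
        (simp_all add: simps del: One_nat_def)
  next
    case 7
    show ?thesis
      unfolding 7 by (subst star_frame_permutation[of "?t 1 7 \<circ> ?t 7 4 \<circ> ?t 4 5 \<circ> ?t 5 6 \<circ> ?t 6 2"])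
        (simp_all add: simps del: One_nat_def)
  next
    case 8
    show ?thesis
      unfolding 8 by (subst star_frame_permutation[of "?t 1 7 \<circ> ?t 7 5 \<circ> ?t 5 6 \<circ> ?t 6 2"])
        (simp_all add: simps del: One_nat_def)
  next
    case 9
    show ?thesis
      unfolding 9 by (subst star_frame_permutation[of "?t 1 7 \<circ> ?t 7 6 \<circ> ?t 6 2"])
        (simp_all add: simps del: One_nat_def)
  next
    case 10
    show ?thesis
      unfolding 10 by (subst star_frame_permutation[of "?t 1 7 \<circ> ?t 7 4 \<circ> ?t 4 5 \<circ> ?t 5 6 \<circ> ?t 6 3 \<circ> ?t 3 2"])
        (simp_all add: simps del: One_nat_def)
  next
    case 11
    show ?thesis
      unfolding 11 by (subst star_frame_permutation[of "?t 1 7 \<circ> ?t 7 5 \<circ> ?t 5 6 \<circ> ?t 6 3 \<circ> ?t 3 2"])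
        (simp_all add: simps del: One_nat_def)
  next
    case 12
    show ?thesis
      unfolding 12 by (subst star_frame_permutation[of "?t 1 7 \<circ> ?t 7 6 \<circ> ?t 6 3 \<circ> ?t 3 2"])
        (simp_all add: simps del: One_nat_def)
  next
    case 13
    show ?thesis
      unfolding 13 by (subst star_frame_permutation[of "?t 1 7 \<circ> ?t 7 5 \<circ> ?t 5 6 \<circ> ?t 6 4 \<circ> ?t 4 3 \<circ> ?t 3 2"])
        (simp_all add: simps del: One_nat_def)
  next
    case 14
    show ?thesis
      unfolding 14 by (subst star_frame_permutation[of "?t 1 7 \<circ> ?t 7 6 \<circ> ?t 6 4 \<circ> ?t 4 3 \<circ> ?t 3 2"])
        (simp_all add: simps del: One_nat_def)
  next
    case 15
    show ?thesis
      unfolding 15 by (subst star_frame_permutation[of "?t 1 7 \<circ> ?t 7 6 \<circ> ?t 6 5 \<circ> ?t 5 4 \<circ> ?t 4 3 \<circ> ?t 3 2"])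
        (simp_all add: simps del: One_nat_def)
  qed
qed

text \<open>Both sides are bilinear and skew in the two vectors, so it suffices to compare them on
  frame vectors with increasing indices. The formula displays the eigenvalues: 1 on primitive forms
  of type (1,1), -1 on types (2,0) and (0,2), and 1 - 3 = -2 on multiples of
  \<open>\<omega>\<close>, since \<open>(\<omega>, \<omega>) = 3\<close>.\<close>

lemma hodge_adapted_frame:
  "hodge G \<mu> 5 (wedge 3 2 (wedge 1 2 (form1 \<eta>) (form2 \<omega>)) (form2 F)) v =
     F (J (v 1)) (J (v 2)) - \<omega> (v 1) (v 2) *\<^sub>R contraction"
proof -
  define Q where "Q u v = (1 / 4) *\<^sub>R alt_sum 7 (star_integrand u v) e -
    (F (J u) (J v) - \<omega> u v *\<^sub>R contraction)" for u v
  have Q_skew: "Q v u = - Q u v" for u v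
    unfolding Q_def star_frame_swap[of v u] F_skew[of "J v"] \<omega>_skew[of v u] by simp
  have add: "star_integrand (u + u') v x = star_integrand u v x + star_integrand u' v x"
    and scale: "star_integrand (r *\<^sub>R u) v x = r *\<^sub>R star_integrand u v x" for u u' v x r
    unfolding star_integrand_def
    by (simp_all add: G_add G_scale ring_distribs scaleR_add_left mult_ac)
  have lin: "linear (\<lambda>u. Q u v)" for v
  proof (rule linearI)
    show "Q (u + u') v = Q u v + Q u' v" for u u'
      unfolding Q_def alt_sum_def add linear_add[OF J_frame(1)]
      by (simp add: F_add \<omega>_add scaleR_add_left scaleR_add_right sum.distrib)
    show "Q (r *\<^sub>R u) v = r *\<^sub>R Q u v" for r u
      unfolding Q_def alt_sum_def scale linear_scale[OF J_frame(1)]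
      by (simp add: F_scale \<omega>_scale scaleR_sum_right scaleR_diff_right mult_ac)
  qed
  moreover have "linear (Q u)" for u
  proof -
    have "Q u = (\<lambda>v. - Q v u)" by (rule ext) (rule Q_skew)
    then show ?thesis by (rule ssubst) (rule linear_compose_neg[OF lin])
  qed
  moreover have "Q (e a) (e b) = 0" if ab: "a \<in> {1..7}" "b \<in> {1..7}" for a b
  proof -
    consider "a = 7 \<or> b = 7 \<or> a = b" | "a \<in> {1..6}" "b \<in> {1..6}" "a < b" | "a \<in> {1..6}" "b \<in> {1..6}" "b < a"
      using ab by fastforce
    then show ?thesis
    proof cases
      case 1
      have "F (J (e a)) (J (e b)) = 0"
        using 1 J_frame(8) linear_0[OF F_linear(1)] linear_0[OF F_linear(2)] F_self by auto
      moreover have "\<omega> (e a) (e b) = 0"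
        using 1 ab by (auto simp: \<omega>_frame G_frame simp del: One_nat_def)
      ultimately show ?thesis
        unfolding Q_def star_frame_degenerate[OF 1 ab] by simp
    next
      case 2
      then show ?thesis unfolding Q_def by (simp add: star_frame_less)
    next
      case 3
      then have "Q (e b) (e a) = 0" unfolding Q_def by (simp add: star_frame_less)
      then show ?thesis using Q_skew[of "e a" "e b"] by simp
    qed
  qed
  ultimately have "Q (v 1) (v 2) = 0" by (rule bilinear_frame_zero)
  then show ?thesis unfolding hodge_frame Q_def by simp
qed

lemma inner_2form_adapted_frame: "inner_2form G F \<omega> = contraction"
proof -
  let ?f = "SOME e. pos_onb G (\<lambda>_. 1) e"
  \<comment> \<open>With the constant 1 as orientation every orthonormal basis counts as positive,
    so the chosen basis may have either orientation relative to \<open>e\<close>. Hence a trace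
    argument is used instead of \<open>alt_form_pos_onb\<close>.\<close>
  have "pos_onb G (\<lambda>_. 1) e" using onb unfolding pos_onb_def by simp
  then have f: "pos_onb G (\<lambda>_. 1) ?f" by (rule someI[where P="pos_onb G (\<lambda>_. 1)"])
  define b where "b x y = \<omega> x y *\<^sub>R F x y" for x y
  have b: "b x y = b y x" "b x x = 0" for x y
    unfolding b_def using \<omega>_skew[of x y] F_skew[of x y] by (simp_all add: F_self)
  have "linear (\<lambda>u. \<omega> u y *\<^sub>R F v w)" "linear (\<lambda>u. \<omega> y u *\<^sub>R F v w)" for v w y
    by (auto intro!: linearI simp: \<omega>_add \<omega>_scale scaleR_add_left)
  moreover have "linear (\<lambda>u. r *\<^sub>R F u w)" "linear (\<lambda>u. r *\<^sub>R F w u)" for r w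
    by (intro linear_compose_scale_right F_linear)+
  \<comment> \<open>\<open>b\<close> is quadratic in each argument; it is the diagonal of the
    bilinear map that feeds \<open>\<omega>\<close> and \<open>F\<close> separately. The frame is
    changed in one argument at a time.\<close>
  ultimately have trace: "(\<Sum>i\<in>{1..7}. b (?f i) y) = (\<Sum>i\<in>{1..7}. b (e i) y)"
    "(\<Sum>i\<in>{1..7}. b x (?f i)) = (\<Sum>i\<in>{1..7}. b x (e i))" for x y
    unfolding b_def
    using trace_onb[OF onb f, of "\<lambda>u v. \<omega> u y *\<^sub>R F v y"] trace_onb[OF onb f, of "\<lambda>u v. \<omega> x u *\<^sub>R F x v"]
    by simp_all
  have "2 *\<^sub>R inner_2form G F \<omega> = (\<Sum>j\<in>{1..7}. \<Sum>i\<in>{1..7}. b (?f i) (?f j))"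
    using sum_symmetric_upper[of "\<lambda>i j. b (?f i) (?f j)" 7] b
    unfolding inner_2form_def Let_def b_def by simp
  also have "\<dots> = (\<Sum>j\<in>{1..7}. \<Sum>i\<in>{1..7}. b (e i) (?f j))"
    by (simp only: trace(1))
  also have "\<dots> = (\<Sum>i\<in>{1..7}. \<Sum>j\<in>{1..7}. b (e i) (?f j))"
    by (rule sum.swap)
  also have "\<dots> = (\<Sum>i\<in>{1..7}. \<Sum>j\<in>{1..7}. b (e i) (e j))"
    by (simp only: trace(2))
  also have "\<dots> = (\<Sum>j\<in>{1..7}. \<Sum>i\<in>{1..7}. b (e i) (e j))"
    by (rule sum.swap)
  also have "\<dots> = 2 *\<^sub>R (\<Sum>j\<in>{1..7}. \<Sum>i\<in>{1..<j}. b (e i) (e j))"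
    using sum_symmetric_upper[of "\<lambda>i j. b (e i) (e j)" 7] b by simp
  also have "(\<Sum>j\<in>{1..7}. \<Sum>i\<in>{1..<j}. b (e i) (e j)) = contraction"
  proof -
    have "{1..7} = {1,2,3,4,5,6,7::nat}" "{1..<1} = ({} :: nat set)" "{1..<2} = {1::nat}" "{1..<3} = {1,2::nat}"
      "{1..<4} = {1,2,3::nat}" "{1..<5} = {1,2,3,4::nat}" "{1..<6} = {1,2,3,4,5::nat}" "{1..<7} = {1,2,3,4,5,6::nat}"
      by auto
    then show ?thesis
      by (simp add: b_def \<omega>_frame G_frame contraction_def del: One_nat_def)
  qed
  finally show ?thesis by simp
qed

end
end

section \<open>Calculus of smooth maps\<close>

lemma Ck_on_cong:
  assumes "open S" "\<And>x. x \<in> S \<Longrightarrow> f x = g x" "Ck_on k S f"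
  shows "Ck_on k S g"
  using assms(2,3)
proof (induction k arbitrary: f g)
  case 0
  then show ?case using continuous_on_cong[of S S f g] by simp
next
  case (Suc k)
  have diff: "g differentiable (at x)" if "x \<in> S" for x
  proof -
    have "(f has_derivative frechet_derivative f (at x)) (at x)"
      using Suc.prems(2) that by (simp add: frechet_derivative_works)
    then have "(g has_derivative frechet_derivative f (at x)) (at x)"
      by (rule has_derivative_transform_within_open[OF _ assms(1) that]) (rule Suc.prems(1))
    then show ?thesis by (rule differentiableI)
  qed
  have eq: "frechet_derivative f (at x) = frechet_derivative g (at x)" if "x \<in> S" for x
    by (rule frechet_derivative_transform_within_open[OF _ assms(1) that]) (use Suc.prems that in auto)
  have "Ck_on k S (\<lambda>x. frechet_derivative g (at x) b)" if "b \<in> Basis" for b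
    by (rule Suc.IH[of "\<lambda>x. frechet_derivative f (at x) b"]) (use eq Suc.prems(2) that in auto)
  with diff show ?case by simp
qed

lemma Ck_on_subset: "Ck_on k S f \<Longrightarrow> T \<subseteq> S \<Longrightarrow> Ck_on k T f"
  by (induction k arbitrary: f) (auto intro: continuous_on_subset)

lemma Ck_on_locally:
  assumes "\<And>x. x \<in> S \<Longrightarrow> \<exists>U. open U \<and> x \<in> U \<and> Ck_on k U f"
  shows "Ck_on k S f"
  using assms
proof (induction k arbitrary: f)
  case 0
  then have "isCont f x" if "x \<in> S" for x
    using that by (metis Ck_on.simps(1) continuous_on_eq_continuous_at)
  then show ?case by (simp add: continuous_at_imp_continuous_on)
next
  case (Suc k)
  have "Ck_on k S (\<lambda>x. frechet_derivative f (at x) b)" if "b \<in> Basis" for b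
    by (rule Suc.IH) (use Suc.prems that in force)
  then show ?case using Suc.prems by force
qed

lemma Ck_on_Suc_imp: "Ck_on (Suc k) S f \<Longrightarrow> Ck_on k S f"
proof (induction k arbitrary: f)
  case 0
  then show ?case
    by (auto intro!: continuous_at_imp_continuous_on differentiable_imp_continuous_within)
next
  case (Suc k)
  then show ?case by (subst Ck_on.simps) (auto simp del: Ck_on.simps(1) intro: Suc.IH)
qed

text \<open>\<open>Ck_on\<close> refers to \<open>frechet_derivative\<close>; this rule accepts any
  explicit formula for the derivative, so that the product and chain rules can be supplied
  directly.\<close>

lemma Ck_on_SucI:
  assumes "open S" "\<And>x. x \<in> S \<Longrightarrow> (f has_derivative f' x) (at x)"
    and "\<And>b. b \<in> Basis \<Longrightarrow> Ck_on k S (\<lambda>x. f' x b)"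
  shows "Ck_on (Suc k) S f"
proof -
  have "f' x = frechet_derivative f (at x)" if "x \<in> S" for x
    using assms(2)[OF that] by (rule frechet_derivative_at)
  then have "Ck_on k S (\<lambda>x. frechet_derivative f (at x) b)" if "b \<in> Basis" for b
    using Ck_on_cong[OF assms(1) _ assms(3)[OF that]] by auto
  then show ?thesis using assms(2) by (auto intro: differentiableI)
qed

lemma Ck_on_SucD:
  assumes "Ck_on (Suc k) S f"
  shows "x \<in> S \<Longrightarrow> (f has_derivative frechet_derivative f (at x)) (at x)"
    and "b \<in> Basis \<Longrightarrow> Ck_on k S (\<lambda>x. frechet_derivative f (at x) b)"
  using assms by (auto simp: frechet_derivative_works)

lemma Ck_on_const: "Ck_on k S (\<lambda>x. c)"
  by (induction k arbitrary: c) auto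

lemma Ck_on_bounded_linear:
  assumes "open S" "bounded_linear L" "Ck_on k S f"
  shows "Ck_on k S (\<lambda>x. L (f x))"
  using assms(3)
proof (induction k arbitrary: f)
  case 0
  then show ?case using bounded_linear.continuous_on[OF assms(2)] by simp
next
  case (Suc k)
  show ?case
    by (rule Ck_on_SucI[OF assms(1), where f'="\<lambda>x b. L (frechet_derivative f (at x) b)"])
       (auto intro!: bounded_linear.has_derivative[OF assms(2)] Ck_on_SucD[OF Suc.prems] Suc.IH)
qed

lemma Ck_on_add:
  assumes "open S" "Ck_on k S f" "Ck_on k S g"
  shows "Ck_on k S (\<lambda>x. f x + g x)"
  using assms(2,3)
proof (induction k arbitrary: f g)
  case 0
  then show ?case by (auto intro: continuous_on_add)
next
  case (Suc k)
  show ?case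
    by (rule Ck_on_SucI[OF assms(1),
          where f'="\<lambda>x b. frechet_derivative f (at x) b + frechet_derivative g (at x) b"])
       (auto intro!: has_derivative_add Ck_on_SucD[OF Suc.prems(1)] Ck_on_SucD[OF Suc.prems(2)] Suc.IH)
qed

text \<open>In the product rule one factor stays undifferentiated and has one order more than the
  induction hypothesis asks for; \<open>Ck_on_Suc_imp\<close> lowers it.\<close>

lemma Ck_on_bounded_bilinear:
  assumes "open S" "bounded_bilinear B" "Ck_on k S f" "Ck_on k S g"
  shows "Ck_on k S (\<lambda>x. B (f x) (g x))"
  using assms(3,4)
proof (induction k arbitrary: f g)
  case 0
  then show ?case using bounded_bilinear.continuous_on[OF assms(2)] by simp
next
  case (Suc k)
  show ?case
    by (rule Ck_on_SucI[OF assms(1), where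
          f'="\<lambda>x b. B (f x) (frechet_derivative g (at x) b) + B (frechet_derivative f (at x) b) (g x)"])
       (auto intro!: bounded_bilinear.FDERIV[OF assms(2)] Ck_on_SucD[OF Suc.prems(1)]
          Ck_on_SucD[OF Suc.prems(2)] Suc.IH Ck_on_add[OF assms(1)] Ck_on_Suc_imp[OF Suc.prems(1)]
          Ck_on_Suc_imp[OF Suc.prems(2)])
qed

lemma Ck_on_sum:
  assumes "open S" "\<And>i. i \<in> I \<Longrightarrow> Ck_on k S (f i)"
  shows "Ck_on k S (\<lambda>x. \<Sum>i\<in>I. f i x)"
  using assms(2)
  by (induction I rule: infinite_finite_induct) (auto intro: Ck_on_add[OF assms(1)] Ck_on_const)

lemma linear_eq_sum_Basis:
  fixes L :: "'a::euclidean_space \<Rightarrow> 'b::real_vector"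
  assumes "linear L"
  shows "L v = (\<Sum>c\<in>Basis. (v \<bullet> c) *\<^sub>R L c)"
proof -
  have "L v = L (\<Sum>c\<in>Basis. (v \<bullet> c) *\<^sub>R c)" by (simp add: euclidean_representation)
  then show ?thesis by (simp only: linear_sum[OF assms] linear_scale[OF assms])
qed

lemma Ck_on_compose:
  fixes f :: "'b::euclidean_space \<Rightarrow> 'c::real_normed_vector"
  assumes "open S" "open T" "g ` S \<subseteq> T" "Ck_on k T f" "Ck_on k S g"
  shows "Ck_on k S (f \<circ> g)"
  using assms(4,5)
proof (induction k arbitrary: f)
  case 0
  then show ?case using assms(3) continuous_on_compose[of S g f] continuous_on_subset[of T f "g ` S"] by simp
next
  case (Suc k)
  have der: "(f has_derivative frechet_derivative f (at (g x))) (at (g x))" if "x \<in> S" for x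
    by (rule Ck_on_SucD(1)[OF Suc.prems(1)]) (use that assms(3) in auto)
  show ?case
  \<comment> \<open>The chain rule applies the derivative of \<open>f\<close> to a vector that
    varies with \<open>x\<close>, whereas \<open>Ck_on\<close> controls it only on fixed basis
    vectors. Hence the expansion in the basis.\<close>
  proof (rule Ck_on_SucI[OF assms(1), where
        f'="\<lambda>x b. \<Sum>c\<in>Basis. (frechet_derivative g (at x) b \<bullet> c) *\<^sub>R frechet_derivative f (at (g x)) c"])
    fix x assume x: "x \<in> S"
    have "(f \<circ> g has_derivative frechet_derivative f (at (g x)) \<circ> frechet_derivative g (at x)) (at x)"
      using Ck_on_SucD(1)[OF Suc.prems(2) x] der[OF x] by (rule diff_chain_at)
    also have "frechet_derivative f (at (g x)) \<circ> frechet_derivative g (at x) =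
        (\<lambda>b. \<Sum>c\<in>Basis. (frechet_derivative g (at x) b \<bullet> c) *\<^sub>R frechet_derivative f (at (g x)) c)"
      unfolding comp_def by (rule ext, rule linear_eq_sum_Basis[OF has_derivative_linear[OF der[OF x]]])
    finally show "(f \<circ> g has_derivative \<dots>) (at x)" .
  next
    fix b :: 'a assume b: "b \<in> Basis"
    have "Ck_on k S ((\<lambda>y. frechet_derivative f (at y) c) \<circ> g)" if "c \<in> Basis" for c
      using Ck_on_SucD(2)[OF Suc.prems(1) that] Ck_on_Suc_imp[OF Suc.prems(2)] by (rule Suc.IH)
    then show "Ck_on k S (\<lambda>x. \<Sum>c\<in>Basis. (frechet_derivative g (at x) b \<bullet> c) *\<^sub>R frechet_derivative f (at (g x)) c)"
      using Ck_on_SucD(2)[OF Suc.prems(2) b]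
      by (intro Ck_on_sum Ck_on_bounded_bilinear[OF _ bounded_bilinear_scaleR]
          Ck_on_bounded_linear[OF _ bounded_linear_inner_left] assms(1)) (simp_all add: comp_def)
  qed
qed

lemma smooth_on_cong: "open S \<Longrightarrow> (\<And>x. x \<in> S \<Longrightarrow> f x = g x) \<Longrightarrow> smooth_on S f \<Longrightarrow> smooth_on S g"
  unfolding smooth_on_def using Ck_on_cong by blast

lemma smooth_on_subset: "smooth_on S f \<Longrightarrow> T \<subseteq> S \<Longrightarrow> smooth_on T f"
  unfolding smooth_on_def using Ck_on_subset by blast

lemma smooth_on_locally:
  "(\<And>x. x \<in> S \<Longrightarrow> \<exists>U. open U \<and> x \<in> U \<and> smooth_on U f) \<Longrightarrow> smooth_on S f"
  unfolding smooth_on_def by (intro allI Ck_on_locally) metis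

lemma smooth_on_const: "smooth_on S (\<lambda>x. c)"
  unfolding smooth_on_def by (simp add: Ck_on_const)

lemma smooth_on_bounded_linear: "open S \<Longrightarrow> bounded_linear L \<Longrightarrow> smooth_on S f \<Longrightarrow> smooth_on S (\<lambda>x. L (f x))"
  unfolding smooth_on_def by (simp add: Ck_on_bounded_linear)

lemma smooth_on_add: "open S \<Longrightarrow> smooth_on S f \<Longrightarrow> smooth_on S g \<Longrightarrow> smooth_on S (\<lambda>x. f x + g x)"
  unfolding smooth_on_def by (simp add: Ck_on_add)

lemma smooth_on_bounded_bilinear:
  "open S \<Longrightarrow> bounded_bilinear B \<Longrightarrow> smooth_on S f \<Longrightarrow> smooth_on S g \<Longrightarrow> smooth_on S (\<lambda>x. B (f x) (g x))"
  unfolding smooth_on_def by (simp add: Ck_on_bounded_bilinear)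

lemma smooth_on_sum:
  "open S \<Longrightarrow> (\<And>i. i \<in> I \<Longrightarrow> smooth_on S (f i)) \<Longrightarrow> smooth_on S (\<lambda>x. \<Sum>i\<in>I. f i x)"
  unfolding smooth_on_def by (simp add: Ck_on_sum)

lemma smooth_on_compose:
  fixes f :: "'b::euclidean_space \<Rightarrow> 'c::real_normed_vector"
  shows "open S \<Longrightarrow> open T \<Longrightarrow> g ` S \<subseteq> T \<Longrightarrow> smooth_on T f \<Longrightarrow> smooth_on S g \<Longrightarrow> smooth_on S (f \<circ> g)"
  unfolding smooth_on_def by (simp add: Ck_on_compose)

lemma smooth_on_id: "open S \<Longrightarrow> smooth_on S (\<lambda>x::'a::euclidean_space. x)"
  unfolding smooth_on_def
proof
  fix k assume "open S"
  then show "Ck_on k S (\<lambda>x::'a. x)"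
    by (cases k) (auto intro!: Ck_on_SucI[where f'="\<lambda>_ b. b"] Ck_on_const)
qed

lemma smooth_on_has_derivative:
  assumes "smooth_on S f" "x \<in> S"
  shows "(f has_derivative frechet_derivative f (at x)) (at x)"
proof -
  have "Ck_on (Suc 0) S f" using assms(1) unfolding smooth_on_def by blast
  then show ?thesis using assms(2) by (rule Ck_on_SucD)
qed

lemma smooth_on_differentiable: "smooth_on S f \<Longrightarrow> x \<in> S \<Longrightarrow> f differentiable (at x)"
  using smooth_on_has_derivative differentiableI by blast

lemma smooth_on_continuous_on: "smooth_on S f \<Longrightarrow> continuous_on S f"
  unfolding smooth_on_def by (metis Ck_on.simps(1))

lemma smooth_on_frechet_derivative:
  assumes "open S" "smooth_on S f" "smooth_on S v"
  shows "smooth_on S (\<lambda>x. frechet_derivative f (at x) (v x))"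
proof -
  have "smooth_on S (\<lambda>x. frechet_derivative f (at x) c)" if "c \<in> Basis" for c
    unfolding smooth_on_def
  proof
    fix k
    have "Ck_on (Suc k) S f" using assms(2) unfolding smooth_on_def by blast
    then show "Ck_on k S (\<lambda>x. frechet_derivative f (at x) c)" using that by (rule Ck_on_SucD)
  qed
  then have "smooth_on S (\<lambda>x. \<Sum>c\<in>Basis. (v x \<bullet> c) *\<^sub>R frechet_derivative f (at x) c)"
    by (intro smooth_on_sum smooth_on_bounded_bilinear[OF _ bounded_bilinear_scaleR]
          smooth_on_bounded_linear[OF _ bounded_linear_inner_left] assms)
  then show ?thesis
    by (rule smooth_on_cong[OF assms(1), rotated])
       (simp flip: linear_eq_sum_Basis[OF has_derivative_linear[OF smooth_on_has_derivative[OF assms(2)]]])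
qed

section \<open>Symmetry of second derivatives\<close>

lemma exists_mixed_difference:
  fixes f :: "'a::euclidean_space \<Rightarrow> real"
  assumes S: "open S" and f: "smooth_on S f" and t: "t > 0"
    and sub: "\<And>r s. 0 \<le> r \<Longrightarrow> r \<le> t \<Longrightarrow> 0 \<le> s \<Longrightarrow> s \<le> t \<Longrightarrow> x + r *\<^sub>R u + s *\<^sub>R v \<in> S"
  shows "\<exists>r s. 0 < r \<and> r < t \<and> 0 < s \<and> s < t \<and>
    f (x + t *\<^sub>R u + t *\<^sub>R v) - f (x + t *\<^sub>R u) - f (x + t *\<^sub>R v) + f x =
      t * t * frechet_derivative (\<lambda>y. frechet_derivative f (at y) u) (at (x + r *\<^sub>R u + s *\<^sub>R v)) v"
proof -
  let ?Du = "\<lambda>y. frechet_derivative f (at y) u"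
  have Du: "smooth_on S ?Du" by (rule smooth_on_frechet_derivative[OF S f smooth_on_const])
  have chain: "((\<lambda>r. h (c + r *\<^sub>R w)) has_real_derivative frechet_derivative h (at (c + r *\<^sub>R w)) w) (at r)"
    if "smooth_on S h" "c + r *\<^sub>R w \<in> S" for h :: "'a \<Rightarrow> real" and c w r
  proof -
    have h: "(h has_derivative frechet_derivative h (at (c + r *\<^sub>R w))) (at (c + r *\<^sub>R w))"
      using that by (rule smooth_on_has_derivative)
    have "((\<lambda>r. c + r *\<^sub>R w) has_derivative (\<lambda>r. r *\<^sub>R w)) (at r)"
      by (auto intro!: derivative_eq_intros)
    from diff_chain_at[OF this h] show ?thesis
      unfolding has_field_derivative_def comp_def linear_scale[OF has_derivative_linear[OF h]]
      by (simp add: mult.commute[of _ "frechet_derivative h (at (c + r *\<^sub>R w)) w"])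
  qed
  \<comment> \<open>The mixed second difference is the increment of \<open>?g\<close>, itself a
    difference in direction \<open>v\<close>. The mean value theorem along \<open>u\<close> and then
    along \<open>v\<close> yields the intermediate point.\<close>
  let ?g = "\<lambda>r. f ((x + t *\<^sub>R v) + r *\<^sub>R u) - f (x + r *\<^sub>R u)"
  have "\<exists>r>0. r < t \<and> ?g t - ?g 0 = (t - 0) * (?Du ((x + t *\<^sub>R v) + r *\<^sub>R u) - ?Du (x + r *\<^sub>R u))"
  proof (rule MVT2[OF t])
    fix r assume "0 \<le> r" "r \<le> t"
    then show "(?g has_real_derivative ?Du ((x + t *\<^sub>R v) + r *\<^sub>R u) - ?Du (x + r *\<^sub>R u)) (at r)"
      using sub[of r t] sub[of r 0] t by (intro DERIV_diff chain f) (simp_all add: add_ac)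
  qed
  then obtain r where r: "0 < r" "r < t"
    "?g t - ?g 0 = t * (?Du ((x + t *\<^sub>R v) + r *\<^sub>R u) - ?Du (x + r *\<^sub>R u))" by auto
  have "\<exists>s>0. s < t \<and> ?Du (x + r *\<^sub>R u + t *\<^sub>R v) - ?Du (x + r *\<^sub>R u + 0 *\<^sub>R v) =
      (t - 0) * frechet_derivative ?Du (at (x + r *\<^sub>R u + s *\<^sub>R v)) v"
    by (rule MVT2[OF t]) (use sub r in \<open>auto intro!: chain Du\<close>)
  then obtain s where s: "0 < s" "s < t" "?Du (x + r *\<^sub>R u + t *\<^sub>R v) - ?Du (x + r *\<^sub>R u) =
      t * frechet_derivative ?Du (at (x + r *\<^sub>R u + s *\<^sub>R v)) v" by auto
  have "f (x + t *\<^sub>R u + t *\<^sub>R v) - f (x + t *\<^sub>R u) - f (x + t *\<^sub>R v) + f x = ?g t - ?g 0"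
    by (simp add: add_ac)
  also have "\<dots> = t * (?Du (x + r *\<^sub>R u + t *\<^sub>R v) - ?Du (x + r *\<^sub>R u))"
    unfolding r(3) by (simp add: add_ac)
  finally show ?thesis using r s by (auto simp: mult.assoc)
qed

text \<open>The mixed second difference is symmetric in \<open>u\<close> and \<open>v\<close>. Hence
  the two mixed derivatives take a common value at some points arbitrarily near \<open>x\<close>,
  and continuity carries the equality to \<open>x\<close>.\<close>

lemma frechet_derivative_commute_real:
  fixes f :: "'a::euclidean_space \<Rightarrow> real"
  assumes S: "open S" and f: "smooth_on S f" and x: "x \<in> S"
  shows "frechet_derivative (\<lambda>y. frechet_derivative f (at y) u) (at x) v =
    frechet_derivative (\<lambda>y. frechet_derivative f (at y) v) (at x) u"
proof -
  define D where "D u v y = frechet_derivative (\<lambda>y. frechet_derivative f (at y) u) (at y) v" for u v y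
  have cont: "isCont (D u v) x" for u v
  proof -
    have "smooth_on S (D u v)"
      unfolding D_def by (intro smooth_on_frechet_derivative S f smooth_on_const)
    then show ?thesis using S x smooth_on_continuous_on continuous_on_eq_continuous_at by blast
  qed
  have "dist (D u v x) (D v u x) \<le> e" if "e > 0" for e
  proof -
    obtain d1 where d1: "d1 > 0" "\<And>y. dist y x < d1 \<Longrightarrow> dist (D u v y) (D u v x) < e / 2"
      using cont[of u v] \<open>e > 0\<close> unfolding continuous_at_eps_delta by (metis half_gt_zero)
    obtain d2 where d2: "d2 > 0" "\<And>y. dist y x < d2 \<Longrightarrow> dist (D v u y) (D v u x) < e / 2"
      using cont[of v u] \<open>e > 0\<close> unfolding continuous_at_eps_delta by (metis half_gt_zero)
    obtain d3 where d3: "d3 > 0" "ball x d3 \<subseteq> S"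
      using S x open_contains_ball by blast
    define d where "d = min d1 (min d2 d3)"
    \<comment> \<open>Every point of the parallelogram with sides \<open>t *\<^sub>R u\<close> and
      \<open>t *\<^sub>R v\<close> is then closer to \<open>x\<close> than \<open>d\<close>; the
      summand 1 keeps the denominator positive and the estimate strict.\<close>
    define t where "t = d / (norm u + norm v + 1)"
    have d: "d > 0" using d1 d2 d3 by (simp add: d_def)
    have pos: "norm u + norm v + 1 > 0" by (smt (verit) norm_ge_zero)
    have t: "t > 0" using d pos by (simp add: t_def)
    have near: "dist (x + r *\<^sub>R u + s *\<^sub>R v) x < d" if "0 \<le> r" "r \<le> t" "0 \<le> s" "s \<le> t" for r s
    proof -
      have "dist (x + r *\<^sub>R u + s *\<^sub>R v) x = norm (r *\<^sub>R u + s *\<^sub>R v)"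
        by (simp add: dist_norm add.assoc)
      also have "\<dots> \<le> r * norm u + s * norm v"
        using norm_triangle_ineq[of "r *\<^sub>R u" "s *\<^sub>R v"] that by simp
      also have "\<dots> \<le> t * norm u + t * norm v"
        using that by (intro add_mono mult_right_mono) auto
      also have "\<dots> < t * (norm u + norm v + 1)"
        using t by (simp add: algebra_simps)
      also have "\<dots> = d" using pos by (simp add: t_def)
      finally show ?thesis .
    qed
    have sub: "x + r *\<^sub>R u + s *\<^sub>R v \<in> S" if "0 \<le> r" "r \<le> t" "0 \<le> s" "s \<le> t" for r s
      using near[OF that] d3 by (auto simp: d_def dist_commute subset_iff)
    obtain r s where 1: "0 < r" "r < t" "0 < s" "s < t"
      "f (x + t *\<^sub>R u + t *\<^sub>R v) - f (x + t *\<^sub>R u) - f (x + t *\<^sub>R v) + f x = t * t * D u v (x + r *\<^sub>R u + s *\<^sub>R v)"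
      using exists_mixed_difference[OF S f t sub] unfolding D_def by blast
    have sub': "x + r *\<^sub>R v + s *\<^sub>R u \<in> S" if "0 \<le> r" "r \<le> t" "0 \<le> s" "s \<le> t" for r s
      using sub[OF that(3,4,1,2)] by (simp add: add_ac)
    obtain r' s' where 2: "0 < r'" "r' < t" "0 < s'" "s' < t"
      "f (x + t *\<^sub>R v + t *\<^sub>R u) - f (x + t *\<^sub>R v) - f (x + t *\<^sub>R u) + f x = t * t * D v u (x + r' *\<^sub>R v + s' *\<^sub>R u)"
      using exists_mixed_difference[OF S f t sub'] unfolding D_def by blast
    have swap: "x + t *\<^sub>R v + t *\<^sub>R u = x + t *\<^sub>R u + t *\<^sub>R v"
      by (simp add: add_ac)
    have eq: "t * t * D u v (x + r *\<^sub>R u + s *\<^sub>R v) = t * t * D v u (x + r' *\<^sub>R v + s' *\<^sub>R u)"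
      using 1(5) 2(5) unfolding swap by linarith
    have "D u v (x + r *\<^sub>R u + s *\<^sub>R v) = D v u (x + r' *\<^sub>R v + s' *\<^sub>R u)"
      by (rule mult_left_cancel[THEN iffD1, OF _ eq]) (use t in simp)
    moreover have "dist (D u v (x + r *\<^sub>R u + s *\<^sub>R v)) (D u v x) < e / 2"
      using near[of r s] 1 by (intro d1) (simp add: d_def)
    \<comment> \<open>Here \<open>s'\<close> is the coefficient of \<open>u\<close> and
      \<open>r'\<close> that of \<open>v\<close>, so \<open>near\<close> is used with the two
      exchanged.\<close>
    moreover have "dist (D v u (x + r' *\<^sub>R v + s' *\<^sub>R u)) (D v u x) < e / 2"
      using near[of s' r'] 2 by (intro d2) (simp add: d_def add_ac)
    ultimately show ?thesis by (simp add: dist_real_def) argo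
  qed
  then have "dist (D u v x) (D v u x) \<le> 0" by (meson field_le_epsilon add_nonneg_nonneg dense_ge)
  then show ?thesis unfolding D_def by simp
qed

lemma frechet_derivative_commute:
  fixes f :: "'a::euclidean_space \<Rightarrow> 'b::euclidean_space"
  assumes S: "open S" and f: "smooth_on S f" and x: "x \<in> S"
  shows "frechet_derivative (\<lambda>y. frechet_derivative f (at y) u) (at x) v =
    frechet_derivative (\<lambda>y. frechet_derivative f (at y) v) (at x) u"
proof (rule euclidean_eqI)
  fix c :: 'b assume "c \<in> Basis"
  have inner: "frechet_derivative (\<lambda>y. h y \<bullet> c) (at y) w = frechet_derivative h (at y) w \<bullet> c"
    if "smooth_on S h" "y \<in> S" for h :: "'a \<Rightarrow> 'b" and y w
    using frechet_derivative_at[OF bounded_linear.has_derivative[OF bounded_linear_inner_left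
        smooth_on_has_derivative[OF that]], of c] by metis
  have fc: "smooth_on S (\<lambda>y. f y \<bullet> c)"
    by (rule smooth_on_bounded_linear[OF S bounded_linear_inner_left f])
  have second: "frechet_derivative (\<lambda>y. frechet_derivative (\<lambda>y. f y \<bullet> c) (at y) u) (at x) v =
      frechet_derivative (\<lambda>y. frechet_derivative f (at y) u) (at x) v \<bullet> c" for u v
  proof -
    have Du: "smooth_on S (\<lambda>y. frechet_derivative f (at y) u)"
      by (rule smooth_on_frechet_derivative[OF S f smooth_on_const])
    have "frechet_derivative (\<lambda>y. frechet_derivative (\<lambda>y. f y \<bullet> c) (at y) u) (at x) =
        frechet_derivative (\<lambda>y. frechet_derivative f (at y) u \<bullet> c) (at x)"
      by (rule frechet_derivative_transform_within_open[OF _ S x inner[OF f]])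
         (rule smooth_on_differentiable[OF smooth_on_frechet_derivative[OF S fc smooth_on_const] x])
    then show ?thesis using inner[OF Du x] by simp
  qed
  show "frechet_derivative (\<lambda>y. frechet_derivative f (at y) u) (at x) v \<bullet> c =
      frechet_derivative (\<lambda>y. frechet_derivative f (at y) v) (at x) u \<bullet> c"
    using frechet_derivative_commute_real[OF S fc x, of u v] unfolding second .
qed

text \<open>The product rule for a direction that moves with the point. Expanding in the basis
  separates the variation of the derivative from that of the direction; a constant \<open>w\<close>
  identifies the first term.\<close>

lemma frechet_derivative_directional:
  fixes f :: "'a::euclidean_space \<Rightarrow> 'b::real_normed_vector"
  assumes S: "open S" and f: "smooth_on S f" and v: "smooth_on S v" and x: "x \<in> S"
  shows "frechet_derivative (\<lambda>y. frechet_derivative f (at y) (v y)) (at x) u =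
    frechet_derivative (\<lambda>y. frechet_derivative f (at y) (v x)) (at x) u
    + frechet_derivative f (at x) (frechet_derivative v (at x) u)"
proof -
  let ?D = "\<lambda>c y. frechet_derivative f (at y) c"
  have lin: "linear (frechet_derivative f (at y))" if "y \<in> S" for y
    by (rule has_derivative_linear[OF smooth_on_has_derivative[OF f that]])
  have sum: "frechet_derivative (\<lambda>y. ?D (w y) y) (at x) u = (\<Sum>c\<in>Basis. (w x \<bullet> c) *\<^sub>R frechet_derivative (?D c) (at x) u
      + (frechet_derivative w (at x) u \<bullet> c) *\<^sub>R ?D c x)" if w: "smooth_on S w" for w
  proof -
    have "((\<lambda>y. \<Sum>c\<in>Basis. (w y \<bullet> c) *\<^sub>R ?D c y) has_derivative
        (\<lambda>u. \<Sum>c\<in>Basis. (w x \<bullet> c) *\<^sub>R frechet_derivative (?D c) (at x) u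
          + (frechet_derivative w (at x) u \<bullet> c) *\<^sub>R ?D c x)) (at x)"
      by (intro has_derivative_sum has_derivative_scaleR has_derivative_inner_left
          smooth_on_has_derivative[OF _ x] w smooth_on_frechet_derivative[OF S f smooth_on_const])
    then have "((\<lambda>y. ?D (w y) y) has_derivative
        (\<lambda>u. \<Sum>c\<in>Basis. (w x \<bullet> c) *\<^sub>R frechet_derivative (?D c) (at x) u
          + (frechet_derivative w (at x) u \<bullet> c) *\<^sub>R ?D c x)) (at x)"
      by (rule has_derivative_transform_within_open[OF _ S x]) (rule linear_eq_sum_Basis[OF lin, symmetric])
    from frechet_derivative_at[OF this] show ?thesis by (rule fun_cong[OF sym])
  qed
  have "(\<Sum>c\<in>Basis. (frechet_derivative v (at x) u \<bullet> c) *\<^sub>R ?D c x) = ?D (frechet_derivative v (at x) u) x"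
    by (rule linear_eq_sum_Basis[OF lin[OF x], symmetric])
  then show ?thesis
    unfolding sum[OF v] sum[OF smooth_on_const[of S "v x"]] by (simp add: sum.distrib)
qed

text \<open>The flat function exp(-1/t), extended by 0. The powers of 1/t make the family closed
  under differentiation up to linear combinations, so that smoothness follows by one induction over
  all \<open>n\<close>.\<close>

definition exp_inverse :: "nat \<Rightarrow> real \<Rightarrow> real" where
  "exp_inverse n t = (if t > 0 then inverse t ^ n * exp (- inverse t) else 0)"

lemma exp_inverse_tendsto_0: "(exp_inverse n \<longlongrightarrow> 0) (at 0)"
proof -
  have "((\<lambda>t. inverse t ^ n / exp (inverse t)) \<longlongrightarrow> (0::real)) (at_right 0)"
    using filterlim_compose[OF tendsto_power_div_exp_0 filterlim_inverse_at_top_right] .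
  then have "(exp_inverse n \<longlongrightarrow> 0) (at_right 0)"
    by (rule Lim_transform_eventually)
       (auto simp: exp_inverse_def exp_minus field_simps eventually_at_filter)
  moreover have "(exp_inverse n \<longlongrightarrow> 0) (at_left 0)"
    by (rule tendsto_eventually) (auto simp: exp_inverse_def eventually_at_filter)
  ultimately show ?thesis by (simp add: filterlim_split_at)
qed

lemma exp_inverse_DERIV:
  "(exp_inverse n has_real_derivative exp_inverse (n + 2) t - real n * exp_inverse (n + 1) t) (at t)"
proof -
  consider "t > 0" | "t < 0" | "t = 0" by linarith
  then show ?thesis
  proof cases
    case 1
    have "((\<lambda>t. inverse t ^ n * exp (- inverse t)) has_real_derivative
        exp_inverse (n + 2) t - real n * exp_inverse (n + 1) t) (at t)"
      using 1 by (cases n) (auto intro!: derivative_eq_intros simp: exp_inverse_def field_simps power2_eq_square power_Suc2 simp del: power_Suc split: nat_diff_split)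
    then show ?thesis
      by (rule has_field_derivative_transform_within_open[of _ _ _ "{0<..}"]) (use 1 in \<open>auto simp: exp_inverse_def\<close>)
  next
    case 2
    have "((\<lambda>t. 0) has_real_derivative exp_inverse (n + 2) t - real n * exp_inverse (n + 1) t) (at t)"
      using 2 by (simp add: exp_inverse_def)
    then show ?thesis
      by (rule has_field_derivative_transform_within_open[of _ _ _ "{..<0}"]) (use 2 in \<open>auto simp: exp_inverse_def\<close>)
  next
    case 3
    \<comment> \<open>At 0 the difference quotient of \<open>exp_inverse n\<close> is
      \<open>exp_inverse (n + 1)\<close>.\<close>
    have "((\<lambda>y. (exp_inverse n y - exp_inverse n 0) / (y - 0)) \<longlongrightarrow> 0) (at 0)"
      by (rule Lim_transform_eventually[OF exp_inverse_tendsto_0[of "n + 1"]])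
         (auto simp: exp_inverse_def divide_inverse eventually_at_filter)
    then show ?thesis using 3 by (simp add: has_field_derivative_iff exp_inverse_def)
  qed
qed

lemma smooth_on_exp_inverse: "smooth_on UNIV (exp_inverse n)"
  unfolding smooth_on_def
proof
  fix k
  show "Ck_on k UNIV (exp_inverse n)"
  proof (induction k arbitrary: n)
    case 0
    show ?case
      using exp_inverse_DERIV by (auto intro!: continuous_at_imp_continuous_on DERIV_isCont)
  next
    case (Suc k)
    show ?case
    proof (rule Ck_on_SucI[where f'="\<lambda>t b. (exp_inverse (n + 2) t - real n * exp_inverse (n + 1) t) * b"])
      fix b :: real
      have "Ck_on k UNIV (\<lambda>t. b * exp_inverse (n + 2) t + (- (b * real n)) * exp_inverse (n + 1) t)"
        by (intro Ck_on_add Ck_on_bounded_linear[OF _ bounded_linear_mult_right] Suc.IH) auto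
      then show "Ck_on k UNIV (\<lambda>t. (exp_inverse (n + 2) t - real n * exp_inverse (n + 1) t) * b)"
        by (simp add: algebra_simps)
    qed (use exp_inverse_DERIV in \<open>auto simp: has_field_derivative_def\<close>)
  qed
qed

lemma exists_smooth_bump:
  fixes x0 :: "'a::euclidean_space"
  assumes "r > 0"
  obtains b :: "'a \<Rightarrow> real" where "smooth_on UNIV b" "b x0 = 1" "\<And>x. x \<notin> cball x0 r \<Longrightarrow> b x = 0"
proof -
  \<comment> \<open>\<open>q\<close> is smooth, positive exactly inside the ball of radius
    \<open>r\<close>, and equal to the square of \<open>r\<close> at the centre, which explains the
    normalising denominator of \<open>b\<close>.\<close>
  define q where "q x = r\<^sup>2 - (x - x0) \<bullet> (x - x0)" for x :: 'a
  define b where "b x = exp_inverse 0 (q x) / exp_inverse 0 (r\<^sup>2)" for x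
  have "smooth_on UNIV (\<lambda>x. x - x0)"
    using smooth_on_add[OF _ smooth_on_id smooth_on_const, of UNIV "- x0"] by simp
  then have "smooth_on UNIV (\<lambda>x. r\<^sup>2 + - ((x - x0) \<bullet> (x - x0)))"
    by (intro smooth_on_add smooth_on_const smooth_on_bounded_linear[OF _ bounded_linear_minus[OF bounded_linear_ident]]
          smooth_on_bounded_bilinear[OF _ bounded_bilinear_inner]) auto
  then have "smooth_on UNIV (exp_inverse 0 \<circ> q)"
    by (intro smooth_on_compose[OF _ _ _ smooth_on_exp_inverse]) (auto simp: q_def[abs_def])
  then have "smooth_on UNIV b"
    unfolding b_def[abs_def] comp_def
    by (intro smooth_on_bounded_linear[OF _ bounded_linear_divide]) auto
  moreover have "b x0 = 1" using assms by (simp add: b_def q_def exp_inverse_def)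
  moreover have "b x = 0" if "x \<notin> cball x0 r" for x
  proof -
    have "r < norm (x - x0)" using that by (simp add: dist_norm norm_minus_commute)
    then have "r\<^sup>2 < (norm (x - x0))\<^sup>2" using assms by (intro power_strict_mono) auto
    then show ?thesis by (simp add: b_def q_def exp_inverse_def power2_norm_eq_inner)
  qed
  ultimately show ?thesis by (rule that)
qed

section \<open>Smooth functions and vector fields on a manifold\<close>

locale manifold =
  fixes K :: "('m::{t2_space,second_countable_topology}, 'n::finite) atlas"
  assumes smooth_manifold: "smooth_manifold K"
begin

abbreviation "\<U> \<equiv> chart_dom K"
abbreviation "\<phi> \<equiv> coord K"
abbreviation "\<psi> \<equiv> coord_inv K"

lemma dom_self [simp]: "p \<in> \<U> p" and open_dom: "open (\<U> p)" and open_range: "open (\<phi> p ` \<U> p)"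
  and chart_homeomorphism: "homeomorphism (\<U> p) (\<phi> p ` \<U> p) (\<phi> p) (\<psi> p)"
  and transition_smooth: "smooth_on (\<phi> p ` (\<U> p \<inter> \<U> q)) (\<phi> q \<circ> \<psi> p)"
  using smooth_manifold unfolding smooth_manifold_def by blast+

lemma coord_inv_coord [simp]: "q \<in> \<U> p \<Longrightarrow> \<psi> p (\<phi> p q) = q"
  and coord_coord_inv [simp]: "x \<in> \<phi> p ` \<U> p \<Longrightarrow> \<phi> p (\<psi> p x) = x"
  using chart_homeomorphism[of p] by (auto simp: homeomorphism_def)

lemma open_coord_image:
  assumes "open N" shows "open (\<phi> p ` (\<U> p \<inter> N))"
proof -
  have "openin (top_of_set (\<U> p)) (\<U> p \<inter> N)" using assms by (rule openin_open_Int)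
  then have "openin (top_of_set (\<phi> p ` \<U> p)) (\<phi> p ` (\<U> p \<inter> N))"
    by (rule homeomorphism_imp_open_map[OF chart_homeomorphism])
  then show ?thesis using openin_open_trans[OF _ open_range] by blast
qed

lemma smooth_fun_on_smooth_on: "smooth_fun_on K W f \<Longrightarrow> smooth_on (\<phi> q ` (\<U> q \<inter> W)) (f \<circ> \<psi> q)"
  unfolding smooth_fun_on_def by blast

text \<open>One chart suffices, because the other local expressions differ by smooth transition
  maps.\<close>

lemma smooth_fun_on_chartI:
  assumes N: "open N" "N \<subseteq> \<U> a" and f: "smooth_on (\<phi> a ` N) (f \<circ> \<psi> a)"
  shows "smooth_fun_on K N f"
  unfolding smooth_fun_on_def
proof
  fix q
  have Na: "\<U> a \<inter> N = N" using N by blast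
  have "smooth_on (\<phi> q ` (\<U> q \<inter> N)) ((f \<circ> \<psi> a) \<circ> (\<phi> a \<circ> \<psi> q))"
  proof (rule smooth_on_compose[OF _ _ _ f])
    show "open (\<phi> q ` (\<U> q \<inter> N))" by (rule open_coord_image[OF N(1)])
    show "open (\<phi> a ` N)" using open_coord_image[OF N(1), of a] unfolding Na .
    show "(\<phi> a \<circ> \<psi> q) ` \<phi> q ` (\<U> q \<inter> N) \<subseteq> \<phi> a ` N" by auto
    show "smooth_on (\<phi> q ` (\<U> q \<inter> N)) (\<phi> a \<circ> \<psi> q)"
      by (rule smooth_on_subset[OF transition_smooth]) (use N in auto)
  qed
  then show "smooth_on (\<phi> q ` (\<U> q \<inter> N)) (f \<circ> \<psi> q)"
    by (rule smooth_on_cong[OF open_coord_image[OF N(1)], rotated]) (use N in auto)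
qed

lemma smooth_fun_on_locally:
  assumes "\<And>q. q \<in> W \<Longrightarrow> \<exists>N. open N \<and> q \<in> N \<and> smooth_fun_on K N f"
  shows "smooth_fun_on K W f"
  unfolding smooth_fun_on_def
proof
  fix q
  show "smooth_on (\<phi> q ` (\<U> q \<inter> W)) (f \<circ> \<psi> q)"
  proof (rule smooth_on_locally)
    fix x assume "x \<in> \<phi> q ` (\<U> q \<inter> W)"
    then obtain r where r: "r \<in> \<U> q" "r \<in> W" "x = \<phi> q r" by auto
    obtain N where "open N" "r \<in> N" "smooth_fun_on K N f" using assms[OF r(2)] by blast
    then show "\<exists>U. open U \<and> x \<in> U \<and> smooth_on U (f \<circ> \<psi> q)"
      using r open_coord_image smooth_fun_on_smooth_on by (intro exI[of _ "\<phi> q ` (\<U> q \<inter> N)"]) auto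
  qed
qed

lemma smooth_fun_on_subset: "smooth_fun_on K W f \<Longrightarrow> V \<subseteq> W \<Longrightarrow> smooth_fun_on K V f"
  unfolding smooth_fun_on_def by (meson Int_mono image_mono order_refl smooth_on_subset)

lemma smooth_fun_on_cong:
  assumes "open W" "\<And>q. q \<in> W \<Longrightarrow> f q = g q" "smooth_fun_on K W f"
  shows "smooth_fun_on K W g"
  unfolding smooth_fun_on_def
proof
  fix q show "smooth_on (\<phi> q ` (\<U> q \<inter> W)) (g \<circ> \<psi> q)"
    by (rule smooth_on_cong[OF open_coord_image[OF assms(1)] _ smooth_fun_on_smooth_on[OF assms(3)]])
       (use assms(2) in auto)
qed

lemma smooth_fun_on_const: "smooth_fun_on K W (\<lambda>q. c)"
  unfolding smooth_fun_on_def comp_def by (simp add: smooth_on_const)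

lemma smooth_fun_on_bounded_linear:
  assumes "open W" "bounded_linear L" "smooth_fun_on K W f"
  shows "smooth_fun_on K W (\<lambda>q. L (f q))"
  using smooth_on_bounded_linear[OF open_coord_image[OF assms(1)] assms(2) smooth_fun_on_smooth_on[OF assms(3)]]
  unfolding smooth_fun_on_def comp_def by blast

lemma smooth_fun_on_add:
  assumes "open W" "smooth_fun_on K W f" "smooth_fun_on K W g"
  shows "smooth_fun_on K W (\<lambda>q. f q + g q)"
  using smooth_on_add[OF open_coord_image[OF assms(1)] smooth_fun_on_smooth_on[OF assms(2)]
      smooth_fun_on_smooth_on[OF assms(3)]]
  unfolding smooth_fun_on_def comp_def by blast

lemma smooth_fun_on_bounded_bilinear:
  assumes "open W" "bounded_bilinear B" "smooth_fun_on K W f" "smooth_fun_on K W g"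
  shows "smooth_fun_on K W (\<lambda>q. B (f q) (g q))"
  using smooth_on_bounded_bilinear[OF open_coord_image[OF assms(1)] assms(2) smooth_fun_on_smooth_on[OF assms(3)]
      smooth_fun_on_smooth_on[OF assms(4)]]
  unfolding smooth_fun_on_def comp_def by blast

lemma transition_has_derivative:
  assumes "q \<in> \<U> a" "q \<in> \<U> b"
  shows "((\<phi> b \<circ> \<psi> a) has_derivative dtrans K a b q) (at (\<phi> a q))"
  unfolding dtrans_def using assms by (intro smooth_on_has_derivative[OF transition_smooth]) auto

lemma dtrans_linear: "q \<in> \<U> a \<Longrightarrow> q \<in> \<U> b \<Longrightarrow> linear (dtrans K a b q)"
  using transition_has_derivative has_derivative_linear by blast

lemma dtrans_self:
  assumes "q \<in> \<U> a" shows "dtrans K a a q u = u"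
proof -
  have "((\<lambda>x. x) has_derivative dtrans K a a q) (at (\<phi> a q))"
    by (rule has_derivative_transform_within_open[OF transition_has_derivative[OF assms assms] open_range])
       (use assms in auto)
  then have "dtrans K a a q = (\<lambda>x. x)" using has_derivative_unique has_derivative_ident by blast
  then show ?thesis by simp
qed

lemma dtrans_dtrans:
  assumes "q \<in> \<U> a" "q \<in> \<U> b" "q \<in> \<U> c"
  shows "dtrans K b c q (dtrans K a b q u) = dtrans K a c q u"
proof -
  have "((\<phi> b \<circ> \<psi> a) has_derivative dtrans K a b q) (at (\<phi> a q))"
    by (rule transition_has_derivative[OF assms(1,2)])
  moreover have "((\<phi> c \<circ> \<psi> b) has_derivative dtrans K b c q) (at ((\<phi> b \<circ> \<psi> a) (\<phi> a q)))"
    using transition_has_derivative[OF assms(2,3)] assms by simp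
  ultimately have "((\<phi> c \<circ> \<psi> b) \<circ> (\<phi> b \<circ> \<psi> a) has_derivative dtrans K b c q \<circ> dtrans K a b q) (at (\<phi> a q))"
    by (rule diff_chain_at)
  then have "((\<phi> c \<circ> \<psi> a) has_derivative dtrans K b c q \<circ> dtrans K a b q) (at (\<phi> a q))"
    by (rule has_derivative_transform_within_open[OF _ open_coord_image[OF open_dom[of b], of a]])
       (use assms in auto)
  then have "dtrans K b c q \<circ> dtrans K a b q = dtrans K a c q"
    using transition_has_derivative[OF assms(1,3)] has_derivative_unique by blast
  from fun_cong[OF this, of u] show ?thesis by simp
qed

lemma smooth_fun_on_dtrans:
  assumes W: "open W" "W \<subseteq> \<U> a" "W \<subseteq> \<U> b" and v: "smooth_fun_on K W v"
  shows "smooth_fun_on K W (\<lambda>q. dtrans K a b q (v q))"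
proof (rule smooth_fun_on_chartI[OF W(1,2)])
  have Wa: "\<U> a \<inter> W = W" using W by blast
  have op: "open (\<phi> a ` W)" using open_coord_image[OF W(1), of a] unfolding Wa .
  have "smooth_on (\<phi> a ` W) (\<lambda>x. frechet_derivative (\<phi> b \<circ> \<psi> a) (at x) ((v \<circ> \<psi> a) x))"
    by (intro smooth_on_frechet_derivative[OF op] smooth_on_subset[OF transition_smooth]
          smooth_on_subset[OF smooth_fun_on_smooth_on[OF v]]) (use W in auto)
  then show "smooth_on (\<phi> a ` W) ((\<lambda>q. dtrans K a b q (v q)) \<circ> \<psi> a)"
    by (rule smooth_on_cong[OF op, rotated]) (use W in \<open>auto simp: dtrans_def subset_iff\<close>)
qed

lemma smooth_vf_smooth_fun_on: "smooth_vf K X \<Longrightarrow> smooth_fun_on K (\<U> a) (\<lambda>q. dtrans K q a q (X q))"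
  unfolding smooth_vf_def by blast

lemma smooth_vf_locallyI:
  assumes "\<And>q. \<exists>N a. open N \<and> q \<in> N \<and> N \<subseteq> \<U> a \<and> smooth_fun_on K N (\<lambda>r. dtrans K r a r (X r))"
  shows "smooth_vf K X"
  unfolding smooth_vf_def
proof (rule allI, rule smooth_fun_on_locally)
  fix b q assume q: "q \<in> \<U> b"
  obtain N a where N: "open N" "q \<in> N" "N \<subseteq> \<U> a" "smooth_fun_on K N (\<lambda>r. dtrans K r a r (X r))"
    using assms by blast
  have op: "open (N \<inter> \<U> b)" using N open_dom by blast
  have "smooth_fun_on K (N \<inter> \<U> b) (\<lambda>r. dtrans K a b r (dtrans K r a r (X r)))"
    by (rule smooth_fun_on_dtrans[OF op]) (use N smooth_fun_on_subset[OF N(4)] in auto)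
  then have "smooth_fun_on K (N \<inter> \<U> b) (\<lambda>r. dtrans K r b r (X r))"
    by (rule smooth_fun_on_cong[OF op, rotated]) (use N in \<open>auto intro!: dtrans_dtrans\<close>)
  then show "\<exists>N. open N \<and> q \<in> N \<and> smooth_fun_on K N (\<lambda>q. dtrans K q b q (X q))"
    using op N q by blast
qed

lemma smooth_vf_add:
  assumes "smooth_vf K X" "smooth_vf K Y" shows "smooth_vf K (\<lambda>q. X q + Y q)"
  unfolding smooth_vf_def
proof
  fix a
  show "smooth_fun_on K (\<U> a) (\<lambda>q. dtrans K q a q (X q + Y q))"
    by (rule smooth_fun_on_cong[OF open_dom _ smooth_fun_on_add[OF open_dom
          smooth_vf_smooth_fun_on[OF assms(1), of a] smooth_vf_smooth_fun_on[OF assms(2), of a]]])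
       (simp add: linear_add[OF dtrans_linear])
qed

lemma smooth_vf_scaleR:
  assumes "smooth_fun K f" "smooth_vf K X" shows "smooth_vf K (\<lambda>q. f q *\<^sub>R X q)"
  unfolding smooth_vf_def
proof
  fix a
  show "smooth_fun_on K (\<U> a) (\<lambda>q. dtrans K q a q (f q *\<^sub>R X q))"
    by (rule smooth_fun_on_cong[OF open_dom _ smooth_fun_on_bounded_bilinear[OF open_dom bounded_bilinear_scaleR
          smooth_fun_on_subset[OF assms(1) subset_UNIV] smooth_vf_smooth_fun_on[OF assms(2), of a]]])
       (simp add: linear_scale[OF dtrans_linear])
qed

lemma smooth_vf_0: "smooth_vf K (\<lambda>q. 0)"
  unfolding smooth_vf_def
proof
  fix a
  show "smooth_fun_on K (\<U> a) (\<lambda>q. dtrans K q a q 0)"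
    by (rule smooth_fun_on_cong[OF open_dom _ smooth_fun_on_const[of _ 0]]) (simp add: linear_0[OF dtrans_linear])
qed

section \<open>Bump functions and extension of vectors to global fields\<close>

lemma exists_bump:
  assumes "open W" "p \<in> W"
  obtains b :: "'m \<Rightarrow> real" and C where "smooth_fun K b" "b p = 1" "closed C" "C \<subseteq> W" "\<And>q. q \<notin> C \<Longrightarrow> b q = 0"
proof -
  have "\<phi> p p \<in> \<phi> p ` (\<U> p \<inter> W)" using assms by auto
  then obtain r where r: "r > 0" "cball (\<phi> p p) r \<subseteq> \<phi> p ` (\<U> p \<inter> W)"
    using open_coord_image[OF assms(1), of p] open_contains_cball by blast
  obtain \<beta> :: "real^'n \<Rightarrow> real" where \<beta>: "smooth_on UNIV \<beta>" "\<beta> (\<phi> p p) = 1"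
    "\<And>x. x \<notin> cball (\<phi> p p) r \<Longrightarrow> \<beta> x = 0"
    using exists_smooth_bump[OF r(1)] by blast
  \<comment> \<open>Being compact in a Hausdorff space, \<open>C\<close> is closed in the whole
    manifold and not only in the chart. Hence the chart domain and the complement of
    \<open>C\<close> are open and cover it, and \<open>b\<close> is smooth on each.\<close>
  define C where "C = \<psi> p ` cball (\<phi> p p) r"
  define b where "b q = (if q \<in> \<U> p then \<beta> (\<phi> p q) else 0)" for q
  have "continuous_on (cball (\<phi> p p) r) (\<psi> p)"
  proof (rule continuous_on_subset)
    show "continuous_on (\<phi> p ` \<U> p) (\<psi> p)"
      using chart_homeomorphism[of p] unfolding homeomorphism_def by blast
  qed (use r(2) in blast)
  then have "closed C" unfolding C_def by (intro compact_imp_closed compact_continuous_image compact_cball)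
  moreover have "C \<subseteq> W" "C \<subseteq> \<U> p" using r(2) by (auto simp: C_def)
  moreover have zero: "b q = 0" if "q \<notin> C" for q
  proof (cases "q \<in> \<U> p")
    case True
    then have "\<phi> p q \<notin> cball (\<phi> p p) r" using that unfolding C_def by (metis coord_inv_coord image_eqI)
    then show ?thesis by (simp add: b_def \<beta>(3))
  qed (simp add: b_def)
  moreover have "smooth_fun K b"
  proof (rule smooth_fun_on_locally)
    fix q :: 'm
    show "\<exists>N. open N \<and> q \<in> N \<and> smooth_fun_on K N b"
    proof (cases "q \<in> C")
      case True
      have "smooth_fun_on K (\<U> p) b"
        by (rule smooth_fun_on_chartI[OF open_dom order_refl],
            rule smooth_on_cong[OF open_range _ smooth_on_subset[OF \<beta>(1) subset_UNIV]]) (auto simp: b_def)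
      then show ?thesis using True \<open>C \<subseteq> \<U> p\<close> open_dom by blast
    next
      case False
      have op: "open (- C)" using \<open>closed C\<close> by blast
      have "smooth_fun_on K (- C) b"
        by (rule smooth_fun_on_cong[OF op _ smooth_fun_on_const[of _ 0]]) (simp add: zero)
      then show ?thesis using False op by blast
    qed
  qed
  ultimately show ?thesis using that[of b C] \<beta>(2) by (simp add: b_def)
qed

text \<open>The field with constant components in the chart at \<open>p\<close>, cut off by a bump
  function. It lets a pointwise identity be tested on global fields with a prescribed value.\<close>

lemma exists_smooth_vf: obtains X where "smooth_vf K X" "X p = u"
proof -
  obtain b :: "'m \<Rightarrow> real" and C where b: "smooth_fun K b" "b p = 1" "closed C" "C \<subseteq> \<U> p" "\<And>q. q \<notin> C \<Longrightarrow> b q = 0"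
    using exists_bump[OF open_dom dom_self] by blast
  define X where "X q = b q *\<^sub>R dtrans K p q q u" for q
  have "smooth_vf K X"
  proof (rule smooth_vf_locallyI)
    fix q
    show "\<exists>N a. open N \<and> q \<in> N \<and> N \<subseteq> \<U> a \<and> smooth_fun_on K N (\<lambda>r. dtrans K r a r (X r))"
    proof (cases "q \<in> C")
      case True
      have "smooth_fun_on K (\<U> p) (\<lambda>r. b r *\<^sub>R u)"
        by (intro smooth_fun_on_bounded_bilinear[OF open_dom bounded_bilinear_scaleR] smooth_fun_on_const
              smooth_fun_on_subset[OF b(1) subset_UNIV])
      then have "smooth_fun_on K (\<U> p) (\<lambda>r. dtrans K r p r (X r))"
        by (rule smooth_fun_on_cong[OF open_dom, rotated])
           (simp add: X_def linear_scale[OF dtrans_linear] dtrans_dtrans dtrans_self)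
      then show ?thesis using True b(4) open_dom by blast
    next
      case False
      have op: "open (- C \<inter> \<U> q)" using b(3) open_dom by blast
      have "smooth_fun_on K (- C \<inter> \<U> q) (\<lambda>r. dtrans K r q r (X r))"
        by (rule smooth_fun_on_cong[OF op _ smooth_fun_on_const[of _ 0]])
           (simp add: X_def b(5) linear_0[OF dtrans_linear])
      then show ?thesis using False op by (intro exI[of _ "- C \<inter> \<U> q"] exI[of _ q]) auto
    qed
  qed
  moreover have "X p = u" by (simp add: X_def b(2) dtrans_self)
  ultimately show ?thesis by (rule that)
qed

section \<open>Differentials of functions and the Lie bracket\<close>

lemma dfun_has_derivative:
  assumes "smooth_fun K f"
  shows "((f \<circ> \<psi> p) has_derivative dfun K f p) (at (\<phi> p p))"
  unfolding dfun_def
  by (rule smooth_on_has_derivative[OF smooth_fun_on_smooth_on[OF assms]]) auto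

lemma dfun_linear: "smooth_fun K f \<Longrightarrow> linear (dfun K f p)"
  using dfun_has_derivative has_derivative_linear by blast

lemma dfun_add:
  assumes "smooth_fun K f" "smooth_fun K g"
  shows "dfun K (\<lambda>q. f q + g q) p u = dfun K f p u + dfun K g p u"
  using frechet_derivative_at[OF has_derivative_add[OF dfun_has_derivative[OF assms(1), of p]
        dfun_has_derivative[OF assms(2), of p]]]
  unfolding dfun_def[of K "\<lambda>q. f q + g q"] comp_def by metis

text \<open>\<open>dfun\<close> at \<open>q\<close> is computed in the chart selected at
  \<open>q\<close>, so it changes charts as \<open>q\<close> moves. To differentiate it again,
  everything is expressed in the fixed chart at \<open>p\<close>.\<close>

lemma dfun_chart:
  assumes "smooth_fun K f" "q \<in> \<U> p"
  shows "dfun K f q u = frechet_derivative (f \<circ> \<psi> p) (at (\<phi> p q)) (dtrans K q p q u)"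
proof -
  have eq: "(\<phi> p \<circ> \<psi> q) (\<phi> q q) = \<phi> p q" by simp
  have "((f \<circ> \<psi> p) has_derivative frechet_derivative (f \<circ> \<psi> p) (at (\<phi> p q))) (at (\<phi> p q))"
    using assms(2) by (intro smooth_on_has_derivative[OF smooth_fun_on_smooth_on[OF assms(1)]]) auto
  from diff_chain_at[OF transition_has_derivative[OF dom_self assms(2)] this[folded eq], unfolded eq]
  have "((f \<circ> \<psi> q) has_derivative frechet_derivative (f \<circ> \<psi> p) (at (\<phi> p q)) \<circ> dtrans K q p q) (at (\<phi> q q))"
    by (rule has_derivative_transform_within_open[OF _ open_coord_image[OF open_dom[of p], of q]])
       (use assms(2) in auto)
  then have "frechet_derivative (f \<circ> \<psi> p) (at (\<phi> p q)) \<circ> dtrans K q p q = dfun K f q"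
    unfolding dfun_def by (rule frechet_derivative_at)
  from fun_cong[OF this, of u] show ?thesis by simp
qed

text \<open>The first term is the Hessian in the chart, symmetric in \<open>X p\<close> and
  \<open>u\<close>; the second differentiates the components of \<open>X\<close>. In the commutator
  of two fields the Hessians cancel and the second terms form the bracket.\<close>

lemma dfun_dfun:
  assumes f: "smooth_fun K f" and X: "smooth_vf K X"
  shows "dfun K (\<lambda>q. dfun K f q (X q)) p u =
    frechet_derivative (\<lambda>x. frechet_derivative (f \<circ> \<psi> p) (at x) (X p)) (at (\<phi> p p)) u
    + dfun K f p (dfun K (\<lambda>q. dtrans K q p q (X q)) p u)"
proof -
  let ?U = "\<phi> p ` \<U> p" and ?f = "f \<circ> \<psi> p" and ?X = "(\<lambda>q. dtrans K q p q (X q)) \<circ> \<psi> p"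
  have f': "smooth_on ?U ?f" using smooth_fun_on_smooth_on[OF f, of p] by simp
  have X': "smooth_on ?U ?X" using smooth_fun_on_smooth_on[OF smooth_vf_smooth_fun_on[OF X], of p p] by simp
  have p: "\<phi> p p \<in> ?U" by simp
  have "frechet_derivative (\<lambda>x. frechet_derivative ?f (at x) (?X x)) (at (\<phi> p p)) =
      frechet_derivative ((\<lambda>q. dfun K f q (X q)) \<circ> \<psi> p) (at (\<phi> p p))"
  proof (rule frechet_derivative_transform_within_open[OF _ open_range p])
    show "(\<lambda>x. frechet_derivative ?f (at x) (?X x)) differentiable at (\<phi> p p)"
      by (rule smooth_on_differentiable[OF smooth_on_frechet_derivative[OF open_range f' X'] p])
  qed (auto simp: dfun_chart[OF f])
  then have "dfun K (\<lambda>q. dfun K f q (X q)) p u = frechet_derivative (\<lambda>x. frechet_derivative ?f (at x) (?X x)) (at (\<phi> p p)) u"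
    by (simp add: dfun_def[of K "\<lambda>q. dfun K f q (X q)"])
  also have "\<dots> = frechet_derivative (\<lambda>x. frechet_derivative ?f (at x) (?X (\<phi> p p))) (at (\<phi> p p)) u
      + frechet_derivative ?f (at (\<phi> p p)) (frechet_derivative ?X (at (\<phi> p p)) u)"
    by (rule frechet_derivative_directional[OF open_range f' X' p])
  finally show ?thesis by (simp add: dfun_def[symmetric] dtrans_self)
qed

lemma dfun_lie_bracket:
  fixes f :: "'m \<Rightarrow> 'b::euclidean_space"
  assumes f: "smooth_fun K f" and X: "smooth_vf K X" and Y: "smooth_vf K Y"
  shows "dfun K f p (lie_bracket K X Y p) =
    dfun K (\<lambda>q. dfun K f q (Y q)) p (X p) - dfun K (\<lambda>q. dfun K f q (X q)) p (Y p)"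
proof -
  have "smooth_on (\<phi> p ` \<U> p) (f \<circ> \<psi> p)" using smooth_fun_on_smooth_on[OF f, of p] by simp
  then have "frechet_derivative (\<lambda>x. frechet_derivative (f \<circ> \<psi> p) (at x) (Y p)) (at (\<phi> p p)) (X p) =
      frechet_derivative (\<lambda>x. frechet_derivative (f \<circ> \<psi> p) (at x) (X p)) (at (\<phi> p p)) (Y p)"
    by (intro frechet_derivative_commute[OF open_range]) auto
  then show ?thesis
    unfolding dfun_dfun[OF f X] dfun_dfun[OF f Y] lie_bracket_def linear_diff[OF dfun_linear[OF f]] by simp
qed

text \<open>Needed for \<open>lie_bracket_c\<close> with a real field such as \<open>\<xi>\<close>,
  whose imaginary part is the zero field.\<close>

lemma lie_bracket_0:
  assumes "smooth_vf K Y" shows "lie_bracket K (\<lambda>q. 0) Y p = 0"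
proof -
  have "((\<lambda>x. 0) has_derivative (\<lambda>u. 0)) (at (\<phi> p p))" by simp
  then have "((\<lambda>q. dtrans K q p q 0) \<circ> \<psi> p has_derivative (\<lambda>u. 0)) (at (\<phi> p p))"
    by (rule has_derivative_transform_within_open[OF _ open_range]) (auto simp: linear_0[OF dtrans_linear])
  then have "dfun K (\<lambda>q. dtrans K q p q 0) p = (\<lambda>u. 0)"
    unfolding dfun_def by (rule frechet_derivative_at[symmetric])
  moreover have "linear (dfun K (\<lambda>q. dtrans K q p q (Y q)) p)"
    unfolding dfun_def
    by (rule has_derivative_linear[OF smooth_on_has_derivative[OF smooth_fun_on_smooth_on[OF smooth_vf_smooth_fun_on[OF assms]]]])
       auto
  ultimately show ?thesis by (simp add: lie_bracket_def linear_0)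
qed

end

section \<open>Connections on complex vector bundles\<close>

lemma re_vec_cvec [simp]: "re_vec (cvec u + \<i> *s cvec v) = u" "re_vec (cvec u) = u"
  and im_vec_cvec [simp]: "im_vec (cvec u + \<i> *s cvec v) = v" "im_vec (cvec u) = 0"
  by (simp_all add: re_vec_def im_vec_def cvec_def vec_eq_iff)

lemma matrix_inv_left: "invertible M \<Longrightarrow> matrix_inv M ** M = mat 1"
  unfolding invertible_def matrix_inv_def by (rule someI2_ex) auto

locale bundle_connection = manifold K
  for K :: "('m::{t2_space,second_countable_topology}, 'n::finite) atlas" +
  fixes T :: "('m, 'r::finite) bundle_atlas" and A :: "('m, 'n, 'r) operator"
  assumes vbundle: "vector_bundle K T" and connection: "connection K T A"
begin

lemma bundle_chart: "q \<in> fst (T q)" "open (fst (T q))" "p \<in> fst (T q) \<Longrightarrow> invertible (snd (T q) p)"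
  and bundle_transition: "smooth_fun_on K (fst (T q) \<inter> fst (T q')) (\<lambda>p. snd (T q') p ** matrix_inv (snd (T q) p))"
  using vbundle unfolding vector_bundle_def by blast+

text \<open>The section that is constantly \<open>y\<close> in the trivialisation at
  \<open>p\<close>, cut off by a bump function.\<close>

lemma exists_smooth_section: obtains s where "smooth_section K T s" "s p = x"
proof -
  let ?W = "fst (T p)"
  obtain b :: "'m \<Rightarrow> real" and C where b: "smooth_fun K b" "b p = 1" "closed C" "C \<subseteq> ?W" "\<And>q. q \<notin> C \<Longrightarrow> b q = 0"
    using exists_bump[OF bundle_chart(2) bundle_chart(1)] by blast
  define y where "y = snd (T p) p *v x"
  define s where "s q = b q *\<^sub>R (matrix_inv (snd (T p) q) *v y)" for q
  have scaleR: "M *v (r *\<^sub>R z) = r *\<^sub>R (M *v z)" for M :: "complex^'r^'r" and r z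
    by (simp add: vec_eq_iff matrix_vector_mult_def scaleR_sum_right)
  have eval: "bounded_linear (\<lambda>M::complex^'r^'r. M *v y)"
    by (intro linear_conv_bounded_linear[THEN iffD1] linearI)
       (simp_all add: vec_eq_iff matrix_vector_mult_def sum.distrib scaleR_sum_right algebra_simps)
  have "smooth_fun_on K (fst (T q)) (\<lambda>r. snd (T q) r *v s r)" for q
  proof (rule smooth_fun_on_locally)
    fix r assume r: "r \<in> fst (T q)"
    show "\<exists>N. open N \<and> r \<in> N \<and> smooth_fun_on K N (\<lambda>r. snd (T q) r *v s r)"
    proof (cases "r \<in> C")
      case True
      have op: "open (?W \<inter> fst (T q))" using bundle_chart by blast
      have "smooth_fun_on K (?W \<inter> fst (T q)) (\<lambda>r. b r *\<^sub>R ((snd (T q) r ** matrix_inv (snd (T p) r)) *v y))"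
        by (intro smooth_fun_on_bounded_bilinear[OF op bounded_bilinear_scaleR]
              smooth_fun_on_bounded_linear[OF op eval] bundle_transition smooth_fun_on_subset[OF b(1) subset_UNIV])
      then have "smooth_fun_on K (?W \<inter> fst (T q)) (\<lambda>r. snd (T q) r *v s r)"
        by (simp add: s_def scaleR matrix_vector_mul_assoc)
      then show ?thesis using op True b(4) r by blast
    next
      case False
      have op: "open (- C)" using b(3) by blast
      have "smooth_fun_on K (- C) (\<lambda>r. snd (T q) r *v s r)"
        by (rule smooth_fun_on_cong[OF op _ smooth_fun_on_const[of _ 0]]) (simp add: s_def b(5))
      then show ?thesis using False op by blast
    qed
  qed
  then have "smooth_section K T s" unfolding smooth_section_def by blast
  moreover have "s p = x"
    using matrix_inv_left[OF bundle_chart(3)[OF bundle_chart(1)[of p]]]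
    by (simp add: s_def y_def b(2) matrix_vector_mul_assoc)
  ultimately show ?thesis by (rule that)
qed

lemma smooth_section_scale:
  fixes a :: complex
  assumes "smooth_section K T s" shows "smooth_section K T (\<lambda>q. a *s s q)"
proof -
  have "bounded_linear (\<lambda>x::complex^'r. a *s x)"
    by (intro linear_conv_bounded_linear[THEN iffD1] linearI) (simp_all add: vec_eq_iff algebra_simps)
  then show ?thesis
    using assms unfolding smooth_section_def vector_scalar_commute
    by (intro allI smooth_fun_on_bounded_linear[OF bundle_chart(2), where L="\<lambda>x. a *s x"]) simp_all
qed

lemma smooth_section_covariant:
  assumes "smooth_section K T s" "smooth_vf K X" shows "smooth_section K T (\<lambda>q. A s q (cvec (X q)))"
proof -
  have "smooth_cvf K (\<lambda>q. cvec (X q))" using assms(2) smooth_vf_0 unfolding smooth_cvf_def by simp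
  moreover have "\<forall>s X. smooth_section K T s \<longrightarrow> smooth_cvf K X \<longrightarrow> (\<forall>p. X p \<in> UNIV) \<longrightarrow>
      smooth_section K T (\<lambda>p. A s p (X p))"
    using connection unfolding connection_def partial_connection_def by (rule conjunct1)
  ultimately show ?thesis using assms(1) by simp
qed

lemma
  assumes "smooth_section K T s"
  shows connection_add: "A s p (u + v) = A s p u + A s p v"
    and connection_scale: "A s p (a *s v) = a *s A s p v"
    and connection_add_section: "smooth_section K T t \<Longrightarrow> A (\<lambda>q. s q + t q) p v = A s p v + A t p v"
    and connection_leibniz: "smooth_fun K f \<Longrightarrow>
      A (\<lambda>q. f q *s s q) p v = f p *s A s p v + cext_fun (dfun K f p) v *s s p"
  using connection[unfolded connection_def partial_connection_def] assms by simp_all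

lemma connection_scale_section:
  assumes "smooth_section K T s"
  shows "A (\<lambda>q. a *s s q) p v = a *s A s p v"
  using connection_leibniz[OF assms smooth_fun_on_const[of UNIV a]]
  by (simp add: cext_fun_def dfun_def comp_def)

text \<open>The function h(s, t) is differentiated along \<open>X\<close> and \<open>Y\<close> in
  both orders. The terms with one derivative on each section are symmetric in \<open>X\<close> and
  \<open>Y\<close> and cancel in the commutator, which is the derivative along the bracket; what
  remains is the curvature.\<close>

lemma curvature_skew_hermitian:
  assumes F: "is_curvature K T A F" and h: "hermitian_metric K T h" and unitary: "unitary_connection K T h A"
  shows "h p (F p u v *v x) y = - h p x (F p u v *v y)"
proof -
  obtain X where X: "smooth_vf K X" "X p = u" by (rule exists_smooth_vf)
  obtain Y where Y: "smooth_vf K Y" "Y p = v" by (rule exists_smooth_vf)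
  obtain s where s: "smooth_section K T s" "s p = x" by (rule exists_smooth_section)
  obtain t where t: "smooth_section K T t" "t p = y" by (rule exists_smooth_section)
  define N where "N Z s = (\<lambda>q. A s q (cvec (Z q)))" for Z s
  have N: "smooth_section K T (N Z s)" if "smooth_vf K Z" "smooth_section K T s" for Z s
    unfolding N_def by (rule smooth_section_covariant[OF that(2,1)])
  define H where "H s t = (\<lambda>q. h q (s q) (t q))" for s t
  have H: "smooth_fun K (H s t)" if "smooth_section K T s" "smooth_section K T t" for s t
    using h that unfolding hermitian_metric_def H_def by blast
  have dH: "dfun K (H s t) q w = h q (A s q (cvec w)) (t q) + h q (s q) (A t q (cvec w))"
    if "smooth_section K T s" "smooth_section K T t" for s t q w
    using unitary that unfolding unitary_connection_def H_def by blast
  have ddH: "dfun K (\<lambda>q. dfun K (H s t) q (Y q)) p (X p) =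
      h p (N X (N Y s) p) (t p) + h p (N Y s p) (N X t p) + h p (N X s p) (N Y t p) + h p (s p) (N X (N Y t) p)"
    if X: "smooth_vf K X" and Y: "smooth_vf K Y" for X Y
  proof -
    have "(\<lambda>q. dfun K (H s t) q (Y q)) = (\<lambda>q. H (N Y s) t q + H s (N Y t) q)"
      unfolding dH[OF s(1) t(1)] by (simp add: H_def N_def)
    then have "dfun K (\<lambda>q. dfun K (H s t) q (Y q)) p (X p) = dfun K (H (N Y s) t) p (X p) + dfun K (H s (N Y t)) p (X p)"
      using dfun_add[OF H[OF N[OF Y s(1)] t(1)] H[OF s(1) N[OF Y t(1)]]] by simp
    then show ?thesis
      unfolding dH[OF N[OF Y s(1)] t(1)] dH[OF s(1) N[OF Y t(1)]] by (simp add: N_def)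
  qed
  let ?L = "lie_bracket K X Y p"
  have lie: "h p (A s p (cvec ?L)) (t p) + h p (s p) (A t p (cvec ?L)) =
      h p (N X (N Y s) p) (t p) - h p (N Y (N X s) p) (t p) + h p (s p) (N X (N Y t) p) - h p (s p) (N Y (N X t) p)"
    using dfun_lie_bracket[OF H[OF s(1) t(1)] X(1) Y(1), of p]
    unfolding ddH[OF X(1) Y(1)] ddH[OF Y(1) X(1)] dH[OF s(1) t(1), of p ?L] by simp
  have curv: "F p u v *v s p = N X (N Y s) p - N Y (N X s) p - A s p (cvec ?L)"
    if "smooth_section K T s" for s
    using F that X Y unfolding is_curvature_def N_def by blast
  have h_add: "h p (a + b) c = h p a c + h p b c" and h_cnj: "h p c a = cnj (h p a c)" 
    and h_scale: "h p (r *s a) c = r * h p a c" for a b c r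
    using h unfolding hermitian_metric_def by blast+
  have h_diff: "h p (a - b) c = h p a c - h p b c" for a b c
    using h_add[of "a - b" b c] by simp
  have h_diff': "h p c (a - b) = h p c a - h p c b" for a b c
    unfolding h_cnj[of c] h_diff by simp
  have "h p (F p u v *v s p) (t p) + h p (s p) (F p u v *v t p) = 0"
    unfolding curv[OF s(1)] curv[OF t(1)] h_diff h_diff' using lie by (simp add: algebra_simps)
  then show ?thesis by (simp add: s t eq_neg_iff_add_eq_0)
qed

end

text \<open>If \<open>N\<close> is skew-Hermitian then \<i>N is Hermitian. The hypothesis says that
  \<open>M\<close> is -\<i>N, so \<open>M\<close> is both Hermitian and skew-Hermitian and must
  vanish. Definiteness of \<open>h\<close> enters on the vectors \<open>N *v x\<close>.\<close>

lemma hermitian_skew_split: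
  fixes M N :: "complex^'r^'r"
  assumes h: "hermitian_metric K T h"
    and M: "\<And>x y. h p (M *v x) y = - h p x (M *v y)" and N: "\<And>x y. h p (N *v x) y = - h p x (N *v y)"
    and 0: "\<And>x. M *v x + \<i> *s (N *v x) = 0"
  shows "M = 0" "N = 0"
proof -
  have h_cnj: "h p c a = cnj (h p a c)" and h_scale: "h p (r *s a) c = r * h p a c"
    and h_pos: "a \<noteq> 0 \<Longrightarrow> Re (h p a a) > 0" for a c r
    using h unfolding hermitian_metric_def by blast+
  have h_scale': "h p c (r *s a) = cnj r * h p c a" for a c r
    unfolding h_cnj[of c] h_scale by simp
  have Mx: "M *v x = (- \<i>) *s (N *v x)" for x
    using 0[of x] by (simp add: eq_neg_iff_add_eq_0 vector_sneg_minus1[symmetric] vec_eq_iff)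
  have "N *v x = 0" for x
  proof (rule ccontr)
    assume "N *v x \<noteq> 0"
    have "- \<i> * h p (N *v x) (N *v x) = h p (M *v x) (N *v x)"
      unfolding Mx h_scale ..
    also have "\<dots> = - h p x (M *v (N *v x))"
      by (rule M)
    also have "\<dots> = - h p x ((- \<i>) *s (N *v (N *v x)))"
      by (simp only: Mx)
    also have "\<dots> = \<i> * h p (N *v x) (N *v x)"
      unfolding h_scale' N by simp
    finally have "h p (N *v x) (N *v x) = 0" by simp
    then show False using h_pos[OF \<open>N *v x \<noteq> 0\<close>] by simp
  qed
  then show N: "N = 0" by (simp add: matrix_eq)
  show "M = 0" using Mx by (simp add: matrix_eq N)
qed

section \<open>Sasakian geometry\<close>

lemma sasakian_algebra:
  assumes "sasakian K \<eta> \<xi> g \<Phi>"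
  shows "linear (\<eta> p)" "linear (\<Phi> p)" "\<eta> p (\<xi> p) = 1"
    and "\<Phi> p (\<Phi> p u) = - u + \<eta> p u *\<^sub>R \<xi> p" and "g p (\<Phi> p u) (\<Phi> p v) = g p u v - \<eta> p u * \<eta> p v"
    and "\<Phi> p (\<xi> p) = 0" and "\<eta> p (\<Phi> p u) = 0" and "g p (\<xi> p) u = \<eta> p u"
proof -
  show \<eta>: "linear (\<eta> p)"
    using assms unfolding sasakian_def contact_form_def smooth_1form_def by blast
  show \<Phi>: "linear (\<Phi> p)" using assms unfolding sasakian_def smooth_endo_def by blast
  show \<xi>: "\<eta> p (\<xi> p) = 1" using assms unfolding sasakian_def by blast
  show \<Phi>2: "\<Phi> p (\<Phi> p u) = - u + \<eta> p u *\<^sub>R \<xi> p" for u using assms unfolding sasakian_def by blast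
  show g\<Phi>: "g p (\<Phi> p u) (\<Phi> p v) = g p u v - \<eta> p u * \<eta> p v" for u v
    using assms unfolding sasakian_def by blast
  have gxi: "g p (\<xi> p) (\<xi> p) = 1" using assms unfolding sasakian_def by blast
  have g: "bilinear (g p)" "\<And>u v. g p u v = g p v u" "\<And>u. u \<noteq> 0 \<Longrightarrow> g p u u > 0"
    using assms unfolding sasakian_def riemannian_metric_def by blast+
  \<comment> \<open>The squared length of \<open>\<Phi> p (\<xi> p)\<close> is 1 - 1 = 0.\<close>
  show \<Phi>\<xi>: "\<Phi> p (\<xi> p) = 0"
    using g(3)[of "\<Phi> p (\<xi> p)"] g\<Phi>[of "\<xi> p" "\<xi> p"] by (auto simp: \<xi> gxi)
  \<comment> \<open>The cube of \<open>\<Phi>\<close> is computed twice, with the formula for the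
    square applied to \<open>u\<close> and to \<open>\<Phi> p u\<close>; the difference is the
    multiple of \<open>\<xi> p\<close> by \<open>\<eta> p (\<Phi> p u)\<close>.\<close>
  have "\<Phi> p (\<Phi> p (\<Phi> p u)) = - \<Phi> p u"
    unfolding \<Phi>2[of u] linear_add[OF \<Phi>] linear_scale[OF \<Phi>] linear_neg[OF \<Phi>] by (simp add: \<Phi>\<xi>)
  then have "\<eta> p (\<Phi> p u) *\<^sub>R \<xi> p = 0" unfolding \<Phi>2[of "\<Phi> p u"] by simp
  moreover have "\<xi> p \<noteq> 0" using \<xi> linear_0[OF \<eta>] by auto
  ultimately show "\<eta> p (\<Phi> p u) = 0" by simp
  show "g p (\<xi> p) u = \<eta> p u"
    using g\<Phi>[of "\<xi> p" u] bilinear_lzero[OF g(1)] by (simp add: \<xi> \<Phi>\<xi>)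
qed

text \<open>For horizontal w the square of \<open>\<Phi>\<close> is -1, so \<open>\<Phi>\<close>
  maps w + \<i>\<open>\<Phi>\<close>w to \<open>\<Phi>\<close>w - \<i>w, which is -\<i> times that
  vector.\<close>

lemma H01_horizontal_lift:
  assumes S: "sasakian K \<eta> \<xi> g \<Phi>"
  shows "cvec (u - \<eta> p u *\<^sub>R \<xi> p) + \<i> *s cvec (\<Phi> p u) \<in> H01 \<eta> \<Phi> p"
    and "cvec (u - \<eta> p u *\<^sub>R \<xi> p) + \<i> *s cvec (- \<Phi> p u) \<in> H10 \<eta> \<Phi> p"
proof -
  note alg = sasakian_algebra[OF S]
  define w where "w = u - \<eta> p u *\<^sub>R \<xi> p"
  have "\<eta> p w = 0" "\<Phi> p w = \<Phi> p u" "\<Phi> p (\<Phi> p u) = - w"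
    by (simp_all add: w_def linear_diff[OF alg(1)] linear_scale[OF alg(1)] linear_diff[OF alg(2)]
        linear_scale[OF alg(2)] alg(3,4,6))
  then show "cvec (u - \<eta> p u *\<^sub>R \<xi> p) + \<i> *s cvec (\<Phi> p u) \<in> H01 \<eta> \<Phi> p"
    "cvec (u - \<eta> p u *\<^sub>R \<xi> p) + \<i> *s cvec (- \<Phi> p u) \<in> H10 \<eta> \<Phi> p"
    unfolding w_def[symmetric] H01_def H10_def mem_Collect_eq cext_fun_def cext_endo_def re_vec_cvec im_vec_cvec
      linear_neg[OF alg(1)] linear_neg[OF alg(2)] alg(7)
    by (simp_all add: cvec_def vec_eq_iff algebra_simps)
qed

text \<open>\<open>\<Phi>\<close> is invariant under the Reeb flow: vanishing torsion gives
  [\<open>\<xi>\<close>, Z] as the derivative of Z along \<open>\<xi>\<close> plus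
  \<open>\<Phi>\<close>Z, and the covariant derivative of \<open>\<Phi>\<close> along
  \<open>\<xi>\<close> is zero because \<open>g p (\<xi> p)\<close> is
  \<open>\<eta> p\<close>.\<close>

lemma lie_bracket_Reeb:
  assumes S: "sasakian K \<eta> \<xi> g \<Phi>" and Y: "smooth_vf K Y"
  shows "lie_bracket K \<xi> (\<lambda>q. \<Phi> q (Y q)) p = \<Phi> p (lie_bracket K \<xi> Y p)"
proof -
  note alg = sasakian_algebra[OF S]
  obtain nab where nab: "levi_civita K g nab" "\<And>p u. nab \<xi> p u = - \<Phi> p u"
    "\<And>Y p u. smooth_vf K Y \<Longrightarrow>
       nab (\<lambda>q. \<Phi> q (Y q)) p u - \<Phi> p (nab Y p u) = g p u (Y p) *\<^sub>R \<xi> p - \<eta> p (Y p) *\<^sub>R u"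
    using S unfolding sasakian_def by blast
  have \<xi>: "smooth_vf K \<xi>" using S unfolding sasakian_def by blast
  have \<Phi>Y: "smooth_vf K (\<lambda>q. \<Phi> q (Y q))" using S Y unfolding sasakian_def smooth_endo_def by blast
  have torsion: "lie_bracket K \<xi> Z p = nab Z p (\<xi> p) + \<Phi> p (Z p)" if "smooth_vf K Z" for Z
  proof -
    have "nab Z p (\<xi> p) - nab \<xi> p (Z p) = lie_bracket K \<xi> Z p"
      using nab(1) \<xi> that unfolding levi_civita_def by blast
    then show ?thesis by (simp add: nab(2))
  qed
  have "nab (\<lambda>q. \<Phi> q (Y q)) p (\<xi> p) = \<Phi> p (nab Y p (\<xi> p))"
    using nab(3)[OF Y, of p "\<xi> p"] by (simp add: alg(8))
  then show ?thesis
    unfolding torsion[OF Y] torsion[OF \<Phi>Y] linear_add[OF alg(2)] by simp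
qed

text \<open>Flatness is evaluated on \<open>\<xi>\<close> and a field \<open>W\<close> of type (0,1)
  whose real part extends the horizontal part of \<open>u\<close>. Complex linearity of
  \<open>A\<close> then splits the result into the curvature on the real fields \<open>Y\<close> and
  \<open>Z\<close>.\<close>

lemma curvature_Reeb:
  fixes K :: "('m::{t2_space,second_countable_topology}, 7) atlas"
    and T :: "('m, 'r::finite) bundle_atlas" and A :: "('m, 7, 'r) operator"
  assumes S: "sasakian K \<eta> \<xi> g \<Phi>" and hol: "holomorphic_sasakian_bundle K \<eta> \<xi> \<Phi> T D0 dbar"
    and int: "integrable_connection K \<eta> \<xi> \<Phi> T dbar A" and F: "is_curvature K T A F"
  shows "F p (\<xi> p) (u - \<eta> p u *\<^sub>R \<xi> p) *v x + \<i> *s (F p (\<xi> p) (\<Phi> p u) *v x) = 0"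
proof -
  interpret bundle_connection K T A
    using S hol int
    by unfold_locales
       (auto simp: sasakian_def holomorphic_sasakian_bundle_def complex_sasakian_bundle_def integrable_connection_def)
  obtain V where V: "smooth_vf K V" "V p = u" by (rule exists_smooth_vf)
  obtain s where s: "smooth_section K T s" "s p = x" by (rule exists_smooth_section)
  have \<xi>: "smooth_vf K \<xi>" using S unfolding sasakian_def by blast
  note alg = sasakian_algebra[OF S]
  define Y where "Y q = V q - \<eta> q (V q) *\<^sub>R \<xi> q" for q
  have "smooth_fun K (\<lambda>q. \<eta> q (V q))"
    using S V(1) unfolding sasakian_def contact_form_def smooth_1form_def by blast
  then have "smooth_fun K (\<lambda>q. - \<eta> q (V q))"
    using smooth_fun_on_bounded_linear[OF open_UNIV bounded_linear_minus[OF bounded_linear_ident]] by blast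
  then have "smooth_vf K (\<lambda>q. V q + (- \<eta> q (V q)) *\<^sub>R \<xi> q)"
    by (intro smooth_vf_add smooth_vf_scaleR V \<xi>)
  then have Y: "smooth_vf K Y" by (simp add: Y_def[abs_def])
  define Z where "Z q = \<Phi> q (Y q)" for q
  have Z: "smooth_vf K Z" using S Y unfolding sasakian_def smooth_endo_def Z_def by blast
  have ZV: "Z q = \<Phi> q (V q)" for q
    unfolding Z_def Y_def linear_diff[OF alg(2)] linear_scale[OF alg(2)] by (simp add: alg(6))
  define W where "W q = cvec (Y q) + \<i> *s cvec (Z q)" for q
  have W: "smooth_cvf K W" unfolding smooth_cvf_def W_def by (simp add: Y Z)
  have cxi: "smooth_cvf K (\<lambda>q. cvec (\<xi> q))" unfolding smooth_cvf_def by (simp add: \<xi> smooth_vf_0)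
  \<comment> \<open>One form of membership that serves three times: \<open>a = 0\<close> gives
    \<open>W\<close>, \<open>w = 0\<close> with \<open>a = 1\<close> gives the Reeb field, and a
    general \<open>a\<close> gives the bracket.\<close>
  have lift: "cvec (w - \<eta> q w *\<^sub>R \<xi> q) + \<i> *s cvec (\<Phi> q w) + a *s cvec (\<xi> q) \<in> H01_tilde \<eta> \<xi> \<Phi> q" for q w a
    using H01_horizontal_lift(1)[OF S, of w q] unfolding H01_tilde_def N_xi_def by blast
  have W_in: "W q \<in> H01_tilde \<eta> \<xi> \<Phi> q" for q
    using lift[of "V q" q 0] by (simp add: W_def ZV Y_def)
  have xi_in: "cvec (\<xi> q) \<in> H01_tilde \<eta> \<xi> \<Phi> q" for q
  proof -
    have "cvec 0 = (0::complex^7)" by (simp add: cvec_def vec_eq_iff)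
    then show ?thesis using lift[of 0 q 1] linear_0[OF alg(1)] linear_0[OF alg(2)] by simp
  qed
  have lie: "lie_bracket_c K (\<lambda>q. cvec (\<xi> q)) W p =
      cvec (lie_bracket K \<xi> Y p) + \<i> *s cvec (lie_bracket K \<xi> Z p)"
    unfolding lie_bracket_c_def W_def Let_def by (simp add: lie_bracket_0[OF Y] lie_bracket_0[OF Z])
  \<comment> \<open>\<open>dbar\<close> and \<open>A\<close> are only known to agree on \<open>H01_tilde\<close>, 
    so flatness is of use only once the bracket lies in it.\<close>
  have lie_in: "lie_bracket_c K (\<lambda>q. cvec (\<xi> q)) W p \<in> H01_tilde \<eta> \<xi> \<Phi> p"
  proof -
    let ?L = "lie_bracket K \<xi> Y p"
    have "lie_bracket_c K (\<lambda>q. cvec (\<xi> q)) W p =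
        cvec (?L - \<eta> p ?L *\<^sub>R \<xi> p) + \<i> *s cvec (\<Phi> p ?L) + of_real (\<eta> p ?L) *s cvec (\<xi> p)"
      unfolding lie Z_def[abs_def] lie_bracket_Reeb[OF S Y] by (simp add: cvec_def vec_eq_iff)
    then show ?thesis using lift by simp
  qed
  have A_dbar: "dbar t q v = A t q v" if "smooth_section K T t" "v \<in> H01_tilde \<eta> \<xi> \<Phi> q" for t q v
    using int that unfolding integrable_connection_def by simp
  have AW: "(\<lambda>q. A s q (W q)) = (\<lambda>q. A s q (cvec (Y q)) + \<i> *s A s q (cvec (Z q)))"
    unfolding W_def by (simp add: connection_add[OF s(1)] connection_scale[OF s(1)])
  have sY: "smooth_section K T (\<lambda>q. A s q (cvec (Y q)))" and sZ: "smooth_section K T (\<lambda>q. A s q (cvec (Z q)))"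
    and sxi: "smooth_section K T (\<lambda>q. A s q (cvec (\<xi> q)))"
    by (rule smooth_section_covariant[OF s(1)]; fact)+
  have sW: "smooth_section K T (\<lambda>q. A s q (W q))"
    using connection[unfolded connection_def partial_connection_def, THEN conjunct1] s(1) W by simp
  have "flat_along K T (H01_tilde \<eta> \<xi> \<Phi>) dbar" using hol unfolding holomorphic_sasakian_bundle_def by simp
  then have "dbar (\<lambda>q. dbar s q (W q)) p (cvec (\<xi> p)) - dbar (\<lambda>q. dbar s q (cvec (\<xi> q))) p (W p)
      - dbar s p (lie_bracket_c K (\<lambda>q. cvec (\<xi> q)) W p) = 0"
    unfolding flat_along_def
    by (elim allE[of _ "\<lambda>q. cvec (\<xi> q)"] allE[of _ W] allE[of _ s]) (simp add: cxi W W_in xi_in s(1))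
  then have flat: "A (\<lambda>q. A s q (W q)) p (cvec (\<xi> p)) - A (\<lambda>q. A s q (cvec (\<xi> q))) p (W p)
      - A s p (lie_bracket_c K (\<lambda>q. cvec (\<xi> q)) W p) = 0"
    by (simp add: A_dbar s(1) sW sxi W_in xi_in lie_in)
  have curv: "F p (\<xi> p) (X p) *v s p = A (\<lambda>q. A s q (cvec (X q))) p (cvec (\<xi> p))
      - A (\<lambda>q. A s q (cvec (\<xi> q))) p (cvec (X p)) - A s p (cvec (lie_bracket K \<xi> X p))"
    if "smooth_vf K X" for X
    using F \<xi> that s(1) unfolding is_curvature_def by blast
  have "F p (\<xi> p) (Y p) *v s p + \<i> *s (F p (\<xi> p) (Z p) *v s p) = 0"
    unfolding flat[symmetric] curv[OF Y] curv[OF Z] AW lie connection_add_section[OF sY smooth_section_scale[OF sZ]]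
      connection_scale_section[OF sZ] W_def connection_add[OF s(1)] connection_scale[OF s(1)]
      connection_add[OF sxi] connection_scale[OF sxi]
    by (simp add: vec_eq_iff algebra_simps)
  then show ?thesis by (simp add: Y_def ZV V s)
qed

section \<open>Selfduality and the transverse Hermitian Yang--Mills equations\<close>

context adapted_frame begin

lemma selfdual_frame:
  fixes F :: "real^7 \<Rightarrow> real^7 \<Rightarrow> 'w::real_vector"
  assumes alt: "alt_form 2 (form2 F)"
    and selfdual: "form2 F = hodge G \<mu> 5 (wedge 3 2 (wedge 1 2 (form1 \<eta>) (form2 \<omega>)) (form2 F))"
  shows "contraction F = 0" and "F u v = F (J u) (J v)"
proof -
  have sd: "F u v = F (J u) (J v) - \<omega> u v *\<^sub>R contraction F" for u v
    using fun_cong[OF selfdual, of "\<lambda>i. if i = 1 then u else v"]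
    unfolding hodge_adapted_frame[OF alt] by (simp add: form2_def)
  have "F (J (e 1)) (J (e 4)) = F (e 1) (e 4)"
    unfolding J_frame(2,5) linear_neg[OF F_linear(2)[OF alt]] by (rule F_skew[OF alt, symmetric])
  moreover have "\<omega> (e 1) (e 4) = 1" by (simp add: \<omega>_frame G_frame del: One_nat_def)
  ultimately show 0: "contraction F = 0" using sd[of "e 1" "e 4"] by simp
  show "F u v = F (J u) (J v)" using sd[of u v] by (simp add: 0)
qed

end

section \<open>From the normalisation to an adapted frame\<close>

lemma sasakian_inner_form:
  assumes S: "sasakian K \<eta> \<xi> g \<Phi>" and c: "c > 0"
  shows "inner_form (scaled_metric \<eta> g c p)"
proof
  note alg = sasakian_algebra[OF S]
  have g: "bilinear (g p)" "\<And>u v. g p u v = g p v u" "\<And>u. u \<noteq> 0 \<Longrightarrow> g p u u > 0"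
    using S unfolding sasakian_def riemannian_metric_def by blast+
  show "bilinear (scaled_metric \<eta> g c p)"
    unfolding bilinear_def scaled_metric_def
    by (intro conjI allI linearI)
       (simp_all add: bilinear_ladd[OF g(1)] bilinear_radd[OF g(1)] bilinear_lmul[OF g(1)] bilinear_rmul[OF g(1)]
          linear_add[OF alg(1)] linear_scale[OF alg(1)] algebra_simps)
  show "scaled_metric \<eta> g c p u v = scaled_metric \<eta> g c p v u" for u v
    unfolding scaled_metric_def by (simp add: g(2)[of u v])
  fix u :: "real^7" assume u: "u \<noteq> 0"
  show "scaled_metric \<eta> g c p u u > 0"
  proof (cases "\<eta> p u = 0")
    case True
    then show ?thesis using g(3)[OF u] c by (simp add: scaled_metric_def)
  next
    case False
    \<comment> \<open>The transverse part of \<open>g p u u\<close> is the squared length of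
      \<open>\<Phi> p u\<close>, hence nonnegative; the square of \<open>\<eta> p u\<close> makes
      the total positive.\<close>
    have "g p (\<Phi> p u) (\<Phi> p u) \<ge> 0" using g(3)[of "\<Phi> p u"] bilinear_lzero[OF g(1)] by (cases "\<Phi> p u = 0") auto
    then have "c * (g p u u - \<eta> p u * \<eta> p u) \<ge> 0" using c alg(5)[of p u u] by simp
    moreover have "\<eta> p u * \<eta> p u > 0" using False not_real_square_gt_zero by blast
    ultimately show ?thesis unfolding scaled_metric_def by linarith
  qed
qed

text \<open>The form a + \<i>b vanishes on w + \<i>\<open>\<Phi>\<close>w, and it kills
  \<open>\<xi>\<close>, so w may be read as \<open>u\<close>. The real and imaginary parts say how
  \<open>\<Phi>\<close> acts on the coframe by transposition.\<close>

lemma type_10_transpose: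
  assumes S: "sasakian K \<eta> \<xi> g \<Phi>" and a: "linear a" and b: "linear b"
    and type: "type_10 \<eta> \<xi> \<Phi> p (\<lambda>u. Complex (a u) (b u))"
  shows "a (\<Phi> p u) = - b u" "b (\<Phi> p u) = a u"
proof -
  have "a (\<xi> p) = 0" "b (\<xi> p) = 0" using type unfolding type_10_def by (auto simp: complex_eq_iff)
  moreover have "cext_fun (\<lambda>u. Complex (a u) (b u)) (cvec (u - \<eta> p u *\<^sub>R \<xi> p) + \<i> *s cvec (\<Phi> p u)) = 0"
    using type H01_horizontal_lift(1)[OF S] unfolding type_10_def by blast
  ultimately show "a (\<Phi> p u) = - b u" "b (\<Phi> p u) = a u"
    by (simp_all add: cext_fun_def complex_eq_iff linear_diff[OF a] linear_scale[OF a] linear_diff[OF b] linear_scale[OF b])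
qed

lemma type_01_transpose:
  assumes S: "sasakian K \<eta> \<xi> g \<Phi>" and a: "linear a" and b: "linear b"
    and type: "type_01 \<eta> \<xi> \<Phi> p (\<lambda>u. Complex (a u) (b u))"
  shows "a (- \<Phi> p u) = - b u" "b (- \<Phi> p u) = a u"
proof -
  have "a (\<xi> p) = 0" "b (\<xi> p) = 0" using type unfolding type_01_def by (auto simp: complex_eq_iff)
  moreover have "cext_fun (\<lambda>u. Complex (a u) (b u)) (cvec (u - \<eta> p u *\<^sub>R \<xi> p) + \<i> *s cvec (- \<Phi> p u)) = 0"
    using type H01_horizontal_lift(2)[OF S] unfolding type_01_def by blast
  ultimately show "a (- \<Phi> p u) = - b u" "b (- \<Phi> p u) = a u"
    unfolding cext_fun_def re_vec_cvec im_vec_cvec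
    by (simp_all add: complex_eq_iff linear_diff[OF a] linear_scale[OF a] linear_diff[OF b] linear_scale[OF b])
qed

text \<open>The type condition constrains the coframe, while the locale asks for \<open>J\<close> on
  the frame. Expanding \<open>J u\<close> in the orthonormal frame converts one into the
  other.\<close>

lemma adapted_frameI:
  fixes G :: "real^7 \<Rightarrow> real^7 \<Rightarrow> real"
  assumes "inner_form G" "alt_form 7 \<mu>" and onb: "pos_onb G \<mu> e" and \<eta>: "G (e 7) = \<eta>"
    and \<omega>: "\<And>u v. \<omega> u v = (\<Sum>j\<in>{1,2,3}. G (e j) u * G (e (j + 3)) v - G (e j) v * G (e (j + 3)) u)"
    and J: "linear J" "\<And>u. \<eta> (J u) = 0"
    and J': "\<And>j u. j \<in> {1,2,3} \<Longrightarrow> G (e j) (J u) = - G (e (j + 3)) u \<and> G (e (j + 3)) (J u) = G (e j) u"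
  shows "adapted_frame G \<mu> e \<eta> \<omega> J"
proof -
  interpret inner_form G by fact
  have ort: "G (e i) (e j) = (if i = j then 1 else 0)" if "i \<in> {1..7}" "j \<in> {1..7}" for i j
    using onb that unfolding pos_onb_def by simp
  have expand: "J u = - G (e 4) u *\<^sub>R e 1 - G (e 5) u *\<^sub>R e 2 - G (e 6) u *\<^sub>R e 3
      + G (e 1) u *\<^sub>R e 4 + G (e 2) u *\<^sub>R e 5 + G (e 3) u *\<^sub>R e 6" (is "_ = ?rhs") for u
  proof -
    have seven: "{1..7} = {1,2,3,4,5,6,7::nat}" by auto
    have "J u = (\<Sum>j\<in>{1..7}. G (e j) (J u) *\<^sub>R e j)"
      using onb_expand[OF onb, of "J u"] by (simp add: sym)
    also have "\<dots> = ?rhs"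
      unfolding seven using J'[of 1 u] J'[of 2 u] J'[of 3 u] J(2)[of u] \<eta>
      by (simp del: One_nat_def add: algebra_simps)
    finally show ?thesis .
  qed
  show ?thesis
  proof (intro adapted_frame.intro adapted_frame_axioms.intro)
    show "\<eta> u = G (e 7) u" for u using \<eta> by simp
    show "\<omega> u v = (\<Sum>j\<in>{1,2,3}. G (e j) u * G (e (j + 3)) v - G (e j) v * G (e (j + 3)) u)" for u v
      by (rule \<omega>)
    show "J (e 1) = e 4" "J (e 2) = e 5" "J (e 3) = e 6" "J (e 4) = - e 1" "J (e 5) = - e 2" "J (e 6) = - e 3" "J (e 7) = 0"
      by (simp_all add: expand ort del: One_nat_def)
  qed fact+
qed

text \<open>The sign of \<open>J\<close> follows the type in the normalisation. It disappears later,
  because \<open>J\<close> enters only in pairs \<open>F (J u) (J v)\<close>.\<close>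

lemma sasakian_adapted_frame:
  assumes S: "sasakian K \<eta> \<xi> g \<Phi>" and N: "normalised K \<eta> \<xi> g \<Phi> c \<mu>"
  obtains e J where "adapted_frame (scaled_metric \<eta> g c p) (\<mu> p) e (\<eta> p) (ext_d1 K \<eta> p) J"
    "J = \<Phi> p \<or> J = (\<lambda>u. - \<Phi> p u)"
proof -
  let ?G = "scaled_metric \<eta> g c p"
  note alg = sasakian_algebra[OF S]
  have c: "c > 0" and \<mu>: "alt_form 7 (\<mu> p)"
    using N unfolding normalised_def orientation_form_def by simp_all
  interpret inner_form ?G by (rule sasakian_inner_form[OF S c])
  obtain e where e: "pos_onb ?G (\<mu> p) e" "?G (e 7) = \<eta> p"
    "\<And>u v. ext_d1 K \<eta> p u v = (\<Sum>j\<in>{1,2,3}. ?G (e j) u * ?G (e (j + 3)) v - ?G (e j) v * ?G (e (j + 3)) u)"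
    "(\<forall>j\<in>{1,2,3}. type_10 \<eta> \<xi> \<Phi> p (\<lambda>u. Complex (?G (e j) u) (?G (e (j + 3)) u))) \<or>
     (\<forall>j\<in>{1,2,3}. type_01 \<eta> \<xi> \<Phi> p (\<lambda>u. Complex (?G (e j) u) (?G (e (j + 3)) u)))"
    using N unfolding normalised_def Let_def by meson
  note frame = adapted_frameI[OF inner_form_axioms \<mu> e(1,2,3)]
  from e(4) show ?thesis
  proof
    assume "\<forall>j\<in>{1,2,3}. type_10 \<eta> \<xi> \<Phi> p (\<lambda>u. Complex (?G (e j) u) (?G (e (j + 3)) u))"
    then have "adapted_frame ?G (\<mu> p) e (\<eta> p) (ext_d1 K \<eta> p) (\<Phi> p)"
      by (intro frame alg conjI type_10_transpose[OF S linear_right linear_right]) blast+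
    then show ?thesis by (rule that) simp
  next
    assume "\<forall>j\<in>{1,2,3}. type_01 \<eta> \<xi> \<Phi> p (\<lambda>u. Complex (?G (e j) u) (?G (e (j + 3)) u))"
    then have "adapted_frame ?G (\<mu> p) e (\<eta> p) (ext_d1 K \<eta> p) (\<lambda>u. - \<Phi> p u)"
      by (intro frame conjI type_01_transpose[OF S linear_right linear_right] linear_compose_neg alg)
         (auto simp: linear_neg[OF alg(1)] alg(7))
    then show ?thesis by (rule that) simp
  qed
qed

text \<open>The (0,2)-component is a quarter of M + \<i>N, where M and N combine values of
  \<open>F\<close> on real vectors. Applying the matrices to \<open>x\<close> gives the form that
  \<open>hermitian_skew_split\<close> expects.\<close>

lemma component_02_zero_iff:
  fixes F :: "'m \<Rightarrow> real^7 \<Rightarrow> real^7 \<Rightarrow> complex^'r^'r::finite"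
    and \<eta> :: "'m \<Rightarrow> real^7 \<Rightarrow> real" and \<xi> :: "'m \<Rightarrow> real^7"
  assumes F1: "\<And>v. linear (\<lambda>u. F p u v)" and F2: "\<And>u. linear (F p u)"
  defines "w \<equiv> \<lambda>u. u - \<eta> p u *\<^sub>R \<xi> p"
  shows "component_02 \<eta> \<xi> \<Phi> F p u v = 0 \<longleftrightarrow>
    (\<forall>x. (F p (w u) (w v) - F p (\<Phi> p u) (\<Phi> p v)) *v x
       + \<i> *s ((F p (w u) (\<Phi> p v) + F p (\<Phi> p u) (w v)) *v x) = 0)"
proof -
  let ?M = "F p (w u) (w v) - F p (\<Phi> p u) (\<Phi> p v)" and ?N = "F p (w u) (\<Phi> p v) + F p (\<Phi> p u) (w v)"
  have re: "re_vec (proj_01 \<eta> \<xi> \<Phi> p u) = (1/2) *\<^sub>R w u" "im_vec (proj_01 \<eta> \<xi> \<Phi> p u) = (1/2) *\<^sub>R \<Phi> p u" for u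
    by (simp_all add: proj_01_def w_def re_vec_def im_vec_def cvec_def vec_eq_iff)
  have mult: "(\<chi> a b. ?M $ a $ b + \<i> * ?N $ a $ b) *v x = ?M *v x + \<i> *s (?N *v x)" for x
    by (simp add: matrix_vector_mult_def vec_eq_iff sum.distrib sum_distrib_left ring_distribs mult.assoc)
  have "component_02 \<eta> \<xi> \<Phi> F p u v = (1/4) *\<^sub>R (\<chi> a b. ?M $ a $ b + \<i> * ?N $ a $ b)"
    unfolding component_02_def cext_2form_def re linear_scale[OF F1] linear_scale[OF F2]
    by (simp add: vec_eq_iff complex_eq_iff field_simps)
  then have "component_02 \<eta> \<xi> \<Phi> F p u v = 0 \<longleftrightarrow> (\<chi> a b. ?M $ a $ b + \<i> * ?N $ a $ b) = 0"
    by simp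
  also have "\<dots> \<longleftrightarrow> (\<forall>x. (\<chi> a b. ?M $ a $ b + \<i> * ?N $ a $ b) *v x = 0)"
    using matrix_eq[of "\<chi> a b. ?M $ a $ b + \<i> * ?N $ a $ b" 0] by simp
  finally show ?thesis unfolding mult .
qed

theorem proposition1p1:
  fixes K :: "('m::{t2_space,second_countable_topology}, 7) atlas"
    and \<eta> :: "'m \<Rightarrow> real^7 \<Rightarrow> real" and \<xi> :: "'m \<Rightarrow> real^7"
    and g :: "'m \<Rightarrow> real^7 \<Rightarrow> real^7 \<Rightarrow> real" and \<Phi> :: "'m \<Rightarrow> real^7 \<Rightarrow> real^7"
    and c :: real and \<mu> :: "'m \<Rightarrow> (nat \<Rightarrow> real^7) \<Rightarrow> real"
    and T :: "('m, 'r::finite) bundle_atlas" and D0 A :: "('m, 7, 'r) operator"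
    and F :: "'m \<Rightarrow> real^7 \<Rightarrow> real^7 \<Rightarrow> complex^'r^'r"
  assumes "sasakian K \<eta> \<xi> g \<Phi>"
    and "normalised K \<eta> \<xi> g \<Phi> c \<mu>"
    and "complex_sasakian_bundle K \<xi> T D0"
    and "connection K T A"
    and "is_curvature K T A F"
  shows "(selfdual_contact_instanton K \<eta> (scaled_metric \<eta> g c) \<mu> F \<longrightarrow>
            transverse_HYM K \<eta> \<xi> \<Phi> (scaled_metric \<eta> g c) F) \<and>
         (\<forall>dbar h. holomorphic_sasakian_bundle K \<eta> \<xi> \<Phi> T D0 dbar \<longrightarrow>
            integrable_connection K \<eta> \<xi> \<Phi> T dbar A \<longrightarrow>
            hermitian_metric K T h \<longrightarrow> unitary_connection K T h A \<longrightarrow>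
            transverse_HYM K \<eta> \<xi> \<Phi> (scaled_metric \<eta> g c) F \<longrightarrow>
            selfdual_contact_instanton K \<eta> (scaled_metric \<eta> g c) \<mu> F)"
proof -
  let ?G = "scaled_metric \<eta> g c"
  note S = assms(1) and N = assms(2) and curv = assms(5)
  note alg = sasakian_algebra[OF S]
  have alt: "alt_form 2 (form2 (F p))" for p using curv unfolding is_curvature_def by blast
  have F_lin: "linear (\<lambda>u. F p u v)" "linear (F p u)" for p u v
  proof -
    obtain e J where "adapted_frame (?G p) (\<mu> p) e (\<eta> p) (ext_d1 K \<eta> p) J"
      using sasakian_adapted_frame[OF S N] by blast
    then interpret adapted_frame "?G p" "\<mu> p" e "\<eta> p" "ext_d1 K \<eta> p" J .
    show "linear (\<lambda>u. F p u v)" "linear (F p u)" by (rule F_linear[OF alt])+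
  qed
  have F_neg: "F p (- u) v = - F p u v" "F p u (- v) = - F p u v" for p u v
    by (rule linear_neg[OF F_lin(1)] linear_neg[OF F_lin(2)])+
  define w where "w p u = u - \<eta> p u *\<^sub>R \<xi> p" for p u
  have \<Phi>w: "\<Phi> p (w p u) = \<Phi> p u" and \<Phi>\<Phi>: "\<Phi> p (\<Phi> p u) = - w p u" for p u
    by (simp_all add: w_def linear_diff[OF alg(2)] linear_scale[OF alg(2)] alg(4,6))
  have "transverse_HYM K \<eta> \<xi> \<Phi> ?G F" if sd: "selfdual_contact_instanton K \<eta> ?G \<mu> F"
    unfolding transverse_HYM_def
  proof (intro conjI allI)
    fix p
    obtain e J where frame: "adapted_frame (?G p) (\<mu> p) e (\<eta> p) (ext_d1 K \<eta> p) J" "J = \<Phi> p \<or> J = (\<lambda>u. - \<Phi> p u)"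
      using sasakian_adapted_frame[OF S N] by blast
    interpret adapted_frame "?G p" "\<mu> p" e "\<eta> p" "ext_d1 K \<eta> p" J by (rule frame(1))
    have sdp: "form2 (F p) = hodge (?G p) (\<mu> p) 5 (wedge 3 2 (wedge 1 2 (form1 (\<eta> p)) (form2 (ext_d1 K \<eta> p))) (form2 (F p)))"
      using sd unfolding selfdual_contact_instanton_def by blast
    show "inner_2form (?G p) (F p) (ext_d1 K \<eta> p) = 0"
      unfolding inner_2form_adapted_frame[OF alt] by (rule selfdual_frame(1)[OF alt sdp])
    have inv: "F p (\<Phi> p u) (\<Phi> p v) = F p u v" for u v
      using selfdual_frame(2)[OF alt sdp, of u v] frame(2) by (auto simp: F_neg)
    fix u v
    have "F p (w p u) (w p v) = F p (\<Phi> p u) (\<Phi> p v)"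
      using inv[of "w p u" "w p v"] by (simp add: \<Phi>w)
    \<comment> \<open>Invariance is applied with \<open>\<Phi> p v\<close> in the second place,
      where another \<open>\<Phi>\<close> gives \<open>- w p v\<close>; this is the imaginary part
      of the (0,2)-component.\<close>
    moreover have "F p (w p u) (\<Phi> p v) = - F p (\<Phi> p u) (w p v)"
      using inv[of "w p u" "\<Phi> p v"] by (simp add: \<Phi>w \<Phi>\<Phi> F_neg)
    ultimately show "component_02 \<eta> \<xi> \<Phi> F p u v = 0"
      unfolding component_02_zero_iff[OF F_lin] w_def[symmetric] by simp
  qed
  moreover have "selfdual_contact_instanton K \<eta> ?G \<mu> F"
    if hol: "holomorphic_sasakian_bundle K \<eta> \<xi> \<Phi> T D0 dbar"
      and int: "integrable_connection K \<eta> \<xi> \<Phi> T dbar A"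
      and h: "hermitian_metric K T h" and unitary: "unitary_connection K T h A"
      and HYM: "transverse_HYM K \<eta> \<xi> \<Phi> ?G F" for dbar h
    unfolding selfdual_contact_instanton_def
  proof (intro allI ext)
    fix p and v :: "nat \<Rightarrow> real^7"
    obtain e J where frame: "adapted_frame (?G p) (\<mu> p) e (\<eta> p) (ext_d1 K \<eta> p) J" "J = \<Phi> p \<or> J = (\<lambda>u. - \<Phi> p u)"
      using sasakian_adapted_frame[OF S N] by blast
    interpret adapted_frame "?G p" "\<mu> p" e "\<eta> p" "ext_d1 K \<eta> p" J by (rule frame(1))
    interpret bundle_connection K T A
      using S assms(3,4) by unfold_locales (auto simp: sasakian_def complex_sasakian_bundle_def)
    have skew: "h p (F p a b *v x) y = - h p x (F p a b *v y)" for a b x y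
      by (rule curvature_skew_hermitian[OF curv h unitary])
    have h_add: "h p (a + b) z = h p a z + h p b z" and h_cnj: "h p z a = cnj (h p a z)" for a b z
      using h unfolding hermitian_metric_def by blast+
    have h_diff: "h p (a - b) z = h p a z - h p b z" for a b z
      using h_add[of "a - b" b z] by simp
    have h_add': "h p z (a + b) = h p z a + h p z b" and h_diff': "h p z (a - b) = h p z a - h p z b" for a b z
      unfolding h_cnj[of z] h_add h_diff by simp_all
    have xi: "F p (\<xi> p) (w p u) = 0" for u
    proof (rule hermitian_skew_split(1)[OF h, where p = p and N = "F p (\<xi> p) (\<Phi> p u)"])
      show "F p (\<xi> p) (w p u) *v x + \<i> *s (F p (\<xi> p) (\<Phi> p u) *v x) = 0" for x
        unfolding w_def by (rule curvature_Reeb[OF S hol int curv])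
    qed (rule skew)+
    \<comment> \<open>Contraction with \<open>\<xi>\<close> vanishes on horizontal vectors by
      \<open>xi\<close> and on \<open>\<xi>\<close> itself by skewness, so only the horizontal parts
      of the arguments matter.\<close>
    have Fw: "F p (w p a) (w p b) = F p a b" for a b
    proof -
      have F\<xi>: "F p (\<xi> p) u = 0" for u
        using xi[of u] F_self[OF alt, of p "\<xi> p"]
        by (simp add: w_def linear_diff[OF F_lin(2)] linear_scale[OF F_lin(2)])
      then have "F p u (\<xi> p) = 0" for u using F_skew[OF alt, of p u "\<xi> p"] by simp
      with F\<xi> show ?thesis
        by (simp add: w_def linear_diff[OF F_lin(1)] linear_scale[OF F_lin(1)] linear_diff[OF F_lin(2)] linear_scale[OF F_lin(2)])
    qed
    \<comment> \<open>Real and imaginary part are real combinations of skew-Hermitian matrices, so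
      they vanish separately; the real part is the \<open>\<Phi>\<close>-invariance.\<close>
    have "F p (w p a) (w p b) - F p (\<Phi> p a) (\<Phi> p b) = 0" for a b
    proof (rule hermitian_skew_split(1)[OF h, where p = p and
        N = "F p (w p a) (\<Phi> p b) + F p (\<Phi> p a) (w p b)"])
      show "(F p (w p a) (w p b) - F p (\<Phi> p a) (\<Phi> p b)) *v x
          + \<i> *s ((F p (w p a) (\<Phi> p b) + F p (\<Phi> p a) (w p b)) *v x) = 0" for x
        using HYM component_02_zero_iff[of F, OF F_lin, where p = p and \<eta> = \<eta> and \<xi> = \<xi> and \<Phi> = \<Phi> and u = a and v = b]
        unfolding transverse_HYM_def w_def by blast
    qed (simp_all add: matrix_vector_mult_diff_rdistrib matrix_vector_mult_add_rdistrib h_add h_diff h_add' h_diff' skew)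
    then have "F p (J a) (J b) = F p a b" for a b
      using frame(2) Fw[of a b] by (auto simp: F_neg)
    moreover have "contraction (F p) = 0"
      using HYM unfolding transverse_HYM_def inner_2form_adapted_frame[OF alt, symmetric] by blast
    ultimately show "form2 (F p) v = hodge (?G p) (\<mu> p) 5
        (wedge 3 2 (wedge 1 2 (form1 (\<eta> p)) (form2 (ext_d1 K \<eta> p))) (form2 (F p))) v"
      unfolding hodge_adapted_frame[OF alt] by (simp add: form2_def)
  qed
  ultimately show ?thesis by blast
qed

end
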